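(* Let $[a,b]\subset\mathbb{R}$ be a compact interval, let $n$ be a positive integer, and let $f:[a,b]\to\mathbb{R}$ be such that $f^{(n)}$ exists on $[a,b]$ and $f^{(n)}\in ACG_*$ on $[a,b]$ (so that $f^{(n+1)}$ exists almost everywhere and is Henstock--Kurzweil integrable). Put $$P_n(x)=\sum_{k=0}^n\frac{f^{(k)}(a)(x-a)^k}{k!},\qquad R_n(x)=f(x)-P_n(x)\qquad(x\in[a,b]).$$ Let $\|\cdot\|$ (no subscript) denote the Alexiewicz norm on $[a,b]$, $\|\cdot\|_{[a,x]}$ the Alexiewicz norm on $[a,x]$, and $\|\cdot\|_p$ the Lebesgue $p$-norm on $[a,b]$. Then $$\|R_n\|\leq \frac{(b-a)^{n+1}}{(n+1)!}\|f^{(n+1)}\|.$$ For all $x\in[a,b]$, $$|R_n(x)|\leq \frac{(x-a)^{n}}{n!}\|f^{(n+1)}\|_{[a,x]}.$$ And $$\|R_n\|_p\leq \frac{(b-a)^{n+1/p}}{n!\,(np+1)^{1/p}}\|f^{(n+1)}\|\quad (1\leq p<\infty),\qquad \|R_n\|_\infty\leq\frac{(b-a)^{n}}{n!}\|f^{(n+1)}\|.$$ Also, $$\|R_n\|_\infty\leq \frac{(b-a)^{n}}{n!}|f^{(n)}(a)| +\frac{(b-a)^{n}}{n!}\|f^{(n)}\|_\infty,$$ and, for $1\le p<\infty$, $$\|R_n\|_p\leq \frac{(b-a)^{n+1/p}}{n!\,(np+1)^{1/p}}|f^{(n)}(a)| +A,$$ where $A$ may be taken to be any one of the following quantities $A_1,A_2,A_3,A_4$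 (with $1/\alpha+1/\beta=1$, $1\le\alpha\le\infty$): - $A_1 = \dfrac{(b-a)^{n-1+1/p}\,\|f^{(n)}\|}{(n-1)!\,[(n-1)p+1]^{1/p}}$ for $n\geq 1$; and also, when $n=1$, $A_1=\|f(\cdot)-f(a)\|_p$; - $A_2 = \dfrac{(b-a)^{n-1+1/p+1/\beta}\,\|f^{(n)}\|_\alpha}{(n-1)!\,[(n-1)\beta +1]^{1/\beta}\,[(n-1+1/\beta)p+1]^{1/p}}$ for $1<\alpha\leq\infty$; and $A_2 = \dfrac{(b-a)^{n-1+1/p}\,\|f^{(n)}\|_1}{(n-1)!\,[(n-1)p+1]^{1/p}}$ for $\alpha=1$; - $A_3 = \dfrac{(b-a)^{1-1/p}}{(n-1)!\,[(n-1)p+1]^{1/p}}\left(\displaystyle\int_a^b|f^{(n)}(t)|^p(b-t)^{(n-1)p+1}\,dt\right)^{1/p}$; - $A_4 = \dfrac{(b-a)^{n(1-1/p)}}{n!}\left(\displaystyle\int_a^b|f^{(n)}(t)|^p(b-t)^{n}\,dt\right)^{1/p}$.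
   Context: Derivatives at the endpoints $a,b$ are one-sided. Henstock--Kurzweil integral: $g:[a,b]\to\mathbb{R}$ is Henstock--Kurzweil integrable with integral $A$ if for every $\varepsilon>0$ there is a function $\delta:[a,b]\to(0,\infty)$ such that $|\sum_i g(z_i)(x_i-x_{i-1})-A|<\varepsilon$ for every tagged partition $a=x_0<\dots<x_N=b$ with tags $z_i\in[x_{i-1},x_i]\subset(z_i-\delta(z_i),z_i+\delta(z_i))$. The integral is unaffected by changing $g$ on a Lebesgue null set, so functions defined only almost everywhere can be integrated (assign arbitrary values elsewhere). Integrals of $f^{(n+1)}$ are in this sense. The class $ACG_*$: a function $F:[a,b]\to\mathbb{R}$ is $AC_*$ on a set $E\subset[a,b]$ if for every $\varepsilon>0$ there is $\eta>0$ such that $\sum_i \sup_{s,t\in[c_i,d_i]}|F(s)-F(t)|<\varepsilon$ for every finite collection of non-overlapping intervals $[c_i,d_i]$ with endpoints in $E$ and $\sum_i(d_i-c_i)<\eta$. $F\in ACG_*$ on $[a,b]$ means that $F$ is continuous on $[a,b]$ and $[a,b]$ is a countable union of sets on each of which $F$ is $AC_*$. (Fundamental theorem: if $F\in ACG_*$ then $F'$ exists almost everywhere, $F'$ is Henstock--Kurzweil integrable, and $\int_a^xF'=F(x)-F(a)$ for all $x\in[a,b]$.) Alexiewicz norm: for $g$ Henstock--Kurzweil integrable on $I=[a,c]$, $\|g\|_{I}=\sup_{a\le x\le c}\left|\int_a^x g\right|$; the notation $\|g\|$ means $\|g\|_{[a,b]}$. *)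

theory Defs
  imports "HOL-Probability.Essential_Supremum"
begin

text \<open>
  Functions on \<open>[a, b]\<close> are total functions \<open>real \<Rightarrow> real\<close> of which only the values on \<open>{a..b}\<close>
  matter.  Derivatives are taken within \<open>{a..b}\<close>, hence one-sided at the endpoints.
  Where the derivative does not exist, \<^const>\<open>vector_derivative\<close> has an unspecified value, so
  the last iterate may also be used when the derivative exists only almost everywhere.
\<close>

fun nth_deriv_on :: "real set \<Rightarrow> nat \<Rightarrow> (real \<Rightarrow> real) \<Rightarrow> real \<Rightarrow> real" where
  "nth_deriv_on S 0 f = f"
| "nth_deriv_on S (Suc k) f = (\<lambda>x. vector_derivative (nth_deriv_on S k f) (at x within S))"

definition times_differentiable_on :: "nat \<Rightarrow> (real \<Rightarrow> real) \<Rightarrow> real set \<Rightarrow> bool" where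
  "times_differentiable_on n f S \<longleftrightarrow> (\<forall>k<n. nth_deriv_on S k f differentiable_on S)"

text \<open>
  A finite family of non-overlapping intervals is encoded as the finite set of its endpoint pairs.
  The oscillation is an \<^typ>\<open>ereal\<close>, so that it is \<open>\<infinity>\<close> where \<open>F\<close> is unbounded.
\<close>

definition oscillation :: "(real \<Rightarrow> real) \<Rightarrow> real set \<Rightarrow> ereal" where
  "oscillation F I = (SUP s\<in>I. SUP t\<in>I. ereal \<bar>F s - F t\<bar>)"

definition AC_star_on :: "(real \<Rightarrow> real) \<Rightarrow> real set \<Rightarrow> bool" where
  "AC_star_on F E \<longleftrightarrow>
    (\<forall>\<epsilon>>0. \<exists>\<eta>>0. \<forall>D :: (real \<times> real) set.
      finite D \<longrightarrow>
      (\<forall>(c, d)\<in>D. c \<in> E \<and> d \<in> E \<and> c \<le> d) \<longrightarrow>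
      pairwise (\<lambda>(c, d) (c', d'). {c<..<d} \<inter> {c'<..<d'} = {}) D \<longrightarrow>
      (\<Sum>(c, d)\<in>D. d - c) < \<eta> \<longrightarrow>
      (\<Sum>(c, d)\<in>D. oscillation F {c..d}) < ereal \<epsilon>)"

definition ACG_star_on :: "(real \<Rightarrow> real) \<Rightarrow> real \<Rightarrow> real \<Rightarrow> bool" where
  "ACG_star_on F a b \<longleftrightarrow>
    continuous_on {a..b} F \<and>
    (\<exists>E :: nat \<Rightarrow> real set. (\<Union>k. E k) = {a..b} \<and> (\<forall>k. AC_star_on F (E k)))"

text \<open>
  \<^const>\<open>integral\<close> is the Henstock--Kurzweil integral; the definition is meaningful for
  \<open>g integrable_on {a..c}\<close>.
\<close>

definition alexiewicz_norm :: "real \<Rightarrow> real \<Rightarrow> (real \<Rightarrow> real) \<Rightarrow> real" where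
  "alexiewicz_norm a c g = (SUP x\<in>{a..c}. \<bar>integral {a..x} g\<bar>)"

text \<open>
  The Lebesgue \<open>p\<close>-norm on \<open>[a, b]\<close> for \<open>1 \<le> p \<le> \<infinity>\<close>, with value \<open>\<infinity>\<close> for a measurable function
  outside \<open>L\<^sup>p\<close>.
\<close>

definition Lp_norm :: "ereal \<Rightarrow> real \<Rightarrow> real \<Rightarrow> (real \<Rightarrow> real) \<Rightarrow> ereal" where
  "Lp_norm p a b g =
    (if p = \<infinity> then esssup (lebesgue_on {a..b}) (\<lambda>x. ereal \<bar>g x\<bar>)
     else let J = (\<integral>\<^sup>+x. ennreal (\<bar>g x\<bar> powr real_of_ereal p) \<partial>lebesgue_on {a..b})
          in if J = \<infinity> then \<infinity> else ereal (enn2real J powr (1 / real_of_ereal p)))"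

definition taylor_poly :: "real \<Rightarrow> real \<Rightarrow> nat \<Rightarrow> (real \<Rightarrow> real) \<Rightarrow> real \<Rightarrow> real" where
  "taylor_poly a b n f x = (\<Sum>k\<le>n. nth_deriv_on {a..b} k f a * (x - a) ^ k / fact k)"

definition taylor_rem :: "real \<Rightarrow> real \<Rightarrow> nat \<Rightarrow> (real \<Rightarrow> real) \<Rightarrow> real \<Rightarrow> real" where
  "taylor_rem a b n f x = f x - taylor_poly a b n f x"

end

theory Submission
  imports Defs
begin

text \<open>
  The estimates come from the Cauchy form of the remainder: with \<open>F\<close> the \<open>n\<close>-th derivative, \<open>R\<^sub>n x\<close> is
  the integral over \<open>t\<close> of \<open>(x - t)\<^sup>n\<^sup>-\<^sup>1 / (n - 1)!\<close> times \<open>F t - F a\<close>, and \<open>F t - F a\<close> is the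
  Henstock--Kurzweil primitive of \<open>F'\<close>, hence bounded by the Alexiewicz norm.  The bounds with \<open>A\<close>
  split off \<open>F a\<close> by Minkowski's inequality and treat \<open>R\<^sub>n\<^sub>-\<^sub>1\<close> by the inequalities of Hoelder
  (for \<open>A\<^sub>2\<close>) and Jensen followed by Tonelli (for \<open>A\<^sub>3\<close> and \<open>A\<^sub>4\<close>).

  The fundamental theorem for \<open>ACG\<^sub>*\<close> functions has two halves.  Differentiability almost everywhere:
  a Vitali covering shows that an \<open>AC\<^sub>*\<close> function on \<open>E\<close> has finite derivates almost everywhere on
  \<open>E\<close>, and Stepanov's theorem upgrades this to differentiability.  Recovery of \<open>F\<close> from \<open>F'\<close>: on the
  exceptional null set a gauge makes the increments of \<open>F\<close> over tagged intervals sum to at most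
  \<open>\<epsilon>\<close>, and elsewhere the derivative controls them.
\<close>

section \<open>Differentiability of pointwise Lipschitz functions\<close>

text \<open>In \<open>AC_star_on\<close> both endpoints of an interval must lie in \<open>E\<close>,
  whereas the intervals of a Vitali cover or of a tagged division are only known to have their tag
  there. This shapes both halves of the fundamental theorem: intervals are made to start at their
  tag and are then lengthened until they end at a point of \<open>E\<close>. Lengthening is harmless
  because the oscillation over the longer interval dominates the increment over the shorter one.
  Starting at the tag makes every argument one-sided; the left-hand statements are the right-hand
  ones for the reflected function. The remainder estimates work with continuous functions only. Both
  \<open>R\<^sub>n\<close> and \<open>R\<^sub>n\<^sub>-\<^sub>1\<close> are integrals of a
  continuous function against a power kernel, and the derivative of
  \<open>f\<^sup>(\<^sup>n\<^sup>)\<close>, which may fail to be absolutely integrable, enters only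
  through increments of \<open>f\<^sup>(\<^sup>n\<^sup>)\<close>.\<close>

lemma primitive_has_derivative_ae:
  fixes h H :: "real \<Rightarrow> real"
  assumes H: "\<And>x y. x \<le> y \<Longrightarrow> (h has_integral H y - H x) {x..y}"
  obtains N where "negligible N" "\<And>x. x \<notin> N \<Longrightarrow> (H has_real_derivative h x) (at x)"
proof -
  have int: "h integrable_on cbox x y" for x y
    using H[of x y] by (cases "x \<le> y") (auto simp: integrable_on_def)
  have H': "((\<lambda>t. h (- t)) has_integral H (- x) - H (- y)) {x..y}" if "x \<le> y" for x y
    using has_integral_reflect_real[of h "H (- x) - H (- y)" "- x" "- y"] H[of "- y" "- x"] that by simp
  have int': "(\<lambda>t. h (-t)) integrable_on cbox x y" for x y
    using H'[of x y] by (cases "x \<le> y") (auto simp: integrable_on_def)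
  obtain N1 where N1: "negligible N1"
    and *: "\<And>x e. \<lbrakk>x \<notin> N1; 0 < e\<rbrakk> \<Longrightarrow>
               \<exists>d>0. \<forall>k. 0 < k \<and> k < d \<longrightarrow> \<bar>integral {x..x + k} h / k - h x\<bar> < e"
    by (rule integrable_ccontinuous_explicit[OF int]) (auto simp: divide_inverse_commute)
  \<comment> \<open>Only right-hand averages are controlled by
    \<open>integrable_ccontinuous_explicit\<close>. The left-hand averages of \<open>h\<close> at
    \<open>x\<close> are the right-hand averages of the reflected function at
    \<open>-x\<close>.\<close>
  obtain N2 where N2: "negligible N2"
    and **: "\<And>x e. \<lbrakk>x \<notin> N2; 0 < e\<rbrakk> \<Longrightarrow>
               \<exists>d>0. \<forall>k. 0 < k \<and> k < d \<longrightarrow> \<bar>integral {x..x + k} (\<lambda>t. h (-t)) / k - h (-x)\<bar> < e"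
    by (rule integrable_ccontinuous_explicit[OF int']) (auto simp: divide_inverse_commute)
  have "negligible (uminus ` N2)"
    using N2 by (rule negligible_differentiable_image_negligible[OF order_refl])
      (auto intro!: differentiable_on_minus simp: differentiable_on_ident)
  then have neg: "negligible (N1 \<union> uminus ` N2)"
    using N1 by simp
  have "(H has_real_derivative h x) (at x)" if "x \<notin> N1 \<union> uminus ` N2" for x
    unfolding DERIV_def
  proof (rule LIM_I)
    fix e :: real assume "0 < e"
    have "x \<notin> N1" using that by blast
    have "-x \<notin> N2" using that by (metis UnI2 image_eqI minus_minus)
    obtain d1 where d1: "d1 > 0" "\<And>k. 0 < k \<Longrightarrow> k < d1 \<Longrightarrow> \<bar>integral {x..x + k} h / k - h x\<bar> < e"
      using *[OF \<open>x \<notin> N1\<close> \<open>0 < e\<close>] by blast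
    obtain d2 where d2: "d2 > 0"
      "\<And>k. 0 < k \<Longrightarrow> k < d2 \<Longrightarrow> \<bar>integral {-x..-x + k} (\<lambda>t. h (-t)) / k - h x\<bar> < e"
      using **[OF \<open>-x \<notin> N2\<close> \<open>0 < e\<close>] by (auto; blast)
    have "\<bar>(H (x + k) - H x) / k - h x\<bar> < e" if "k \<noteq> 0" "\<bar>k\<bar> < min d1 d2" for k
    proof (cases "k > 0")
      case True
      then show ?thesis using d1(2)[of k] that integral_unique[OF H[of x "x + k"]] by simp
    next
      case False
      have eq: "(H (x + k) - H x) / k = (H x - H (x + k)) / - k"
        by (metis minus_diff_eq minus_divide_divide)
      have I: "integral {-x..-x + - k} (\<lambda>t. h (- t)) = H x - H (x + k)"
        using integral_unique[OF H'[of "-x" "-x + - k"]] False by (simp add: add.commute)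
      show ?thesis
        using False d2(2)[of "- k"] that unfolding I eq by simp
    qed
    then show "\<exists>s>0. \<forall>k. k \<noteq> 0 \<and> norm (k - 0) < s \<longrightarrow> norm ((H (x + k) - H x) / k - h x) < e"
      using d1(1) d2(1) by (intro exI[of _ "min d1 d2"]) auto
  qed
  with neg show thesis by (rule that)
qed

text \<open>Adding a multiple of the identity makes \<open>G\<close> a bi-Lipschitz homeomorphism \<open>H\<close>. The image measure
  of Lebesgue measure under the inverse of \<open>H\<close> is absolutely continuous, since \<open>H\<close> preserves null
  sets, and its Radon--Nikodym density is a derivative of \<open>H\<close>.\<close>

lemma lipschitz_differentiable_ae:
  fixes G :: "real \<Rightarrow> real"
  assumes lip: "\<And>x y. \<bar>G x - G y\<bar> \<le> L * \<bar>x - y\<bar>"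
  obtains N where "negligible N" "\<And>x. x \<notin> N \<Longrightarrow> G differentiable (at x)"
proof -
  have "L \<ge> 0" using lip[of 1 0] by (simp add: abs_ge_zero order_trans[OF abs_ge_zero])
  \<comment> \<open>Slopes of \<open>G\<close> are at least \<open>- L\<close>, so those of
    \<open>H\<close> lie between \<open>1\<close> and \<open>2 * L + 1\<close>. The lower bound
    makes \<open>H\<close> a bijection, the upper one makes it preserve null sets.\<close>
  define H where "H x = G x + (L + 1) * x" for x
  have lower: "H y - H x \<ge> y - x" if "x \<le> y" for x y
    using lip[of y x] that by (auto simp: H_def algebra_simps abs_if split: if_splits)
  have lipH: "\<bar>H x - H y\<bar> \<le> (2 * L + 1) * \<bar>x - y\<bar>" for x y
  proof -
    have "H x - H y = (G x - G y) + (L + 1) * (x - y)" by (simp add: H_def algebra_simps)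
    then have "\<bar>H x - H y\<bar> \<le> \<bar>G x - G y\<bar> + \<bar>(L + 1) * (x - y)\<bar>" by linarith
    then show ?thesis using lip[of x y] \<open>L \<ge> 0\<close> by (simp add: abs_mult distrib_right)
  qed
  have strict: "strict_mono H"
  proof (rule strict_monoI)
    fix x y :: real assume "x < y" then show "H x < H y" using lower[of x y] by linarith
  qed
  then have inj: "inj H" by (simp add: strict_mono_imp_inj_on)
  have contH: "continuous_on UNIV H"
    by (rule lipschitz_on_continuous_on[of "2 * L + 1"])
      (use lipH \<open>L \<ge> 0\<close> in \<open>auto intro!: lipschitz_onI simp: dist_real_def\<close>)
  have surj: "surj H"
    unfolding surj_def
  proof
    fix y
    \<comment> \<open>\<open>H\<close> rises at least as fast as the identity, so a step of
      \<open>y - H 0\<close> from \<open>0\<close> reaches or passes the level \<open>y\<close>; the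
      sign decides which of \<open>u\<close> and \<open>v\<close> moves.\<close>
    define u where "u = min 0 (y - H 0)" 
    define v where "v = max 0 (y - H 0)"
    have "H u \<le> y" "y \<le> H v" "u \<le> v"
      using lower[of u 0] lower[of 0 v] by (auto simp: u_def v_def)
    then show "\<exists>x. y = H x"
      using IVT'[of H u y v] continuous_on_subset[OF contH] by blast
  qed
  then have bij: "bij H" using inj by (simp add: bij_def)
  define K where "K = inv H"
  have HK: "H (K y) = y" and KH: "K (H x) = x" for x y
    using surj inj by (auto simp: K_def surj_f_inv_f)
  have "mono K"
  proof (rule monoI)
    fix x y :: real assume "x \<le> y"
    then show "K x \<le> K y" using strict HK by (metis strict_mono_less_eq)
  qed
  then have measK: "K \<in> borel_measurable borel" by (rule borel_measurable_mono)
  define N where "N = distr lborel borel K"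
  have imageH: "K -` A = H ` A" for A
    using HK KH by (auto simp: image_iff) (metis)
  have emN: "emeasure N {x..y} = ennreal (H y - H x)" if "x \<le> y" for x y
  proof -
    have "K -` {x..y} = {H x..H y}"
      using strict HK by (auto simp: strict_mono_less_eq) (metis strict_mono_less_eq strict HK)+
    moreover have "H x \<le> H y" using that strict by (simp add: strict_mono_less_eq)
    ultimately show ?thesis unfolding N_def using measK by (simp add: emeasure_distr)
  qed
  have ac: "absolutely_continuous lborel N"
    unfolding absolutely_continuous_def
  proof
    fix A :: "real set" assume A: "A \<in> null_sets lborel"
    then have negA: "negligible A"
      by (simp add: negligible_iff_null_sets null_sets_completionI)
    have "negligible (H ` A)"
    proof (rule negligible_locally_Lipschitz_image[OF _ negA])
      fix x assume "x \<in> A"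
      show "\<exists>T B. open T \<and> x \<in> T \<and> (\<forall>y\<in>A \<inter> T. norm (H y - H x) \<le> B * norm (y - x))"
        using lipH by (intro exI[of _ UNIV] exI[of _ "2 * L + 1"]) auto
    qed simp
    moreover have "H ` A \<in> sets lborel"
      using null_setsD2[OF A] measurable_sets[OF measK, of A] by (simp flip: imageH)
    ultimately have "emeasure lborel (H ` A) = 0"
      by (simp add: negligible_iff_null_sets null_sets_completion_iff null_setsD1)
    then show "A \<in> null_sets N"
      using A measK by (auto simp: N_def null_sets_def emeasure_distr imageH)
  qed
  obtain h where h: "h \<in> borel_measurable lborel" "density lborel h = N"
    using sigma_finite_measure.Radon_Nikodym[OF lborel.sigma_finite_measure_axioms ac] by (auto simp: N_def)
  have nn: "(\<integral>\<^sup>+t\<in>{x..y}. h t \<partial>lborel) = ennreal (H y - H x)" if "x \<le> y" for x y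
  proof -
    have "emeasure (density lborel h) {x..y} = ennreal (H y - H x)"
      using emN[OF that] h(2) by simp
    then show ?thesis using h(1) by (simp add: emeasure_density)
  qed
  \<comment> \<open>The density \<open>h\<close> takes values in \<open>ennreal\<close>. Its
    integrals over bounded intervals are finite, so it is finite almost everywhere and can be
    replaced by the real function \<open>g\<close>.\<close>
  define g where "g t = enn2real (h t)" for t
  have fin: "AE t in lborel. h t < \<infinity>"
  proof -
    have "AE t in lborel. h t * indicator {- real n..real n} t \<noteq> \<infinity>" for n
      by (rule nn_integral_noteq_infinite) (use h nn[of "- real n" "real n"] in auto)
    then have "AE t in lborel. \<forall>n. h t * indicator {- real n..real n} t \<noteq> \<infinity>"
      by (simp add: AE_all_countable)
    then show ?thesis
    proof (rule AE_mp, intro AE_I2 impI)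
      fix t assume *: "\<forall>n. h t * indicator {- real n..real n} t \<noteq> \<infinity>"
      obtain n where "\<bar>t\<bar> \<le> real n" using real_arch_simple by blast
      then have "t \<in> {- real n..real n}" by auto
      with *[rule_format, of n] show "h t < \<infinity>" by (simp add: less_top)
    qed
  qed
  have int: "(g has_integral H y - H x) {x..y}" if "x \<le> y" for x y
  proof -
    have "((\<lambda>t. g t * indicator {x..y} t) has_integral H y - H x) UNIV"
    proof (rule nn_integral_has_integral)
      show "(\<lambda>t. g t * indicator {x..y} t) \<in> borel_measurable borel"
        using h(1) unfolding g_def by measurable
      have "(\<integral>\<^sup>+t. ennreal (g t * indicator {x..y} t) \<partial>lborel) = (\<integral>\<^sup>+t\<in>{x..y}. h t \<partial>lborel)"
        by (rule nn_integral_cong_AE, use fin in eventually_elim)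
          (auto simp: g_def indicator_def)
      then show "(\<integral>\<^sup>+t. ennreal (g t * indicator {x..y} t) \<partial>lborel) = ennreal (H y - H x)"
        using nn[OF that] by simp
    qed (use lower[OF that] that in \<open>auto simp: g_def\<close>)
    then show ?thesis
      by (simp add: indicator_def of_bool_def if_distrib mult_if_delta cong: if_cong flip: has_integral_restrict_UNIV[of "{x..y}"])
  qed
  obtain M where M: "negligible M" "\<And>x. x \<notin> M \<Longrightarrow> (H has_real_derivative g x) (at x)"
    using primitive_has_derivative_ae[OF int] by blast
  have "G differentiable (at x)" if "x \<notin> M" for x
  proof -
    have "((\<lambda>t. H t - (L + 1) * t) has_real_derivative (g x - (L + 1))) (at x)"
      by (auto intro!: derivative_eq_intros M(2)[OF that])
    then show ?thesis by (auto simp: H_def real_differentiable_def)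
  qed
  with M(1) show thesis by (rule that)
qed

text \<open>\<open>F\<close> agrees on \<open>S\<close> with a Lipschitz function \<open>G\<close>, and near \<open>S\<close> their difference is at most a
  multiple of the distance to \<open>S\<close>. That distance is itself Lipschitz, so almost everywhere on \<open>S\<close> it
  has derivative \<open>0\<close>; no density theorem is needed.\<close>

lemma stepanov_piece:
  fixes F :: "real \<Rightarrow> real"
  assumes k: "k \<ge> 0" and r: "r > 0"
    and F: "\<And>x y. x \<in> S \<Longrightarrow> \<bar>y - x\<bar> < r \<Longrightarrow> \<bar>F y - F x\<bar> \<le> k * \<bar>y - x\<bar>"
    and S: "\<And>x y. x \<in> S \<Longrightarrow> y \<in> S \<Longrightarrow> \<bar>y - x\<bar> < r"
  shows "negligible {x \<in> S. \<not> F differentiable (at x)}"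
proof (cases "S = {}")
  case False
  then obtain s0 where s0: "s0 \<in> S" by blast
  \<comment> \<open>McShane's extension of \<open>F\<close> from \<open>S\<close>. Any two points of
    \<open>S\<close> are closer than \<open>r\<close>, so \<open>F\<close> is
    \<open>k\<close>-Lipschitz on \<open>S\<close>.\<close>
  define G where "G y = (INF s\<in>S. F s + k * \<bar>y - s\<bar>)" for y
  have low: "F s0 - k * \<bar>y - s0\<bar> \<le> F s + k * \<bar>y - s\<bar>" if "s \<in> S" for y s
  proof -
    have "F s0 - F s \<le> k * \<bar>s0 - s\<bar>" using F[OF that, of s0] S[OF that s0] by simp
    also have "\<dots> \<le> k * (\<bar>y - s0\<bar> + \<bar>y - s\<bar>)" by (intro mult_left_mono k) linarith
    finally show ?thesis by (simp add: distrib_left)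
  qed
  have bdd: "bdd_below ((\<lambda>s. F s + k * \<bar>y - s\<bar>) ` S)" for y
    by (rule bdd_belowI2[where m = "F s0 - k * \<bar>y - s0\<bar>"]) (rule low)
  have G_le: "G y \<le> G z + k * \<bar>y - z\<bar>" for y z
  proof -
    have "G y - k * \<bar>y - z\<bar> \<le> F s + k * \<bar>z - s\<bar>" if "s \<in> S" for s
    proof -
      have "G y \<le> F s + k * \<bar>y - s\<bar>" unfolding G_def by (rule cINF_lower[OF bdd that])
      also have "\<dots> \<le> F s + k * (\<bar>y - z\<bar> + \<bar>z - s\<bar>)"
        by (intro add_left_mono mult_left_mono k) linarith
      finally show ?thesis by (simp add: distrib_left)
    qed
    then have "G y - k * \<bar>y - z\<bar> \<le> G z" 
      unfolding G_def[of z] by (intro cINF_greatest[OF False]) blast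
    then show ?thesis by simp
  qed
  have lipG: "\<bar>G x - G y\<bar> \<le> k * \<bar>x - y\<bar>" for x y
    using G_le[of x y] G_le[of y x] by (simp add: abs_minus_commute abs_le_iff)
  have GF: "G x = F x" if "x \<in> S" for x
  proof (rule antisym)
    show "G x \<le> F x" using cINF_lower[OF bdd that, of x] by (simp add: G_def)
    show "F x \<le> G x" unfolding G_def
    proof (rule cINF_greatest[OF False])
      fix s assume "s \<in> S"
      then show "F x \<le> F s + k * \<bar>x - s\<bar>" using F[OF \<open>s \<in> S\<close>, of x] S[OF \<open>s \<in> S\<close> that] by simp
    qed
  qed
  obtain N1 where N1: "negligible N1" "\<And>x. x \<notin> N1 \<Longrightarrow> G differentiable (at x)"
    using lipschitz_differentiable_ae[OF lipG] by blast
  have "\<bar>infdist x S - infdist y S\<bar> \<le> 1 * \<bar>x - y\<bar>" for x y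
    using infdist_triangle_abs[of x S y] by (simp add: dist_real_def)
  then obtain N2 where N2: "negligible N2" "\<And>x. x \<notin> N2 \<Longrightarrow> (\<lambda>x. infdist x S) differentiable (at x)"
    using lipschitz_differentiable_ae[of "\<lambda>x. infdist x S" 1] by blast
  have "F differentiable (at x)" if x: "x \<in> S" "x \<notin> N1 \<union> N2" for x
  proof -
    obtain l where l: "((\<lambda>x. infdist x S) has_real_derivative l) (at x)"
      using N2(2)[of x] x by (auto simp: real_differentiable_def)
    \<comment> \<open>The distance to \<open>S\<close> attains its minimum \<open>0\<close> at
      \<open>x\<close>. With derivative \<open>0\<close> there, \<open>S\<close> has a point within
      \<open>c * \<bar>h\<bar>\<close> of \<open>x + h\<close> for small \<open>h\<close>, for any
      given \<open>c > 0\<close>.\<close>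
    have "l = 0"
      using DERIV_local_min[OF l, of 1] x by (simp add: infdist_nonneg)
    have "((\<lambda>x. F x - G x) has_real_derivative 0) (at x)"
      unfolding DERIV_def
    proof (rule LIM_I)
      fix e :: real assume "0 < e"
      \<comment> \<open>\<open>F\<close> and \<open>G\<close> each vary by at most
        \<open>k * c * \<bar>h\<bar>\<close> between \<open>x + h\<close> and a nearby point of
        \<open>S\<close>, whence \<open>2 * k * c < e\<close>. The bound \<open>c \<le> 1\<close>
        keeps that point within \<open>r\<close> of \<open>x + h\<close>.\<close>
      define c where "c = min 1 (e / (2 * k + 1))"
      have c: "0 < c" "c \<le> 1" and ce: "2 * k * c < e"
      proof -
        show "0 < c" using \<open>0 < e\<close> k by (simp add: c_def)
        show "c \<le> 1" by (simp add: c_def)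
        have "c \<le> e / (2 * k + 1)" by (simp add: c_def)
        then have "c * (2 * k + 1) \<le> e" using k by (simp add: pos_le_divide_eq)
        then show "2 * k * c < e" using \<open>0 < c\<close> by (simp add: algebra_simps)
      qed
      obtain s where s: "s > 0"
        "\<And>h. h \<noteq> 0 \<Longrightarrow> \<bar>h\<bar> < s \<Longrightarrow> \<bar>(infdist (x + h) S - infdist x S) / h\<bar> < c"
        using LIM_D[OF l[unfolded DERIV_def \<open>l = 0\<close>] \<open>0 < c\<close>] by auto
      have "\<bar>(F (x + h) - G (x + h) - (F x - G x)) / h\<bar> < e" if h: "h \<noteq> 0" "\<bar>h\<bar> < min s r" for h
      proof -
        have "infdist (x + h) S < c * \<bar>h\<bar>"
          using s(2)[of h] h x by (simp add: abs_divide pos_divide_less_eq infdist_nonneg)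
        then have "(INF a\<in>S. dist (x + h) a) < c * \<bar>h\<bar>"
          using False by (simp add: infdist_def)
        then obtain t where t: "t \<in> S" "\<bar>x + h - t\<bar> < c * \<bar>h\<bar>"
          using False by (subst (asm) cINF_less_iff)
            (auto simp: dist_real_def intro: bdd_belowI2[where m = 0])
        have "c * \<bar>h\<bar> \<le> 1 * \<bar>h\<bar>" by (intro mult_right_mono c) simp
        then have "\<bar>x + h - t\<bar> < r" using t h by linarith
        then have "\<bar>F (x + h) - F t\<bar> \<le> k * \<bar>x + h - t\<bar>" by (rule F[OF t(1)])
        moreover have "\<bar>G (x + h) - G t\<bar> \<le> k * \<bar>x + h - t\<bar>" by (rule lipG)
        moreover have "k * \<bar>x + h - t\<bar> \<le> k * (c * \<bar>h\<bar>)"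
          using t by (intro mult_left_mono k) simp
        ultimately have "\<bar>F (x + h) - G (x + h)\<bar> \<le> 2 * k * c * \<bar>h\<bar>"
          using GF[OF t(1)] by simp
        also have "\<dots> < e * \<bar>h\<bar>" using ce h by (intro mult_strict_right_mono) auto
        finally show ?thesis using GF[OF x(1)] h by (simp add: abs_divide pos_divide_less_eq)
      qed
      then show "\<exists>s>0. \<forall>h. h \<noteq> 0 \<and> norm (h - 0) < s \<longrightarrow>
          norm ((F (x + h) - G (x + h) - (F x - G x)) / h - 0) < e"
        using s(1) r by (intro exI[of _ "min s r"]) auto
    qed
    then have "(\<lambda>x. F x - G x) differentiable (at x)" by (auto simp: real_differentiable_def)
    moreover have "G differentiable (at x)" using N1(2) x by blast
    ultimately have "(\<lambda>x. F x - G x + G x) differentiable (at x)" by (rule differentiable_add)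
    then show ?thesis by simp
  qed
  then have "{x \<in> S. \<not> F differentiable (at x)} \<subseteq> N1 \<union> N2" by blast
  then show ?thesis using N1(1) N2(1) by (meson negligible_Un negligible_subset)
qed simp

text \<open>\<open>stepanov_piece\<close> needs one Lipschitz constant, one radius and a diameter
  below that radius. Sorting points by an integer that serves as constant and inverse radius, and by
  a rational within half the radius, gives countably many such pieces.\<close>

lemma pointwise_lipschitz_differentiable_ae:
  fixes F :: "real \<Rightarrow> real"
  assumes A: "\<And>x. x \<in> A \<Longrightarrow> \<exists>K d. d > 0 \<and> (\<forall>y. \<bar>y - x\<bar> < d \<longrightarrow> \<bar>F y - F x\<bar> \<le> K * \<bar>y - x\<bar>)"
  shows "negligible {x \<in> A. \<not> F differentiable (at x)}"
proof -
  define S where "S n q = {x. \<bar>x - q\<bar> < 1 / (2 * real (Suc n)) \<and>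
    (\<forall>y. \<bar>y - x\<bar> < 1 / real (Suc n) \<longrightarrow> \<bar>F y - F x\<bar> \<le> real (Suc n) * \<bar>y - x\<bar>)}" for n q
  have "negligible {x \<in> S n q. \<not> F differentiable (at x)}" for n q
  proof (rule stepanov_piece[of "real (Suc n)" "1 / real (Suc n)"])
    fix x y assume "x \<in> S n q" "y \<in> S n q"
    then have "\<bar>x - q\<bar> < 1 / (2 * real (Suc n))" "\<bar>y - q\<bar> < 1 / (2 * real (Suc n))"
      by (auto simp: S_def)
    then have "\<bar>y - x\<bar> < 1 / (2 * real (Suc n)) + 1 / (2 * real (Suc n))" by linarith
    then show "\<bar>y - x\<bar> < 1 / real (Suc n)" by (simp add: field_simps)
  qed (auto simp: S_def)
  then have "negligible (\<Union>n. \<Union>q\<in>\<rat>. {x \<in> S n q. \<not> F differentiable (at x)})"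
    by (intro negligible_countable_Union) (auto simp: countable_rat)
  moreover have "\<exists>n. \<exists>q\<in>\<rat>. x \<in> S n q" if "x \<in> A" for x
  proof -
    obtain K d where d: "d > 0" "\<And>y. \<bar>y - x\<bar> < d \<Longrightarrow> \<bar>F y - F x\<bar> \<le> K * \<bar>y - x\<bar>"
      using A[OF \<open>x \<in> A\<close>] by blast
    obtain n where n: "max K (1 / d) \<le> real n" using real_arch_simple by blast
    have "1 / real (Suc n) < d"
    proof -
      have "1 / d < real (Suc n)" using n by simp
      then show ?thesis using d(1) by (simp add: field_simps)
    qed
    moreover have "K * \<bar>y - x\<bar> \<le> real (Suc n) * \<bar>y - x\<bar>" for y
      using n by (intro mult_right_mono) auto
    ultimately have *: "\<bar>F y - F x\<bar> \<le> real (Suc n) * \<bar>y - x\<bar>" if "\<bar>y - x\<bar> < 1 / real (Suc n)" for y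
      using d(2)[of y] that by (meson order_trans less_trans)
    have "x < x + 1 / (2 * real (Suc n))" by simp
    then obtain q where "q \<in> \<rat>" "x < q" "q < x + 1 / (2 * real (Suc n))"
      using Rats_dense_in_real by blast
    then have "x \<in> S n q" using * unfolding S_def by auto
    with \<open>q \<in> \<rat>\<close> show ?thesis by blast
  qed
  ultimately show ?thesis
    by (elim negligible_subset) blast
qed

section \<open>Almost everywhere differentiability of \<open>AC\<^sub>*\<close> functions\<close>

text \<open>Two nondegenerate intervals with the same left endpoint overlap, so the left endpoint
  identifies an interval of the family. This lets families indexed by pairs be treated as a set of
  tags with one function of the tag.\<close>

lemma reindex_by_left_endpoint:
  fixes x v :: "'i \<Rightarrow> real"
  assumes less: "\<And>i. i \<in> D \<Longrightarrow> x i < v i"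
    and disj: "\<And>i j. i \<in> D \<Longrightarrow> j \<in> D \<Longrightarrow> i \<noteq> j \<Longrightarrow> {x i<..<v i} \<inter> {x j<..<v j} = {}"
  obtains w where "inj_on x D" "\<And>i. i \<in> D \<Longrightarrow> w (x i) = v i"
    "\<And>z z'. z \<in> x ` D \<Longrightarrow> z' \<in> x ` D \<Longrightarrow> z < z' \<Longrightarrow> w z \<le> z'"
proof -
  have sep: "v i \<le> x j" if ij: "i \<in> D" "j \<in> D" "i \<noteq> j" "x i \<le> x j" for i j
  proof (rule ccontr)
    assume "\<not> v i \<le> x j"
    then have "x j < min (v i) (v j)" using less[OF ij(2)] by simp
    then obtain t where "x j < t" "t < min (v i) (v j)" using dense by blast
    then have "t \<in> {x i<..<v i} \<inter> {x j<..<v j}" using ij by auto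
    then show False using disj ij by blast
  qed
  have inj: "inj_on x D"
    by (rule inj_onI) (metis sep less less_le_not_le order_refl)
  define w where "w z = v (the_inv_into D x z)" for z
  have w: "w (x i) = v i" if "i \<in> D" for i
    using that inj by (simp add: w_def the_inv_into_f_f)
  show thesis
  proof (rule that[OF inj w])
    fix z z' assume "z \<in> x ` D" "z' \<in> x ` D" "z < z'"
    then show "w z \<le> z'" using sep w by (metis imageE less_imp_le less_irrefl)
  qed
qed

text \<open>The tagged intervals \<open>{z..v z}\<close> have only their left endpoints in \<open>E\<close>. They are enlarged to
  the non-overlapping intervals from \<open>z\<close> to the next tag or to \<open>e z\<close>, whichever comes first.\<close>

lemma AC_star_sum_tags:
  fixes F :: "real \<Rightarrow> real" and T :: "real set"
  assumes AC: "\<And>D. finite D \<Longrightarrow> (\<forall>(c, d)\<in>D. c \<in> E \<and> d \<in> E \<and> c \<le> d) \<Longrightarrow>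
      pairwise (\<lambda>(c, d) (c', d'). {c<..<d} \<inter> {c'<..<d'} = {}) D \<Longrightarrow>
      (\<Sum>(c, d)\<in>D. d - c) < \<eta> \<Longrightarrow> (\<Sum>(c, d)\<in>D. oscillation F {c..d}) < ereal \<epsilon>"
    and T: "finite T" "T \<subseteq> E"
    and e: "\<And>z. z \<in> T \<Longrightarrow> e z \<in> E" "\<And>z. z \<in> T \<Longrightarrow> z \<le> v z" "\<And>z. z \<in> T \<Longrightarrow> v z \<le> e z"
      "\<And>z. z \<in> T \<Longrightarrow> {z..e z} \<subseteq> U"
    and next_tag: "\<And>z z'. z \<in> T \<Longrightarrow> z' \<in> T \<Longrightarrow> z < z' \<Longrightarrow> v z \<le> z'"
    and U: "U \<in> lmeasurable" "measure lebesgue U < \<eta>"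
  shows "(\<Sum>z\<in>T. \<bar>F (v z) - F z\<bar>) < \<epsilon>"
proof -
  define w where "w z = Min (insert (e z) {t \<in> T. z < t})" for z
  have win: "w z \<in> insert (e z) {t \<in> T. z < t}" for z
    unfolding w_def using T by (intro Min_in) auto
  have wE: "w z \<in> E" if "z \<in> T" for z using win[of z] e(1)[OF that] T by auto
  have vw: "v z \<le> w z" if "z \<in> T" for z using win[of z] e(3)[OF that] next_tag[OF that] by auto
  have we: "w z \<le> e z" for z unfolding w_def using T by (intro Min_le) auto
  have wn: "w z \<le> z'" if "z' \<in> T" "z < z'" for z z'
    unfolding w_def using T that by (intro Min_le) auto
  have zw: "z \<le> w z" if "z \<in> T" for z using vw e(2) that by force
  have disj: "{z<..<w z} \<inter> {z'<..<w z'} = {}" if "z \<in> T" "z' \<in> T" "z \<noteq> z'" for z z'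
    using that
  proof (induction z z' rule: linorder_wlog)
    case (le z z')
    then have "w z \<le> z'" using wn by simp
    then show ?case by auto
  qed (metis inf_commute)
  define D where "D = (\<lambda>z. (z, w z)) ` T"
  have inj: "inj_on (\<lambda>z. (z, w z)) T" by (auto intro: inj_onI)
  have sums: "(\<Sum>(c, d)\<in>D. h c d) = (\<Sum>z\<in>T. h z (w z))" for h :: "real \<Rightarrow> real \<Rightarrow> 'c::comm_monoid_add"
    unfolding D_def by (subst sum.reindex[OF inj]) simp
  have "(\<Sum>(c, d)\<in>D. oscillation F {c..d}) < ereal \<epsilon>"
  proof (rule AC)
    show "finite D" using T by (simp add: D_def)
    show "\<forall>(c, d)\<in>D. c \<in> E \<and> d \<in> E \<and> c \<le> d" using wE zw T by (auto simp: D_def)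
    show "pairwise (\<lambda>(c, d) (c', d'). {c<..<d} \<inter> {c'<..<d'} = {}) D"
      unfolding D_def pairwise_def using disj by auto
    have "(\<Sum>(c, d)\<in>D. d - c) = (\<Sum>z\<in>T. measure lebesgue {z<..<w z})"
      unfolding sums using zw by (intro sum.cong) auto
    also have "\<dots> = measure lebesgue (\<Union>z\<in>T. {z<..<w z})"
      using T disj by (intro measure_finite_Union[symmetric]) (auto simp: disjoint_family_on_def emeasure_lborel_Ioo zw)
    also have "\<dots> \<le> measure lebesgue U"
    proof (rule measure_mono_fmeasurable)
      show "(\<Union>z\<in>T. {z<..<w z}) \<subseteq> U"
      proof clarify
        fix z t assume "z \<in> T" "t \<in> {z<..<w z}"
        then have "t \<in> {z..e z}" using we[of z] by auto
        then show "t \<in> U" using e(4)[OF \<open>z \<in> T\<close>] by blast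
      qed
    qed (use U T in auto)
    finally show "(\<Sum>(c, d)\<in>D. d - c) < \<eta>" using U by simp
  qed
  \<comment> \<open>Here the oscillation, rather than the increment between endpoints, is essential:
    \<open>v z\<close> lies inside the enlarged interval but need not belong to
    \<open>E\<close>.\<close>
  moreover have "ereal \<bar>F (v z) - F z\<bar> \<le> oscillation F {z..w z}" if "z \<in> T" for z
    unfolding oscillation_def using zw[OF that] vw[OF that] e(2)[OF that]
    by (intro SUP_upper2[where i = "v z"] SUP_upper2[where i = z]) auto
  then have "(\<Sum>z\<in>T. ereal \<bar>F (v z) - F z\<bar>) \<le> (\<Sum>(c, d)\<in>D. oscillation F {c..d})"
    unfolding sums by (intro sum_mono) blast
  ultimately have "(\<Sum>z\<in>T. ereal \<bar>F (v z) - F z\<bar>) < ereal \<epsilon>"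
    by (rule le_less_trans[rotated])
  then show ?thesis by simp
qed

lemma AC_star_onE:
  assumes "AC_star_on F E" "\<epsilon> > 0"
  obtains \<eta> where "\<eta> > 0" "\<And>D. finite D \<Longrightarrow> (\<forall>(c, d)\<in>D. c \<in> E \<and> d \<in> E \<and> c \<le> d) \<Longrightarrow>
      pairwise (\<lambda>(c, d) (c', d'). {c<..<d} \<inter> {c'<..<d'} = {}) D \<Longrightarrow>
      (\<Sum>(c, d)\<in>D. d - c) < \<eta> \<Longrightarrow> (\<Sum>(c, d)\<in>D. oscillation F {c..d}) < ereal \<epsilon>"
  using assms unfolding AC_star_on_def by meson

text \<open>Intervals with endpoints in \<open>E\<close> stay inside \<open>{a..b}\<close>, so
  \<open>F\<close> may be replaced by an extension to the whole line.\<close>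

lemma AC_star_on_cong:
  assumes "AC_star_on F E" "E \<subseteq> {a..b}" "\<And>x. x \<in> {a..b} \<Longrightarrow> G x = F x"
  shows "AC_star_on G E"
  unfolding AC_star_on_def
proof (intro allI impI)
  fix \<epsilon> :: real assume "\<epsilon> > 0"
  with assms(1) obtain \<eta> where \<eta>: "\<eta> > 0" "\<And>D. finite D \<Longrightarrow> (\<forall>(c, d)\<in>D. c \<in> E \<and> d \<in> E \<and> c \<le> d) \<Longrightarrow>
      pairwise (\<lambda>(c, d) (c', d'). {c<..<d} \<inter> {c'<..<d'} = {}) D \<Longrightarrow>
      (\<Sum>(c, d)\<in>D. d - c) < \<eta> \<Longrightarrow> (\<Sum>(c, d)\<in>D. oscillation F {c..d}) < ereal \<epsilon>"
    by (rule AC_star_onE) blast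
  show "\<exists>\<eta>>0. \<forall>D. finite D \<longrightarrow> (\<forall>(c, d)\<in>D. c \<in> E \<and> d \<in> E \<and> c \<le> d) \<longrightarrow>
      pairwise (\<lambda>(c, d) (c', d'). {c<..<d} \<inter> {c'<..<d'} = {}) D \<longrightarrow>
      (\<Sum>(c, d)\<in>D. d - c) < \<eta> \<longrightarrow> (\<Sum>(c, d)\<in>D. oscillation G {c..d}) < ereal \<epsilon>"
  proof (intro exI[of _ \<eta>] conjI \<eta>(1) allI impI)
    fix D :: "(real \<times> real) set"
    assume D: "finite D" "\<forall>(c, d)\<in>D. c \<in> E \<and> d \<in> E \<and> c \<le> d"
      "pairwise (\<lambda>(c, d) (c', d'). {c<..<d} \<inter> {c'<..<d'} = {}) D" "(\<Sum>(c, d)\<in>D. d - c) < \<eta>"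
    have "oscillation G {c..d} = oscillation F {c..d}" if "(c, d) \<in> D" for c d
    proof -
      have "{c..d} \<subseteq> {a..b}" using D(2) that assms(2) by fastforce
      then show ?thesis unfolding oscillation_def using assms(3) by (intro SUP_cong refl) auto
    qed
    then have "(\<Sum>(c, d)\<in>D. oscillation G {c..d}) = (\<Sum>(c, d)\<in>D. oscillation F {c..d})"
      by (intro sum.cong) auto
    then show "(\<Sum>(c, d)\<in>D. oscillation G {c..d}) < ereal \<epsilon>" using \<eta>(2)[OF D] by simp
  qed
qed

lemma oscillation_reflect: "oscillation (\<lambda>x. F (- x)) {c..d} = oscillation F {-d..-c}"
proof -
  have "{-d..-c} = uminus ` {c..d}" by simp
  then show ?thesis unfolding oscillation_def by (simp only: image_image)
qed

lemma AC_star_on_reflect: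
  assumes "AC_star_on F E"
  shows "AC_star_on (\<lambda>x. F (- x)) (uminus ` E)"
  unfolding AC_star_on_def
proof (intro allI impI)
  fix \<epsilon> :: real assume "\<epsilon> > 0"
  with assms(1) obtain \<eta> where \<eta>: "\<eta> > 0" "\<And>D. finite D \<Longrightarrow> (\<forall>(c, d)\<in>D. c \<in> E \<and> d \<in> E \<and> c \<le> d) \<Longrightarrow>
      pairwise (\<lambda>(c, d) (c', d'). {c<..<d} \<inter> {c'<..<d'} = {}) D \<Longrightarrow>
      (\<Sum>(c, d)\<in>D. d - c) < \<eta> \<Longrightarrow> (\<Sum>(c, d)\<in>D. oscillation F {c..d}) < ereal \<epsilon>"
    by (rule AC_star_onE) blast
  show "\<exists>\<eta>>0. \<forall>D. finite D \<longrightarrow> (\<forall>(c, d)\<in>D. c \<in> uminus ` E \<and> d \<in> uminus ` E \<and> c \<le> d) \<longrightarrow>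
      pairwise (\<lambda>(c, d) (c', d'). {c<..<d} \<inter> {c'<..<d'} = {}) D \<longrightarrow>
      (\<Sum>(c, d)\<in>D. d - c) < \<eta> \<longrightarrow> (\<Sum>(c, d)\<in>D. oscillation (\<lambda>x. F (- x)) {c..d}) < ereal \<epsilon>"
  proof (intro exI[of _ \<eta>] conjI \<eta>(1) allI impI)
    fix D :: "(real \<times> real) set"
    assume D: "finite D" "\<forall>(c, d)\<in>D. c \<in> uminus ` E \<and> d \<in> uminus ` E \<and> c \<le> d"
      "pairwise (\<lambda>(c, d) (c', d'). {c<..<d} \<inter> {c'<..<d'} = {}) D" "(\<Sum>(c, d)\<in>D. d - c) < \<eta>"
    define D' where "D' = (\<lambda>(c, d). (-d, -c)) ` D"
    have sums: "(\<Sum>(c, d)\<in>D'. h c d) = (\<Sum>(c, d)\<in>D. h (-d) (-c))" for h :: "real \<Rightarrow> real \<Rightarrow> 'c::comm_monoid_add"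
      unfolding D'_def by (subst sum.reindex) (auto intro!: inj_onI sum.cong simp: case_prod_beta)
    have "(\<Sum>(c, d)\<in>D'. oscillation F {c..d}) < ereal \<epsilon>"
    proof (rule \<eta>(2))
      show "finite D'" using D by (simp add: D'_def)
      show "\<forall>(c, d)\<in>D'. c \<in> E \<and> d \<in> E \<and> c \<le> d" using D(2) by (force simp: D'_def)
      show "pairwise (\<lambda>(c, d) (c', d'). {c<..<d} \<inter> {c'<..<d'} = {}) D'"
      proof (rule pairwiseI)
        fix p q assume "p \<in> D'" "q \<in> D'" "p \<noteq> q"
        then obtain c d c' d' where *: "(c, d) \<in> D" "(c', d') \<in> D" "p = (-d, -c)" "q = (-d', -c')" "(c, d) \<noteq> (c', d')"
          by (auto simp: D'_def)
        then have "{c<..<d} \<inter> {c'<..<d'} = {}" using D(3) by (force simp: pairwise_def)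
        then have "{-d<..<-c} \<inter> {-d'<..<-c'} = {}" by (auto simp: min_def max_def split: if_splits)
        then show "(case p of (c, d) \<Rightarrow> \<lambda>(c', d'). {c<..<d} \<inter> {c'<..<d'} = {}) q" using * by simp
      qed
      show "(\<Sum>(c, d)\<in>D'. d - c) < \<eta>" using D(4) by (simp add: sums)
    qed
    then show "(\<Sum>(c, d)\<in>D. oscillation (\<lambda>x. F (- x)) {c..d}) < ereal \<epsilon>"
      by (simp add: sums oscillation_reflect)
  qed
qed

text \<open>At a point of \<open>?Z\<close> arbitrarily short intervals to the right have length
  below \<open>1 / K\<close> times the increment of \<open>F\<close>. A disjoint Vitali subfamily
  covers almost all of \<open>?Z\<close>, and since \<open>E\<close> fits into an interval shorter
  than \<open>\<eta>\<close>, the increments of any finite part sum to at most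
  \<open>1 + 2 * B\<close>. As \<open>K\<close> is arbitrary, the covered length is as small as
  desired.\<close>

lemma AC_star_piece_right_derivates:
  fixes F :: "real \<Rightarrow> real"
  assumes AC: "\<And>D. finite D \<Longrightarrow> (\<forall>(c, d)\<in>D. c \<in> E \<and> d \<in> E \<and> c \<le> d) \<Longrightarrow>
      pairwise (\<lambda>(c, d) (c', d'). {c<..<d} \<inter> {c'<..<d'} = {}) D \<Longrightarrow>
      (\<Sum>(c, d)\<in>D. d - c) < \<eta> \<Longrightarrow> (\<Sum>(c, d)\<in>D. oscillation F {c..d}) < ereal 1"
    and E: "E \<subseteq> {p..q}" "p \<le> q" "q - p < \<eta>"
    and B: "\<And>x. \<bar>F x\<bar> \<le> B"
  shows "negligible {x \<in> E. \<forall>K d. d > 0 \<longrightarrow> (\<exists>y. x < y \<and> y < x + d \<and> K * (y - x) < \<bar>F y - F x\<bar>)}"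
    (is "negligible ?Z")
  unfolding negligible_outer_le
proof (intro allI impI)
  fix e :: real assume "e > 0"
  have "B \<ge> 0" using B[of 0] by linarith
  \<comment> \<open>Chosen so that the final bound \<open>(1 + 2 * B) / K\<close> on the covered
    length equals \<open>e\<close>.\<close>
  define K where "K = (1 + 2 * B) / e"
  have "K > 0" using \<open>e > 0\<close> \<open>B \<ge> 0\<close> by (simp add: K_def)
  define I where "I = {(x, y). x \<in> ?Z \<and> x < y \<and> K * (y - x) < \<bar>F y - F x\<bar>}"
  \<comment> \<open>The covering theorem speaks of balls, so \<open>{x..y}\<close> is written as the
    closed ball about its midpoint; the point \<open>x\<close> to be covered sits on its
    boundary.\<close>
  define c where "c = (\<lambda>(x, y). (x + y) / 2 :: real)"
  define r where "r = (\<lambda>(x, y). (y - x) / 2 :: real)"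
  have cball: "cball (c i) (r i) = {fst i..snd i}" for i
    by (cases i) (simp add: cball_eq_atLeastAtMost c_def r_def field_simps)
  have "\<exists>i. i \<in> I \<and> x \<in> cball (c i) (r i) \<and> r i < d" if "x \<in> ?Z" "0 < d" for x d
  proof -
    obtain y where "x < y" "y < x + d" "K * (y - x) < \<bar>F y - F x\<bar>" using \<open>x \<in> ?Z\<close> \<open>0 < d\<close> by blast
    then show ?thesis using that unfolding cball
      by (intro exI[of _ "(x, y)"]) (auto simp: I_def r_def)
  qed
  then obtain C where C: "countable C" "C \<subseteq> I"
     "pairwise (\<lambda>i j. disjnt (cball (c i) (r i)) (cball (c j) (r j))) C"
     "negligible (?Z - (\<Union>i \<in> C. cball (c i) (r i)))"
    using Vitali_covering_theorem_cballs[of I r ?Z c] by (force simp: I_def r_def)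
  have fin: "measure lebesgue (\<Union>i\<in>D. cball (c i) (r i)) \<le> e" if "D \<subseteq> C" "finite D" for D
  proof (cases "D = {}")
    case False
    have DI: "fst i \<in> E" "fst i < snd i" "K * (snd i - fst i) < \<bar>F (snd i) - F (fst i)\<bar>"
      if "i \<in> D" for i
      using \<open>D \<subseteq> C\<close> C(2) that by (auto simp: I_def)
    have dis: "{fst i..snd i} \<inter> {fst j..snd j} = {}" if "i \<in> D" "j \<in> D" "i \<noteq> j" for i j
      using C(3) \<open>D \<subseteq> C\<close> that unfolding pairwise_def cball by (metis disjnt_def subsetD)
    have "{fst i<..<snd i} \<inter> {fst j<..<snd j} = {}" if "i \<in> D" "j \<in> D" "i \<noteq> j" for i j
    proof -
      have "{fst i<..<snd i} \<inter> {fst j<..<snd j} \<subseteq> {fst i..snd i} \<inter> {fst j..snd j}" by auto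
      then show ?thesis using dis[OF that] by blast
    qed
    then obtain w where w: "inj_on fst D" "\<And>i. i \<in> D \<Longrightarrow> w (fst i) = snd i"
        "\<And>z z'. z \<in> fst ` D \<Longrightarrow> z' \<in> fst ` D \<Longrightarrow> z < z' \<Longrightarrow> w z \<le> z'"
      using reindex_by_left_endpoint[of D fst snd] DI(2) by blast
    define T where "T = fst ` D"
    \<comment> \<open>To the right of the last tag no point of \<open>E\<close> is at hand, so its
      increment is estimated by \<open>2 * B\<close>. All earlier intervals end at or before
      \<open>m\<close>, which lies in \<open>E\<close> and serves them as common right end.\<close>
    define m where "m = Max T"
    have T: "finite T" "T \<noteq> {}" using \<open>finite D\<close> False by (auto simp: T_def)
    then have "m \<in> T" unfolding m_def by simp
    have TE: "T \<subseteq> E" using DI by (auto simp: T_def)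
    have lt: "z < m" if "z \<in> T - {m}" for z
      using Max_ge[OF T(1), of z] that by (auto simp: m_def)
    have zw: "z < w z" if "z \<in> T" for z using DI w(2) that by (auto simp: T_def)
    have "(\<Sum>z\<in>T - {m}. \<bar>F (w z) - F z\<bar>) < 1"
    proof (rule AC_star_sum_tags[OF AC, where e = "\<lambda>_. m" and U = "{p..q}"])
      fix z assume z: "z \<in> T - {m}"
      show "m \<in> E" using \<open>m \<in> T\<close> TE by blast
      show "z \<le> w z" using zw z by force
      show "w z \<le> m" using w(3) \<open>m \<in> T\<close> lt z by (auto simp: T_def)
      have "z \<in> {p..q}" "m \<in> {p..q}" using z TE E(1) \<open>m \<in> T\<close> by auto
      then show "{z..m} \<subseteq> {p..q}" by auto
    next
      fix z z' assume "z \<in> T - {m}" "z' \<in> T - {m}" "z < z'"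
      then show "w z \<le> z'" using w(3) by (auto simp: T_def)
    next
      show "measure lebesgue {p..q} < \<eta>" using E by simp
    qed (use T TE in auto)
    moreover have "\<bar>F (w m) - F m\<bar> \<le> 2 * B" using B[of "w m"] B[of m] by linarith
    ultimately have sumT: "(\<Sum>z\<in>T. \<bar>F (w z) - F z\<bar>) \<le> 1 + 2 * B"
      using T \<open>m \<in> T\<close> by (simp add: sum.remove[of T m])
    have "measure lebesgue (\<Union>i\<in>D. cball (c i) (r i)) \<le> (\<Sum>i\<in>D. measure lebesgue (cball (c i) (r i)))"
      using \<open>finite D\<close> by (intro measure_UNION_le) auto
    also have "\<dots> = (\<Sum>i\<in>D. snd i - fst i)"
      unfolding cball using DI by (intro sum.cong) (auto intro: less_imp_le)
    also have "\<dots> \<le> (\<Sum>i\<in>D. \<bar>F (snd i) - F (fst i)\<bar> / K)"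
      using DI(3) \<open>K > 0\<close> by (intro sum_mono) (simp add: pos_le_divide_eq mult.commute less_imp_le)
    also have "\<dots> = (\<Sum>z\<in>T. \<bar>F (w z) - F z\<bar>) / K"
      unfolding T_def by (subst sum.reindex[OF w(1)]) (simp add: sum_divide_distrib w(2))
    also have "\<dots> \<le> (1 + 2 * B) / K" using sumT \<open>K > 0\<close> by (intro divide_right_mono) auto
    also have "\<dots> = e" using \<open>e > 0\<close> \<open>B \<ge> 0\<close> by (simp add: K_def)
    finally show ?thesis .
  qed (use \<open>e > 0\<close> in simp)
  let ?U = "\<Union>i\<in>C. cball (c i) (r i)"
  have U: "?U \<in> lmeasurable" "measure lebesgue ?U \<le> e"
    using fmeasurable_UN_bound[OF C(1) _ fin] measure_UN_bound[OF C(1) _ fin] by auto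
  let ?N = "?Z - ?U"
  have "?N \<in> lmeasurable" using C(4) by (rule negligible_imp_measurable)
  moreover have "measure lebesgue (?N \<union> ?U) \<le> measure lebesgue ?N + measure lebesgue ?U"
    using U \<open>?N \<in> lmeasurable\<close> by (intro measure_Un_le) auto
  ultimately show "\<exists>T. ?Z \<subseteq> T \<and> T \<in> lmeasurable \<and> measure lebesgue T \<le> e"
    using U negligible_imp_measure0[OF C(4)]
    by (intro exI[of _ "?N \<union> ?U"] conjI fmeasurable.Un) auto
qed

text \<open>Negligibility is a local property, and a neighbourhood of radius
  \<open>\<eta> / 3\<close> has length less than \<open>\<eta>\<close>, as the piecewise version
  requires.\<close>

lemma AC_star_right_derivates:
  fixes F :: "real \<Rightarrow> real"
  assumes "AC_star_on F E" and B: "\<And>x. \<bar>F x\<bar> \<le> B"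
  shows "negligible {x \<in> E. \<forall>K d. d > 0 \<longrightarrow> (\<exists>y. x < y \<and> y < x + d \<and> K * (y - x) < \<bar>F y - F x\<bar>)}"
    (is "negligible ?Z")
proof -
  obtain \<eta> where \<eta>: "\<eta> > 0" "\<And>D. finite D \<Longrightarrow> (\<forall>(c, d)\<in>D. c \<in> E \<and> d \<in> E \<and> c \<le> d) \<Longrightarrow>
      pairwise (\<lambda>(c, d) (c', d'). {c<..<d} \<inter> {c'<..<d'} = {}) D \<Longrightarrow>
      (\<Sum>(c, d)\<in>D. d - c) < \<eta> \<Longrightarrow> (\<Sum>(c, d)\<in>D. oscillation F {c..d}) < ereal 1"
    using AC_star_onE[OF assms(1), of 1] by auto
  show ?thesis
    unfolding locally_negligible_alt[of ?Z]
  proof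
    fix x assume "x \<in> ?Z"
    let ?J = "{x - \<eta> / 3<..<x + \<eta> / 3}" and ?I = "{x - \<eta> / 3..x + \<eta> / 3}"
    have "negligible {x \<in> E \<inter> ?I. \<forall>K d. d > 0 \<longrightarrow> (\<exists>y. x < y \<and> y < x + d \<and> K * (y - x) < \<bar>F y - F x\<bar>)}"
    proof (rule AC_star_piece_right_derivates[OF _ _ _ _ B])
      fix D assume "finite D" "\<forall>(c, d)\<in>D. c \<in> E \<inter> ?I \<and> d \<in> E \<inter> ?I \<and> c \<le> d"
        "pairwise (\<lambda>(c, d) (c', d'). {c<..<d} \<inter> {c'<..<d'} = {}) D" "(\<Sum>(c, d)\<in>D. d - c) < \<eta>"
      then show "(\<Sum>(c, d)\<in>D. oscillation F {c..d}) < ereal 1"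
        by (intro \<eta>(2)) auto
    qed (use \<eta>(1) in auto)
    then have "negligible (?Z \<inter> ?J)" by (rule negligible_subset) auto
    moreover have "openin (top_of_set ?Z) (?Z \<inter> ?J)" by (rule openin_open_Int) simp
    ultimately show "\<exists>U. openin (top_of_set ?Z) U \<and> x \<in> U \<and> negligible U"
      using \<open>x \<in> ?Z\<close> \<eta>(1) by (intro exI[of _ "?Z \<inter> ?J"]) auto
  qed
qed

text \<open>Off two null sets the difference quotients of \<open>F\<close> and of its reflection
  stay bounded to the right of the point. The two one-sided bounds make \<open>F\<close> pointwise
  Lipschitz there.\<close>

lemma AC_star_differentiable_ae:
  fixes F :: "real \<Rightarrow> real"
  assumes AC: "AC_star_on F E" and B: "\<And>x. \<bar>F x\<bar> \<le> B"
  shows "negligible {x \<in> E. \<not> F differentiable (at x)}"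
proof -
  define Z where "Z G S = {x \<in> S. \<forall>K d. d > 0 \<longrightarrow> (\<exists>y. x < y \<and> y < x + d \<and> K * (y - x) < \<bar>G y - G x\<bar>)}"
    for G :: "real \<Rightarrow> real" and S
  have notZ: "\<exists>K d. d > 0 \<and> (\<forall>y. x < y \<longrightarrow> y < x + d \<longrightarrow> \<bar>G y - G x\<bar> \<le> K * (y - x))"
    if "x \<in> S" "x \<notin> Z G S" for G S x
    using that unfolding Z_def not_less[symmetric] by blast
  have 1: "negligible (Z F E)" unfolding Z_def by (rule AC_star_right_derivates[OF AC B])
  have 2: "negligible (Z (\<lambda>x. F (- x)) (uminus ` E))"
    unfolding Z_def by (rule AC_star_right_derivates[OF AC_star_on_reflect[OF AC]]) (rule B)
  have 3: "negligible (uminus ` Z (\<lambda>x. F (- x)) (uminus ` E))"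
    using 2 by (rule negligible_differentiable_image_negligible[OF order_refl])
      (auto intro!: differentiable_on_minus simp: differentiable_on_ident)
  let ?A = "E - (Z F E \<union> uminus ` Z (\<lambda>x. F (- x)) (uminus ` E))"
  have "negligible {x \<in> ?A. \<not> F differentiable (at x)}"
  proof (rule pointwise_lipschitz_differentiable_ae)
    fix x assume x: "x \<in> ?A"
    then have "x \<in> E" "x \<notin> Z F E" by auto
    then obtain K1 d1 where 1: "d1 > 0" "\<And>y. x < y \<Longrightarrow> y < x + d1 \<Longrightarrow> \<bar>F y - F x\<bar> \<le> K1 * (y - x)"
      using notZ by blast
    have "- x \<in> uminus ` E" using \<open>x \<in> E\<close> by blast
    moreover have "- x \<notin> Z (\<lambda>x. F (- x)) (uminus ` E)" using x by (metis DiffD2 UnI2 image_eqI minus_minus)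
    ultimately obtain K2 d2 where 2: "d2 > 0"
      "\<And>y. - x < y \<Longrightarrow> y < - x + d2 \<Longrightarrow> \<bar>F (- y) - F (- (- x))\<bar> \<le> K2 * (y - - x)"
      using notZ[of "- x" "uminus ` E" "\<lambda>x. F (- x)"] by blast
    have "\<bar>F y - F x\<bar> \<le> max K1 K2 * \<bar>y - x\<bar>" if "\<bar>y - x\<bar> < min d1 d2" for y
    proof (cases x y rule: linorder_cases)
      case less
      then have "\<bar>F y - F x\<bar> \<le> K1 * \<bar>y - x\<bar>" using 1(2)[of y] that by simp
      also have "\<dots> \<le> max K1 K2 * \<bar>y - x\<bar>" by (intro mult_right_mono) auto
      finally show ?thesis .
    next
      case greater
      then have "\<bar>F y - F x\<bar> \<le> K2 * \<bar>y - x\<bar>" using 2(2)[of "- y"] that by simp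
      also have "\<dots> \<le> max K1 K2 * \<bar>y - x\<bar>" by (intro mult_right_mono) auto
      finally show ?thesis .
    qed simp
    then show "\<exists>K d. d > 0 \<and> (\<forall>y. \<bar>y - x\<bar> < d \<longrightarrow> \<bar>F y - F x\<bar> \<le> K * \<bar>y - x\<bar>)"
      using 1(1) 2(1) by (intro exI[of _ "max K1 K2"] exI[of _ "min d1 d2"]) auto
  qed
  then have "negligible ({x \<in> ?A. \<not> F differentiable (at x)} \<union> Z F E \<union> uminus ` Z (\<lambda>x. F (- x)) (uminus ` E))"
    using 1 3 by simp
  then show ?thesis by (rule negligible_subset) blast
qed

section \<open>Null variation and the fundamental theorem for \<open>ACG\<^sub>*\<close> functions\<close>

text \<open>Half of a Henstock sum: a tagged interval is cut at its tag, and the right halves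
  \<open>{z..v z}\<close> are measured. Their right ends are unrestricted, since the endpoints of a
  fine division are arbitrary.\<close>

definition right_sums_le :: "(real \<Rightarrow> real) \<Rightarrow> real set \<Rightarrow> (real \<Rightarrow> real) \<Rightarrow> real \<Rightarrow> bool" where
  "right_sums_le F A \<delta> \<epsilon> \<longleftrightarrow> (\<forall>T v. finite T \<longrightarrow> T \<subseteq> A \<longrightarrow>
    (\<forall>z\<in>T. z \<le> v z \<and> v z < z + \<delta> z) \<longrightarrow> (\<forall>z\<in>T. \<forall>z'\<in>T. z < z' \<longrightarrow> v z \<le> z') \<longrightarrow>
    (\<Sum>z\<in>T. \<bar>F (v z) - F z\<bar>) \<le> \<epsilon>)"

text \<open>Only intervals to the right of their tags are considered; the left-hand version is obtained by
  applying this to \<open>\<lambda>x. F (- x)\<close> on the reflected set.\<close>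

definition null_right_variation :: "(real \<Rightarrow> real) \<Rightarrow> real set \<Rightarrow> bool" where
  "null_right_variation F A \<longleftrightarrow> (\<forall>\<epsilon>>0. \<exists>\<delta>. (\<forall>x\<in>A. 0 < \<delta> x) \<and> right_sums_le F A \<delta> \<epsilon>)"

lemma right_sums_leD:
  assumes "right_sums_le F A \<delta> \<epsilon>" "finite T" "T \<subseteq> A" "\<And>z. z \<in> T \<Longrightarrow> z \<le> v z \<and> v z < z + \<delta> z"
    "\<And>z z'. z \<in> T \<Longrightarrow> z' \<in> T \<Longrightarrow> z < z' \<Longrightarrow> v z \<le> z'"
  shows "(\<Sum>z\<in>T. \<bar>F (v z) - F z\<bar>) \<le> \<epsilon>"
  by (rule assms(1)[unfolded right_sums_le_def, rule_format]) (intro assms(2-5); assumption)+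

lemma null_right_variation_subset:
  assumes "null_right_variation F A" "B \<subseteq> A"
  shows "null_right_variation F B"
  unfolding null_right_variation_def
proof (intro allI impI)
  fix \<epsilon> :: real assume "\<epsilon> > 0"
  with assms(1) obtain \<delta> where \<delta>: "\<forall>x\<in>A. 0 < \<delta> x" "right_sums_le F A \<delta> \<epsilon>"
    unfolding null_right_variation_def by blast
  then have "right_sums_le F B \<delta> \<epsilon>"
    using assms(2) unfolding right_sums_le_def by (meson order_trans)
  with \<delta> assms(2) show "\<exists>\<delta>. (\<forall>x\<in>B. 0 < \<delta> x) \<and> right_sums_le F B \<delta> \<epsilon>" by blast
qed

lemma null_right_variation_countable_Union:
  assumes A: "\<And>n :: nat. null_right_variation F (A n)"
  shows "null_right_variation F (\<Union>n. A n)"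
  unfolding null_right_variation_def
proof (intro allI impI)
  fix \<epsilon> :: real assume "\<epsilon> > 0"
  then have "\<exists>\<delta>. (\<forall>x\<in>A n. 0 < \<delta> x) \<and> right_sums_le F (A n) \<delta> (\<epsilon> * (1 / 2) ^ Suc n)" for n
    by (intro A[of n, unfolded null_right_variation_def, rule_format]) simp
  then obtain \<delta> where \<delta>: "\<And>n x. x \<in> A n \<Longrightarrow> 0 < \<delta> n x"
    and le: "\<And>n. right_sums_le F (A n) (\<delta> n) (\<epsilon> * (1 / 2) ^ Suc n)"
    by metis
  \<comment> \<open>The sets may overlap. Assigning each point to the first set containing it gives
    a single gauge and splits any set of tags into groups, the \<open>n\<close>-th of which has the
    budget \<open>\<epsilon> / 2 ^ (n + 1)\<close>.\<close>
  define idx where "idx x = (LEAST n. x \<in> A n)" for x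
  have idx: "x \<in> A (idx x)" if "x \<in> (\<Union>n. A n)" for x
    using that unfolding idx_def by (auto intro: LeastI)
  have "right_sums_le F (\<Union>n. A n) (\<lambda>x. \<delta> (idx x) x) \<epsilon>"
    unfolding right_sums_le_def
  proof (intro allI impI)
    fix T and v :: "real \<Rightarrow> real"
    assume T: "finite T" "T \<subseteq> (\<Union>n. A n)" "\<forall>z\<in>T. z \<le> v z \<and> v z < z + \<delta> (idx z) z"
      "\<forall>z\<in>T. \<forall>z'\<in>T. z < z' \<longrightarrow> v z \<le> z'"
    have "(\<Sum>z\<in>T. \<bar>F (v z) - F z\<bar>) = (\<Sum>n\<in>idx ` T. \<Sum>z\<in>{z \<in> T. idx z = n}. \<bar>F (v z) - F z\<bar>)"
      by (rule sum.image_gen[OF T(1)])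
    also have "\<dots> \<le> (\<Sum>n\<in>idx ` T. \<epsilon> * (1 / 2) ^ Suc n)"
    proof (rule sum_mono)
      fix n
      show "(\<Sum>z\<in>{z \<in> T. idx z = n}. \<bar>F (v z) - F z\<bar>) \<le> \<epsilon> * (1 / 2) ^ Suc n"
      proof (rule right_sums_leD[OF le])
        show "{z \<in> T. idx z = n} \<subseteq> A n" using T(2) idx by blast
      qed (use T in auto)
    qed
    also have "\<dots> = \<epsilon> * (\<Sum>n\<in>idx ` T. (1 / 2) ^ Suc n)" by (simp only: sum_distrib_left)
    also have "\<dots> \<le> \<epsilon> * 1"
    proof (intro mult_left_mono)
      show "(\<Sum>n\<in>idx ` T. (1 / 2) ^ Suc n) \<le> (1 :: real)"
        using sum_le_suminf[OF sums_summable[OF power_half_series], of "idx ` T"]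
          sums_unique[OF power_half_series] T(1) by simp
    qed (use \<open>\<epsilon> > 0\<close> in simp)
    finally show "(\<Sum>z\<in>T. \<bar>F (v z) - F z\<bar>) \<le> \<epsilon>" by simp
  qed
  then show "\<exists>\<delta>. (\<forall>x\<in>\<Union>n. A n. 0 < \<delta> x) \<and> right_sums_le F (\<Union>n. A n) \<delta> \<epsilon>"
    using \<delta> idx by (intro exI[of _ "\<lambda>x. \<delta> (idx x) x"]) blast
qed

lemma null_right_variation_singleton:
  assumes "continuous_on UNIV F"
  shows "null_right_variation F {x}"
  unfolding null_right_variation_def
proof (intro allI impI)
  fix \<epsilon> :: real assume "\<epsilon> > 0"
  then obtain d where d: "d > 0" "\<And>y. dist y x < d \<Longrightarrow> dist (F y) (F x) < \<epsilon>"
    using assms unfolding continuous_on_iff by (metis UNIV_I)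
  have "right_sums_le F {x} (\<lambda>_. d) \<epsilon>"
    unfolding right_sums_le_def
  proof (intro allI impI)
    fix T and v :: "real \<Rightarrow> real"
    assume T: "T \<subseteq> {x}" "\<forall>z\<in>T. z \<le> v z \<and> v z < z + d"
    show "(\<Sum>z\<in>T. \<bar>F (v z) - F z\<bar>) \<le> \<epsilon>"
    proof (cases "T = {}")
      case False
      then have Tx: "T = {x}" using T by blast
      with T have "dist (v x) x < d" by (simp add: dist_real_def)
      from d(2)[OF this] show ?thesis by (simp add: Tx dist_real_def)
    qed (use \<open>\<epsilon> > 0\<close> in simp)
  qed
  then show "\<exists>\<delta>. (\<forall>x\<in>{x}. 0 < \<delta> x) \<and> right_sums_le F {x} \<delta> \<epsilon>"
    using d(1) by (intro exI[of _ "\<lambda>_. d"]) simp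
qed

lemma null_right_variation_countable:
  assumes "continuous_on UNIV F" "countable A"
  shows "null_right_variation F A"
proof (cases "A = {}")
  case True
  then show ?thesis using null_right_variation_subset[OF null_right_variation_singleton[OF assms(1)]] by blast
next
  case False
  have "null_right_variation F (\<Union>n. {from_nat_into A n})"
    by (intro null_right_variation_countable_Union null_right_variation_singleton assms)
  then show ?thesis using False assms(2) by (simp add: UNION_singleton_eq_range)
qed

lemma null_right_variation_Un:
  assumes "null_right_variation F A" "null_right_variation F B"
  shows "null_right_variation F (A \<union> B)"
proof -
  have "null_right_variation F (\<Union>n :: nat. if n = 0 then A else B)"
    by (rule null_right_variation_countable_Union) (use assms in simp)
  then show ?thesis by (rule null_right_variation_subset) (auto split: if_splits)
qed

text \<open>Cover \<open>N\<close> by an open set \<open>U\<close> of measure below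
  \<open>\<eta>\<close>, and to each \<open>x\<close> in \<open>N\<close> choose \<open>e x\<close>
  in \<open>E\<close> with \<open>{x..e x}\<close> inside \<open>U\<close>. The gauge
  \<open>e x - x\<close> makes fine intervals end before \<open>e x\<close>, so they can be
  lengthened within \<open>U\<close> to end in \<open>E\<close>.\<close>

lemma null_right_variation_AC_star_accumulating:
  fixes F :: "real \<Rightarrow> real"
  assumes AC: "AC_star_on F E" and N: "negligible N" "N \<subseteq> E"
    and acc: "\<And>x r. x \<in> N \<Longrightarrow> r > 0 \<Longrightarrow> \<exists>e\<in>E. x < e \<and> e < x + r"
  shows "null_right_variation F N"
  unfolding null_right_variation_def
proof (intro allI impI)
  fix \<epsilon> :: real assume "\<epsilon> > 0"
  with AC obtain \<eta> where \<eta>: "\<eta> > 0" "\<And>D. finite D \<Longrightarrow> (\<forall>(c, d)\<in>D. c \<in> E \<and> d \<in> E \<and> c \<le> d) \<Longrightarrow>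
      pairwise (\<lambda>(c, d) (c', d'). {c<..<d} \<inter> {c'<..<d'} = {}) D \<Longrightarrow>
      (\<Sum>(c, d)\<in>D. d - c) < \<eta> \<Longrightarrow> (\<Sum>(c, d)\<in>D. oscillation F {c..d}) < ereal \<epsilon>"
    by (rule AC_star_onE) blast
  obtain U where U: "N \<subseteq> U" "open U" "U \<in> lmeasurable" "measure lebesgue U < \<eta>"
  proof -
    \<comment> \<open>Outer approximation bounds the measure of \<open>U - N\<close> only; as
      \<open>N\<close> is null, it bounds that of \<open>U\<close>.\<close>
    have null: "N \<in> null_sets lebesgue" using N(1) by (simp add: negligible_iff_null_sets)
    obtain U where U: "open U" "N \<subseteq> U" "U - N \<in> lmeasurable" "emeasure lebesgue (U - N) < ennreal \<eta>"
      using sets_lebesgue_outer_open[of N \<eta>] \<eta>(1) null by (metis null_setsD2)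
    have "U \<in> sets lebesgue" using U(1) by simp
    then have "emeasure lebesgue U < ennreal \<eta>"
      using U(4) emeasure_Diff_null_set[OF null] by simp
    moreover from this have "U \<in> lmeasurable"
      using \<open>U \<in> sets lebesgue\<close> by (intro fmeasurableI) (auto intro: less_trans)
    ultimately have "U \<in> lmeasurable" "measure lebesgue U < \<eta>"
      by (auto simp: emeasure_eq_measure2 ennreal_less_iff)
    then show thesis using that U by blast
  qed
  have "\<exists>e. e \<in> E \<and> x < e \<and> {x..e} \<subseteq> U" if x: "x \<in> N" for x
  proof -
    obtain r where r: "r > 0" "ball x r \<subseteq> U" using U(1,2) x unfolding open_contains_ball by blast
    obtain e where e: "e \<in> E" "x < e" "e < x + r" using acc[OF x r(1)] by blast
    have "{x..e} \<subseteq> ball x r" using e by (auto simp: dist_real_def)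
    then show ?thesis using e r by blast
  qed
  then obtain e where e: "\<And>x. x \<in> N \<Longrightarrow> e x \<in> E \<and> x < e x \<and> {x..e x} \<subseteq> U" by metis
  have "right_sums_le F N (\<lambda>x. e x - x) \<epsilon>"
    unfolding right_sums_le_def
  proof (intro allI impI)
    fix T and v :: "real \<Rightarrow> real"
    assume T: "finite T" "T \<subseteq> N" "\<forall>z\<in>T. z \<le> v z \<and> v z < z + (e z - z)"
      "\<forall>z\<in>T. \<forall>z'\<in>T. z < z' \<longrightarrow> v z \<le> z'"
    have "(\<Sum>z\<in>T. \<bar>F (v z) - F z\<bar>) < \<epsilon>"
    proof (rule AC_star_sum_tags[OF \<eta>(2)])
      show "T \<subseteq> E" using T N by blast
      fix z assume z: "z \<in> T"
      then have "z \<in> N" using T(2) by blast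
      then show "e z \<in> E" "{z..e z} \<subseteq> U" using e by auto
      show "z \<le> v z" "v z \<le> e z" using T(3) z by auto
    next
      show "v z \<le> z'" if "z \<in> T" "z' \<in> T" "z < z'" for z z' using T(4) that by blast
    qed (use T U in auto)
    then show "(\<Sum>z\<in>T. \<bar>F (v z) - F z\<bar>) \<le> \<epsilon>" by simp
  qed
  then show "\<exists>\<delta>. (\<forall>x\<in>N. 0 < \<delta> x) \<and> right_sums_le F N \<delta> \<epsilon>"
    using e by (intro exI[of _ "\<lambda>x. e x - x"]) auto
qed

text \<open>Each such point has a gap of \<open>E\<close> to its right. A rational chosen in the gap
  determines the point, because the next point of the set lies beyond it.\<close>

lemma countable_right_isolated:
  fixes E :: "real set"
  shows "countable {x \<in> E. \<exists>r>0. \<forall>e\<in>E. x < e \<longrightarrow> x + r \<le> e}" (is "countable ?I")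
proof -
  define I where "I = ?I"
  have "\<exists>q. q \<in> \<rat> \<and> x < q \<and> (\<forall>e\<in>I. x < e \<longrightarrow> q < e)" if x: "x \<in> I" for x
  proof -
    obtain r where r: "r > 0" "\<forall>e\<in>E. x < e \<longrightarrow> x + r \<le> e" using x by (auto simp: I_def)
    obtain q where "q \<in> \<rat>" "x < q" "q < x + r" using Rats_dense_in_real[of x "x + r"] r by auto
    then show ?thesis using r by (force simp: I_def)
  qed
  then obtain q where q: "\<And>x. x \<in> I \<Longrightarrow> q x \<in> \<rat>" "\<And>x. x \<in> I \<Longrightarrow> x < q x"
    "\<And>x e. x \<in> I \<Longrightarrow> e \<in> I \<Longrightarrow> x < e \<Longrightarrow> q x < e" by metis
  have "inj_on q I" by (rule inj_onI) (metis q(2,3) less_asym linorder_neqE)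
  moreover have "countable (q ` I)" using q(1) by (intro countable_subset[OF _ countable_rat]) blast
  ultimately have "countable I" by (metis countable_image_inj_on)
  then show ?thesis by (simp only: I_def)
qed

text \<open>Points of \<open>E\<close> that are not limits of \<open>E\<close> from the right form a countable set, where continuity of
  \<open>F\<close> suffices.\<close>

lemma null_right_variation_AC_star:
  fixes F :: "real \<Rightarrow> real"
  assumes AC: "AC_star_on F E" and N: "negligible N" "N \<subseteq> E" and F: "continuous_on UNIV F"
  shows "null_right_variation F N"
proof -
  define I where "I = {x \<in> E. \<exists>r>0. \<forall>e\<in>E. x < e \<longrightarrow> x + r \<le> e}"
  have "null_right_variation F (N - I)"
  proof (rule null_right_variation_AC_star_accumulating[OF AC])
    fix x r :: real assume "x \<in> N - I" "r > 0"
    then show "\<exists>e\<in>E. x < e \<and> e < x + r" using N(2) unfolding I_def by (auto simp: not_le)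
  qed (use N in \<open>auto intro: negligible_subset\<close>)
  moreover have "null_right_variation F I"
    using F countable_right_isolated unfolding I_def by (rule null_right_variation_countable)
  ultimately have "null_right_variation F ((N - I) \<union> I)" by (rule null_right_variation_Un)
  then show ?thesis by (rule null_right_variation_subset) blast
qed

text \<open>In a tagged division one point may tag two adjacent intervals, so tags alone do not
  index it. One of the two right halves is then degenerate and contributes \<open>0\<close>; once
  degenerate halves are dropped, the tags are distinct.\<close>

lemma right_sums_le_indexed:
  fixes F :: "real \<Rightarrow> real" and x v :: "'i \<Rightarrow> real"
  assumes le: "right_sums_le F A \<delta> \<epsilon>"
    and D: "finite D" "\<And>i. i \<in> D \<Longrightarrow> x i \<in> A \<and> x i \<le> v i \<and> v i < x i + \<delta> (x i)"
    and disj: "\<And>i j. i \<in> D \<Longrightarrow> j \<in> D \<Longrightarrow> i \<noteq> j \<Longrightarrow> {x i<..<v i} \<inter> {x j<..<v j} = {}"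
  shows "(\<Sum>i\<in>D. \<bar>F (v i) - F (x i)\<bar>) \<le> \<epsilon>"
proof -
  define D' where "D' = {i \<in> D. x i < v i}"
  obtain w where w: "inj_on x D'" "\<And>i. i \<in> D' \<Longrightarrow> w (x i) = v i"
      "\<And>z z'. z \<in> x ` D' \<Longrightarrow> z' \<in> x ` D' \<Longrightarrow> z < z' \<Longrightarrow> w z \<le> z'"
    using reindex_by_left_endpoint[of D' x v] disj unfolding D'_def by blast
  have "(\<Sum>i\<in>D. \<bar>F (v i) - F (x i)\<bar>) = (\<Sum>i\<in>D'. \<bar>F (v i) - F (x i)\<bar>)"
  proof (intro sum.mono_neutral_right ballI)
    fix i assume "i \<in> D - D'"
    then have "v i = x i" using D(2)[of i] by (auto simp: D'_def)
    then show "\<bar>F (v i) - F (x i)\<bar> = 0" by simp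
  qed (use D in \<open>auto simp: D'_def\<close>)
  also have "\<dots> = (\<Sum>z\<in>x ` D'. \<bar>F (w z) - F z\<bar>)"
    by (subst sum.reindex[OF w(1)]) (simp add: w(2))
  also have "\<dots> \<le> \<epsilon>"
  proof (rule right_sums_leD[OF le])
    show "z \<le> w z \<and> w z < z + \<delta> z" if "z \<in> x ` D'" for z
      using that D w(2) by (auto simp: D'_def)
  qed (use D w(3) in \<open>auto simp: D'_def\<close>)
  finally show ?thesis .
qed

text \<open>A gauge on the whole interval must be positive everywhere. Tags are taken from
  \<open>A\<close>, so the value \<open>1\<close> outside \<open>A\<close> does not affect the
  sums.\<close>

lemma null_right_variationE:
  assumes "null_right_variation F A" "\<epsilon> > 0"
  obtains \<delta> where "\<And>x. 0 < \<delta> x" "right_sums_le F A \<delta> \<epsilon>"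
proof -
  obtain \<delta> where \<delta>: "\<forall>x\<in>A. 0 < \<delta> x" "right_sums_le F A \<delta> \<epsilon>"
    using assms unfolding null_right_variation_def by blast
  have "right_sums_le F A (\<lambda>x. if x \<in> A then \<delta> x else 1) \<epsilon>"
    unfolding right_sums_le_def
  proof (intro allI impI)
    fix T and v :: "real \<Rightarrow> real"
    assume T: "finite T" "T \<subseteq> A" "\<forall>z\<in>T. z \<le> v z \<and> v z < z + (if z \<in> A then \<delta> z else 1)"
      "\<forall>z\<in>T. \<forall>z'\<in>T. z < z' \<longrightarrow> v z \<le> z'"
    show "(\<Sum>z\<in>T. \<bar>F (v z) - F z\<bar>) \<le> \<epsilon>"
    proof (rule right_sums_leD[OF \<delta>(2)])
      fix z assume "z \<in> T"
      moreover from this have "z \<in> A" using T(2) by blast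
      ultimately show "z \<le> v z \<and> v z < z + \<delta> z" using T(3) by auto
    qed (use T in auto)
  qed
  then show thesis using \<delta>(1) by (intro that[of "\<lambda>x. if x \<in> A then \<delta> x else 1"]) auto
qed

lemma tagged_division_of_realD:
  fixes a b :: real
  assumes "p tagged_division_of {a..b}" "(x, K) \<in> p"
  shows "K = {Inf K..Sup K}" "Inf K \<le> x" "x \<le> Sup K" "a \<le> Inf K" "Sup K \<le> b"
proof -
  obtain u v where K: "K = {u..v}" using tagged_division_ofD(4)[OF assms] by auto
  have "x \<in> K" "K \<subseteq> {a..b}" using tagged_division_ofD(2,3)[OF assms] by auto
  then show "K = {Inf K..Sup K}" "Inf K \<le> x" "x \<le> Sup K" "a \<le> Inf K" "Sup K \<le> b"
    unfolding K by auto
qed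

text \<open>\<open>F b - F a\<close> telescopes over a tagged division. An interval tagged outside
  \<open>A\<close> errs by at most \<open>\<epsilon>\<close> times its length, by differentiability
  at the tag. An interval tagged in \<open>A\<close> adds nothing to the Riemann sum, and its
  increment, cut at the tag, is absorbed by the right and the left variation.\<close>

lemma has_integral_derivative_null_variation:
  fixes F g :: "real \<Rightarrow> real"
  assumes "a \<le> b"
    and right: "null_right_variation F A"
    and left: "null_right_variation (\<lambda>x. F (- x)) (uminus ` A)"
    and deriv: "\<And>x. x \<in> {a..b} - A \<Longrightarrow> (F has_vector_derivative g x) (at x within {a..b})"
    and g0: "\<And>x. x \<in> A \<Longrightarrow> g x = 0"
  shows "(g has_integral F b - F a) {a..b}"
  unfolding has_integral_real
proof (intro allI impI)
  fix e :: real assume "e > 0"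
  \<comment> \<open>Three contributions of at most \<open>e / 4\<close> leave a strict inequality;
    the \<open>+ 1\<close> covers the case \<open>a = b\<close>.\<close>
  define \<epsilon> where "\<epsilon> = e / (4 * (b - a + 1))"
  have "\<epsilon> > 0" using \<open>a \<le> b\<close> \<open>e > 0\<close> by (simp add: \<epsilon>_def)
  have \<epsilon>e: "\<epsilon> * (b - a) \<le> e / 4"
    using \<open>a \<le> b\<close> \<open>e > 0\<close> by (simp add: \<epsilon>_def divide_simps)
  have "e / 4 > 0" using \<open>e > 0\<close> by simp
  then obtain \<delta>1 where \<delta>1: "\<And>x. 0 < \<delta>1 x" "right_sums_le F A \<delta>1 (e / 4)"
    using null_right_variationE[OF right] by blast
  obtain \<delta>2 where \<delta>2: "\<And>x. 0 < \<delta>2 x" "right_sums_le (\<lambda>x. F (- x)) (uminus ` A) \<delta>2 (e / 4)"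
    using null_right_variationE[OF left \<open>e / 4 > 0\<close>] by blast
  have "\<forall>x\<in>{a..b} - A. \<exists>d>0. \<forall>y\<in>{a..b}. \<bar>y - x\<bar> < d \<longrightarrow> \<bar>F y - F x - (y - x) * g x\<bar> \<le> \<epsilon> * \<bar>y - x\<bar>"
    using deriv \<open>\<epsilon> > 0\<close> unfolding has_vector_derivative_def has_derivative_within_alt by auto
  then have "\<exists>d>0. x \<in> {a..b} - A \<longrightarrow>
      (\<forall>y\<in>{a..b}. \<bar>y - x\<bar> < d \<longrightarrow> \<bar>F y - F x - (y - x) * g x\<bar> \<le> \<epsilon> * \<bar>y - x\<bar>)" for x
    using zero_less_one by blast
  then obtain d where d: "\<And>x. d x > 0"
    "\<And>x y. x \<in> {a..b} - A \<Longrightarrow> y \<in> {a..b} \<Longrightarrow> \<bar>y - x\<bar> < d x \<Longrightarrow>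
      \<bar>F y - F x - (y - x) * g x\<bar> \<le> \<epsilon> * \<bar>y - x\<bar>"
    by metis
  define r where "r x = min (d x) (min (\<delta>1 x) (\<delta>2 (- x)))" for x
  have "r x > 0" for x using d(1) \<delta>1(1) \<delta>2(1) by (simp add: r_def)
  show "\<exists>\<gamma>. gauge \<gamma> \<and> (\<forall>p. p tagged_division_of {a..b} \<and> \<gamma> fine p \<longrightarrow>
      norm ((\<Sum>(x, K)\<in>p. measure lborel K *\<^sub>R g x) - (F b - F a)) < e)"
  proof (intro exI[of _ "\<lambda>x. ball x (r x)"] conjI allI impI gauge_ball_dependent)
    fix p assume "p tagged_division_of {a..b} \<and> (\<lambda>x. ball x (r x)) fine p"
    then have p: "p tagged_division_of {a..b}" and fine: "\<And>x K. (x, K) \<in> p \<Longrightarrow> K \<subseteq> ball x (r x)"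
      by (auto simp: fine_def)
    note fin = tagged_division_ofD(1)[OF p]
    note K = tagged_division_of_realD[OF p]
    have cont: "measure lborel K = Sup K - Inf K" if "(x, K) \<in> p" for x K
      using K[OF that] by (metis content_real order_trans)
    have near: "\<bar>Sup K - x\<bar> < r x" "\<bar>Inf K - x\<bar> < r x" if "(x, K) \<in> p" for x K
    proof -
      have "Sup K \<in> {Inf K..Sup K}" "Inf K \<in> {Inf K..Sup K}" using K(2,3)[OF that] by simp_all
      then have "Sup K \<in> K" "Inf K \<in> K" by (simp_all only: K(1)[OF that, symmetric])
      then have "Sup K \<in> ball x (r x)" "Inf K \<in> ball x (r x)" using fine[OF that] by auto
      then show "\<bar>Sup K - x\<bar> < r x" "\<bar>Inf K - x\<bar> < r x" by (auto simp: dist_real_def)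
    qed
    have interior: "{Inf K<..<Sup K} \<inter> {Inf K'<..<Sup K'} = {}"
      if "(x, K) \<in> p" "(x', K') \<in> p" "(x, K) \<noteq> (x', K')" for x K x' K'
      using tagged_division_ofD(5)[OF p that] K(1)[OF that(1)] K(1)[OF that(2)]
      by (metis interior_atLeastAtMost_real)
    let ?P = "{i \<in> p. fst i \<in> A}"
    have R: "(\<Sum>i\<in>?P. \<bar>F (Sup (snd i)) - F (fst i)\<bar>) \<le> e / 4"
    proof (rule right_sums_le_indexed[OF \<delta>1(2)])
      fix i assume "i \<in> ?P"
      then show "fst i \<in> A \<and> fst i \<le> Sup (snd i) \<and> Sup (snd i) < fst i + \<delta>1 (fst i)"
        using K(3)[of "fst i" "snd i"] near(1)[of "fst i" "snd i"] by (auto simp: r_def)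
    next
      fix i j assume "i \<in> ?P" "j \<in> ?P" "i \<noteq> j"
      moreover obtain x K' x' K'' where "i = (x, K')" "j = (x', K'')" by fastforce
      ultimately show "{fst i<..<Sup (snd i)} \<inter> {fst j<..<Sup (snd j)} = {}"
        using interior[of x K' x' K''] K(2)[of x K'] K(2)[of x' K''] by fastforce
    qed (use fin in auto)
    \<comment> \<open>Under reflection the left half \<open>{Inf K..x}\<close> becomes an interval
      starting at its tag \<open>- x\<close>. The double minus signs present the increment as one of
      the reflected function.\<close>
    have L: "(\<Sum>i\<in>?P. \<bar>F (- (- Inf (snd i))) - F (- (- fst i))\<bar>) \<le> e / 4"
    proof (rule right_sums_le_indexed[OF \<delta>2(2)])
      fix i assume "i \<in> ?P"
      then show "- fst i \<in> uminus ` A \<and> - fst i \<le> - Inf (snd i) \<and> - Inf (snd i) < - fst i + \<delta>2 (- fst i)"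
        using K(2)[of "fst i" "snd i"] near(2)[of "fst i" "snd i"] by (auto simp: r_def)
    next
      fix i j assume "i \<in> ?P" "j \<in> ?P" "i \<noteq> j"
      moreover obtain x K' x' K'' where ij: "i = (x, K')" "j = (x', K'')" by fastforce
      ultimately have "{Inf K'<..<x} \<inter> {Inf K''<..<x'} = {}"
        using interior[of x K' x' K''] K(3)[of x K'] K(3)[of x' K''] by fastforce
      moreover have "t \<in> {- u<..<- w} \<longleftrightarrow> - t \<in> {w<..<u}" for t u w :: real by auto
      ultimately show "{- fst i<..<- Inf (snd i)} \<inter> {- fst j<..<- Inf (snd j)} = {}"
        unfolding ij by (metis (no_types, lifting) disjoint_iff fst_conv snd_conv)
    qed (use fin in auto)
    have "\<bar>measure lborel (snd i) * g (fst i) - (F (Sup (snd i)) - F (Inf (snd i)))\<bar> \<le> \<epsilon> * measure lborel (snd i) +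
        (if fst i \<in> A then \<bar>F (Sup (snd i)) - F (fst i)\<bar> + \<bar>F (Inf (snd i)) - F (fst i)\<bar> else 0)"
      if "i \<in> p" for i
    proof -
      obtain x K' where i: "i = (x, K')" by fastforce
      note K' = K[OF that[unfolded i]] and near' = near[OF that[unfolded i]] and c = cont[OF that[unfolded i]]
      show ?thesis
      proof (cases "x \<in> A")
        case True
        have "0 \<le> \<epsilon> * measure lborel K'" using \<open>\<epsilon> > 0\<close> by simp
        then show ?thesis using True g0[OF True] by (simp add: i)
      next
        case False
        have "x \<in> {a..b}" using K'(2-5) by simp
        have 1: "\<bar>F (Sup K') - F x - (Sup K' - x) * g x\<bar> \<le> \<epsilon> * \<bar>Sup K' - x\<bar>"
          using K'(2-5) near' False \<open>x \<in> {a..b}\<close> by (intro d(2)) (auto simp: r_def)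
        have 2: "\<bar>F (Inf K') - F x - (Inf K' - x) * g x\<bar> \<le> \<epsilon> * \<bar>Inf K' - x\<bar>"
          using K'(2-5) near' False \<open>x \<in> {a..b}\<close> by (intro d(2)) (auto simp: r_def)
        \<comment> \<open>The straddle estimate: the tag lies between the endpoints, so the
          distances in the two one-sided errors add up to the length of \<open>K'\<close>.\<close>
        have "measure lborel K' * g x - (F (Sup K') - F (Inf K')) =
            (F (Inf K') - F x - (Inf K' - x) * g x) - (F (Sup K') - F x - (Sup K' - x) * g x)"
          by (simp add: c algebra_simps)
        then have "\<bar>measure lborel K' * g x - (F (Sup K') - F (Inf K'))\<bar> \<le> \<epsilon> * \<bar>Sup K' - x\<bar> + \<epsilon> * \<bar>Inf K' - x\<bar>"
          using 1 2 by linarith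
        also have "\<dots> = \<epsilon> * measure lborel K'" using K'(2,3) by (simp add: c algebra_simps)
        finally show ?thesis using False by (simp add: i)
      qed
    qed
    then have "(\<Sum>i\<in>p. \<bar>measure lborel (snd i) * g (fst i) - (F (Sup (snd i)) - F (Inf (snd i)))\<bar>) \<le>
        (\<Sum>i\<in>p. \<epsilon> * measure lborel (snd i) +
        (if fst i \<in> A then \<bar>F (Sup (snd i)) - F (fst i)\<bar> + \<bar>F (Inf (snd i)) - F (fst i)\<bar> else 0))"
      by (rule sum_mono)
    also have "\<dots> = \<epsilon> * (\<Sum>i\<in>p. measure lborel (snd i)) +
        ((\<Sum>i\<in>?P. \<bar>F (Sup (snd i)) - F (fst i)\<bar>) + (\<Sum>i\<in>?P. \<bar>F (Inf (snd i)) - F (fst i)\<bar>))"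
      using fin by (simp add: sum.distrib sum_distrib_left sum.inter_filter[symmetric])
    also have "(\<Sum>i\<in>p. measure lborel (snd i)) = b - a"
      using additive_content_tagged_division[of p a b] p \<open>a \<le> b\<close> by (simp add: case_prod_beta)
    finally have S1: "(\<Sum>i\<in>p. \<bar>measure lborel (snd i) * g (fst i) - (F (Sup (snd i)) - F (Inf (snd i)))\<bar>)
        \<le> e / 4 + (e / 4 + e / 4)"
      using R L \<epsilon>e by simp
    have S2: "(\<Sum>(x, K)\<in>p. measure lborel K *\<^sub>R g x) - (F b - F a) =
        (\<Sum>i\<in>p. measure lborel (snd i) * g (fst i) - (F (Sup (snd i)) - F (Inf (snd i))))"
      using additive_tagged_division_1[OF \<open>a \<le> b\<close> p, of F] by (simp add: case_prod_beta sum_subtractf)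
    have "\<bar>(\<Sum>(x, K)\<in>p. measure lborel K *\<^sub>R g x) - (F b - F a)\<bar> \<le> e / 4 + (e / 4 + e / 4)"
      unfolding S2 by (rule order_trans[OF sum_abs S1])
    then show "norm ((\<Sum>(x, K)\<in>p. measure lborel K *\<^sub>R g x) - (F b - F a)) < e"
      using \<open>e > 0\<close> unfolding real_norm_def by linarith
  qed (use \<open>\<And>x. r x > 0\<close> in auto)
qed

lemma ACG_star_on_FTC:
  fixes F :: "real \<Rightarrow> real"
  assumes "a < b" and ACG: "ACG_star_on F a b"
  shows ACG_star_on_differentiable_ae:
      "negligible {x \<in> {a..b}. \<not> F differentiable (at x within {a..b})}" (is "negligible ?A")
    and ACG_star_on_has_integral: "x \<in> {a..b} \<Longrightarrow>
      ((\<lambda>t. vector_derivative F (at t within {a..b})) has_integral F x - F a) {a..x}"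
proof -
  obtain E where contF: "continuous_on {a..b} F" and E: "(\<Union>k :: nat. E k) = {a..b}"
    and AC: "\<And>k. AC_star_on F (E k)"
    using ACG unfolding ACG_star_on_def by blast
  \<comment> \<open>Constant continuation beyond the endpoints keeps continuity and boundedness on
    the whole line, where two-sided derivatives and reflection can be used.\<close>
  define G where "G x = F (max a (min b x))" for x
  have GF: "G x = F x" if "x \<in> {a..b}" for x using that by (auto simp: G_def)
  have contG: "continuous_on UNIV G"
    unfolding G_def using \<open>a < b\<close>
    by (intro continuous_on_compose2[OF contF]) (auto intro!: continuous_intros)
  have contG': "continuous_on UNIV (\<lambda>x. G (- x))"
    by (intro continuous_on_compose2[OF contG]) (auto intro!: continuous_intros)
  have Eab: "E k \<subseteq> {a..b}" for k using E by blast
  have ACG: "AC_star_on G (E k)" for k by (rule AC_star_on_cong[OF AC Eab GF])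
  have "bounded (F ` {a..b})"
    by (intro compact_imp_bounded compact_continuous_image[OF contF] compact_Icc)
  then obtain B where B: "\<And>x. x \<in> {a..b} \<Longrightarrow> \<bar>F x\<bar> \<le> B"
    unfolding bounded_iff by (metis imageI real_norm_def)
  have BG: "\<bar>G x\<bar> \<le> B" for x unfolding G_def using \<open>a < b\<close> by (intro B) auto
  have "negligible (\<Union>k. {x \<in> E k. \<not> G differentiable (at x)})"
    by (intro negligible_countable_Union) (auto intro: AC_star_differentiable_ae[OF ACG BG])
  then have "negligible ((\<Union>k. {x \<in> E k. \<not> G differentiable (at x)}) \<union> {a, b})" by simp
  moreover have "?A \<subseteq> (\<Union>k. {x \<in> E k. \<not> G differentiable (at x)}) \<union> {a, b}"
  proof
    fix x assume x: "x \<in> ?A"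
    then obtain k where "x \<in> E k" using E by blast
    moreover have "\<not> G differentiable (at x)"
    proof
      assume "G differentiable (at x)"
      then have "G differentiable (at x within {a..b})" by (rule differentiable_at_withinI)
      then have "F differentiable (at x within {a..b})"
        by (rule differentiable_transform_within[where d = 1]) (use x GF in auto)
      with x show False by blast
    qed
    ultimately show "x \<in> (\<Union>k. {x \<in> E k. \<not> G differentiable (at x)}) \<union> {a, b}" by blast
  qed
  ultimately show neg: "negligible ?A" by (rule negligible_subset)
  \<comment> \<open>Each \<open>?A \<inter> E k\<close> is a null subset of a set on which
    \<open>G\<close> is \<open>AC_star_on\<close>, and countable unions preserve null
    variation.\<close>
  have right: "null_right_variation G ?A"
  proof -
    have "null_right_variation G (\<Union>k. ?A \<inter> E k)"
      by (intro null_right_variation_countable_Union null_right_variation_AC_star[OF ACG] contG)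
        (auto intro: negligible_subset[OF neg])
    then show ?thesis by (rule null_right_variation_subset) (use E in blast)
  qed
  have left: "null_right_variation (\<lambda>x. G (- x)) (uminus ` ?A)"
  proof -
    have neg': "negligible (uminus ` ?A)"
      using neg by (rule negligible_differentiable_image_negligible[OF order_refl])
        (auto intro!: differentiable_on_minus simp: differentiable_on_ident)
    have "null_right_variation (\<lambda>x. G (- x)) (\<Union>k. uminus ` ?A \<inter> uminus ` E k)"
      by (intro null_right_variation_countable_Union null_right_variation_AC_star[OF AC_star_on_reflect[OF ACG]] contG')
        (auto intro: negligible_subset[OF neg'])
    then show ?thesis by (rule null_right_variation_subset) (use E in blast)
  qed
  assume x: "x \<in> {a..b}"
  let ?g = "\<lambda>t. vector_derivative F (at t within {a..b})"
  \<comment> \<open>On \<open>?A\<close> the value of \<open>vector_derivative\<close> is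
    unspecified. It is set to \<open>0\<close> so that tags there do not contribute, and restored at
    the end because \<open>?A\<close> is null.\<close>
  have "((\<lambda>t. if t \<in> ?A then 0 else ?g t) has_integral G x - G a) {a..x}"
  proof (rule has_integral_derivative_null_variation[OF _ right left])
    fix t assume t: "t \<in> {a..x} - ?A"
    then have "F differentiable (at t within {a..b})" using x by auto
    then have "(F has_vector_derivative ?g t) (at t within {a..b})"
      by (simp add: vector_derivative_works)
    then have "(F has_vector_derivative ?g t) (at t within {a..x})"
      by (rule has_vector_derivative_within_subset) (use x in auto)
    then have "(G has_vector_derivative ?g t) (at t within {a..x})"
      by (rule has_vector_derivative_transform[rotated 2]) (use t x GF in auto)
    moreover have "t \<notin> ?A" using t by blast
    ultimately show "(G has_vector_derivative (if t \<in> ?A then 0 else ?g t)) (at t within {a..x})"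
      by (simp only: if_False)
  qed (use x in auto)
  then have "((\<lambda>t. if t \<in> ?A then 0 else ?g t) has_integral F x - F a) {a..x}"
    using GF x \<open>a < b\<close> by simp
  then show "(?g has_integral F x - F a) {a..x}"
    by (rule has_integral_spike[OF neg, rotated]) auto
qed

section \<open>Integral inequalities for continuous functions\<close>

lemma nn_integral_lebesgue_on_continuous:
  fixes h :: "real \<Rightarrow> real"
  assumes "continuous_on {a..b} h" "\<And>x. x \<in> {a..b} \<Longrightarrow> 0 \<le> h x"
  shows "(\<integral>\<^sup>+x. ennreal (h x) \<partial>lebesgue_on {a..b}) = ennreal (integral {a..b} h)"
proof -
  have int: "integrable (lebesgue_on {a..b}) h" by (rule continuous_imp_integrable_real[OF assms(1)])
  have "AE x in lebesgue_on {a..b}. 0 \<le> h x" by (rule AE_I2) (use assms(2) in simp)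
  then have "(\<integral>\<^sup>+x. ennreal (h x) \<partial>lebesgue_on {a..b}) = ennreal (\<integral>x. h x \<partial>lebesgue_on {a..b})"
    using int by (intro nn_integral_eq_integral)
  then show ?thesis using lebesgue_integral_eq_integral[OF int] by simp
qed

lemma continuous_on_abs_powr:
  fixes g :: "real \<Rightarrow> real"
  assumes "continuous_on S g" "p > 0"
  shows "continuous_on S (\<lambda>x. \<bar>g x\<bar> powr p)"
  using assms by (intro continuous_on_powr' continuous_intros) auto

text \<open>Continuity on a compact interval makes the integral finite, so the infinite branch of
  \<open>Lp_norm\<close> does not arise.\<close>

lemma Lp_norm_continuous:
  assumes g: "continuous_on {a..b} g" and "1 \<le> p"
  shows "Lp_norm (ereal p) a b g = ereal ((integral {a..b} (\<lambda>x. \<bar>g x\<bar> powr p)) powr (1 / p))"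
proof -
  have c: "continuous_on {a..b} (\<lambda>x. \<bar>g x\<bar> powr p)" using g \<open>1 \<le> p\<close> by (intro continuous_on_abs_powr) auto
  have "0 \<le> integral {a..b} (\<lambda>x. \<bar>g x\<bar> powr p)"
    by (intro integral_nonneg integrable_continuous_real c) auto
  then show ?thesis
    using nn_integral_lebesgue_on_continuous[OF c] by (simp add: Lp_norm_def Let_def)
qed

lemma Linf_norm_leI:
  assumes "continuous_on {a..b} g" "\<And>x. x \<in> {a..b} \<Longrightarrow> \<bar>g x\<bar> \<le> M"
  shows "Lp_norm \<infinity> a b g \<le> ereal M"
proof -
  have [measurable]: "g \<in> borel_measurable (lebesgue_on {a..b})"
    using assms(1) by (rule continuous_imp_measurable_on_sets_lebesgue) simp
  have "(\<lambda>x. ereal \<bar>g x\<bar>) \<in> borel_measurable (lebesgue_on {a..b})"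
    by measurable
  moreover have "AE x in lebesgue_on {a..b}. ereal \<bar>g x\<bar> \<le> ereal M"
    by (rule AE_I2) (use assms(2) in simp)
  ultimately show ?thesis unfolding Lp_norm_def by auto
qed

text \<open>If the essential supremum were below the maximum of \<open>\<bar>g\<bar>\<close>,
  continuity would give an interval of positive length on which it is exceeded. Thus the norm is
  finite and bounds \<open>g\<close> at every point.\<close>

lemma Linf_norm_continuous:
  assumes "a < b" and g: "continuous_on {a..b} g"
  obtains M where "Lp_norm \<infinity> a b g = ereal M" "\<And>x. x \<in> {a..b} \<Longrightarrow> \<bar>g x\<bar> \<le> M"
proof -
  have not_neg: "\<not> negligible {l..u}" if "l < u" for l u :: real
    using negligible_interval(1)[of l u] that by simp
  have cabs: "continuous_on {a..b} (\<lambda>x. \<bar>g x\<bar>)" using g by (intro continuous_intros)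
  obtain x0 where x0: "x0 \<in> {a..b}" "\<And>x. x \<in> {a..b} \<Longrightarrow> \<bar>g x\<bar> \<le> \<bar>g x0\<bar>"
    using continuous_attains_sup[OF compact_Icc _ cabs] \<open>a < b\<close> by auto
  have le: "Lp_norm \<infinity> a b g \<le> ereal \<bar>g x0\<bar>" by (rule Linf_norm_leI[OF g x0(2)])
  have "ereal \<bar>g x0\<bar> \<le> Lp_norm \<infinity> a b g"
  proof (rule ccontr)
    assume "\<not> ereal \<bar>g x0\<bar> \<le> Lp_norm \<infinity> a b g"
    then have lt: "Lp_norm \<infinity> a b g < ereal \<bar>g x0\<bar>" by simp
    obtain y where "Lp_norm \<infinity> a b g < ereal y" "ereal y < ereal \<bar>g x0\<bar>"
      using ereal_dense2[OF lt] by blast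
    then have y: "Lp_norm \<infinity> a b g < ereal y" "y < \<bar>g x0\<bar>" by simp_all
    obtain d where d: "d > 0" "\<And>x. x \<in> {a..b} \<Longrightarrow> dist x x0 < d \<Longrightarrow> dist \<bar>g x\<bar> \<bar>g x0\<bar> < \<bar>g x0\<bar> - y"
      using cabs x0(1) y(2) unfolding continuous_on_iff by (metis diff_gt_0_iff_gt)
    have "AE x in lebesgue_on {a..b}. ereal \<bar>g x\<bar> \<le> Lp_norm \<infinity> a b g"
      unfolding Lp_norm_def by (simp add: esssup_AE)
    then have "AE x in lebesgue_on {a..b}. \<bar>g x\<bar> \<le> y"
      by eventually_elim (use y(1) in \<open>metis ereal_less_eq(3) less_imp_le order_trans\<close>)
    then have "AE x in lebesgue. x \<in> {a..b} \<longrightarrow> \<bar>g x\<bar> \<le> y" by (simp add: AE_restrict_space_iff)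
    then have "negligible {x. \<not> (x \<in> {a..b} \<longrightarrow> \<bar>g x\<bar> \<le> y)}"
      unfolding eventually_ae_filter_negligible by (auto intro: negligible_subset)
    \<comment> \<open>Clipping to \<open>{a..b}\<close> still leaves positive length when
      \<open>x0\<close> is an endpoint, because \<open>a < b\<close>.\<close>
    moreover have "{max a (x0 - d / 2)..min b (x0 + d / 2)} \<subseteq> {x. \<not> (x \<in> {a..b} \<longrightarrow> \<bar>g x\<bar> \<le> y)}"
    proof
      fix x assume x: "x \<in> {max a (x0 - d / 2)..min b (x0 + d / 2)}"
      then have "dist x x0 < d" "x \<in> {a..b}" using d(1) by (auto simp: dist_real_def abs_if)
      from d(2)[OF this(2,1)] show "x \<in> {x. \<not> (x \<in> {a..b} \<longrightarrow> \<bar>g x\<bar> \<le> y)}"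
        using \<open>x \<in> {a..b}\<close> by (auto simp: dist_real_def abs_if split: if_splits)
    qed
    ultimately have "negligible {max a (x0 - d / 2)..min b (x0 + d / 2)}" by (rule negligible_subset)
    moreover have "max a (x0 - d / 2) < min b (x0 + d / 2)" using x0(1) d(1) \<open>a < b\<close> by auto
    ultimately show False
      using not_neg by blast
  qed
  with le have "Lp_norm \<infinity> a b g = ereal \<bar>g x0\<bar>" by (rule antisym)
  then show thesis using x0(2) by (rule that)
qed

section \<open>Integrals of powers\<close>

lemma has_integral_powr_left:
  fixes a b c :: real
  assumes "a \<le> b" "c \<ge> 0"
  shows "((\<lambda>x. (x - a) powr c) has_integral (b - a) powr (c + 1) / (c + 1)) {a..b}"
proof -
  have "((\<lambda>x. (x - a) powr c) has_integral (b - a) powr (c + 1) / (c + 1) - (a - a) powr (c + 1) / (c + 1)) {a..b}"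
  proof (rule fundamental_theorem_of_calculus_interior[OF assms(1)])
    show "continuous_on {a..b} (\<lambda>x. (x - a) powr (c + 1) / (c + 1))"
      using assms(2) by (intro continuous_on_divide continuous_on_powr' continuous_intros) auto
    fix x assume "x \<in> {a<..<b}"
    then show "((\<lambda>x. (x - a) powr (c + 1) / (c + 1)) has_vector_derivative (x - a) powr c) (at x)"
      unfolding has_real_derivative_iff_has_vector_derivative[symmetric] using assms(2)
      by (auto intro!: derivative_eq_intros)
  qed
  then show ?thesis by simp
qed

lemma has_integral_powr_right:
  fixes a b c :: real
  assumes "a \<le> b" "c \<ge> 0"
  shows "((\<lambda>x. (b - x) powr c) has_integral (b - a) powr (c + 1) / (c + 1)) {a..b}"
proof -
  have "((\<lambda>x. (x - - b) powr c) has_integral (- a - - b) powr (c + 1) / (c + 1)) {- b..- a}"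
    using assms by (intro has_integral_powr_left) auto
  then have "((\<lambda>x. (- x - - b) powr c) has_integral (- a - - b) powr (c + 1) / (c + 1)) {a..b}"
    using has_integral_reflect_real[of "\<lambda>x. (- x - - b) powr c"] by simp
  then show ?thesis by (simp add: add.commute)
qed

text \<open>At \<open>x = 0\<close> and \<open>n = 0\<close> the left side is \<open>1\<close> and
  the right side \<open>0\<close>, since \<open>0 powr 0 = 0\<close>. The integrals below discard
  this point as a null set.\<close>

lemma power_powr: "0 \<le> (x :: real) \<Longrightarrow> x \<noteq> 0 \<Longrightarrow> (x ^ n) powr p = x powr (real n * p)"
  by (simp add: powr_powr flip: powr_realpow)

lemma has_integral_power_powr_left:
  fixes a b p :: real
  assumes "a \<le> b" "p \<ge> 0"
  shows "((\<lambda>x. ((x - a) ^ n) powr p) has_integral (b - a) powr (real n * p + 1) / (real n * p + 1)) {a..b}"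
  by (rule has_integral_spike[OF negligible_sing[of a] _ has_integral_powr_left])
    (use assms in \<open>auto simp: power_powr\<close>)

lemma has_integral_power_powr_right:
  fixes a b p :: real
  assumes "a \<le> b" "p \<ge> 0"
  shows "((\<lambda>x. ((b - x) ^ n) powr p) has_integral (b - a) powr (real n * p + 1) / (real n * p + 1)) {a..b}"
  by (rule has_integral_spike[OF negligible_sing[of b] _ has_integral_powr_right])
    (use assms in \<open>auto simp: power_powr\<close>)

lemma Lp_norm_le_powr:
  assumes "a < b" and u: "continuous_on {a..b} u" and "1 \<le> p" "0 \<le> C" "0 \<le> s"
    and le: "\<And>x. a < x \<Longrightarrow> x \<le> b \<Longrightarrow> \<bar>u x\<bar> \<le> C * (x - a) powr s"
  shows "Lp_norm (ereal p) a b u \<le> ereal ((b - a) powr (s + 1 / p) / (s * p + 1) powr (1 / p) * C)"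
proof -
  have "s * p \<ge> 0" using assms by simp
  let ?I = "integral {a..b} (\<lambda>x. \<bar>u x\<bar> powr p)"
  have "((\<lambda>x. C powr p * (x - a) powr (s * p)) has_integral
      C powr p * ((b - a) powr (s * p + 1) / (s * p + 1))) {a..b}"
    using \<open>a < b\<close> \<open>s * p \<ge> 0\<close> by (intro has_integral_mult_right has_integral_powr_left) auto
  note 1 = this
  \<comment> \<open>The majorant vanishes at \<open>a\<close> even for \<open>s = 0\<close>, because
    \<open>0 powr 0 = 0\<close>, while \<open>u a\<close> may be nonzero. Hence the value at
    \<open>a\<close> is changed before comparing.\<close>
  have 2: "((\<lambda>x. if x = a then 0 else \<bar>u x\<bar> powr p) has_integral ?I) {a..b}"
  proof (rule has_integral_spike[OF negligible_sing[of a]])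
    show "((\<lambda>x. \<bar>u x\<bar> powr p) has_integral ?I) {a..b}"
      using u \<open>1 \<le> p\<close> by (intro integrable_integral integrable_continuous_real continuous_on_abs_powr) auto
  qed auto
  have "?I \<le> C powr p * ((b - a) powr (s * p + 1) / (s * p + 1))"
  proof (rule has_integral_le[OF 2 1])
    fix x assume x: "x \<in> {a..b}"
    show "(if x = a then 0 else \<bar>u x\<bar> powr p) \<le> C powr p * (x - a) powr (s * p)"
    proof (cases "x = a")
      case False
      then have "\<bar>u x\<bar> powr p \<le> (C * (x - a) powr s) powr p"
        using le[of x] x \<open>1 \<le> p\<close> by (intro powr_mono2) auto
      also have "\<dots> = C powr p * (x - a) powr (s * p)"
        using \<open>0 \<le> C\<close> by (simp add: powr_mult powr_powr)
      finally show ?thesis using False by simp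
    qed simp
  qed
  moreover have "0 \<le> ?I"
    using u \<open>1 \<le> p\<close> by (intro integral_nonneg integrable_continuous_real continuous_on_abs_powr) auto
  ultimately have "?I powr (1 / p) \<le> (C powr p * ((b - a) powr (s * p + 1) / (s * p + 1))) powr (1 / p)"
    using \<open>1 \<le> p\<close> by (intro powr_mono2) auto
  also have "\<dots> = C * ((b - a) powr ((s * p + 1) / p) / (s * p + 1) powr (1 / p))"
    using \<open>0 \<le> C\<close> \<open>1 \<le> p\<close> \<open>a < b\<close> \<open>s * p \<ge> 0\<close> by (simp add: powr_mult powr_powr powr_divide)
  also have "(s * p + 1) / p = s + 1 / p" using \<open>1 \<le> p\<close> by (simp add: field_simps)
  finally show ?thesis
    unfolding Lp_norm_continuous[OF u \<open>1 \<le> p\<close>] by (simp add: mult.commute)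
qed

text \<open>Young's inequality is applied to the normalised functions. If a norm is
  \<open>0\<close>, continuity makes that function vanish identically.\<close>

lemma Holder_continuous:
  fixes u v :: "real \<Rightarrow> real"
  assumes "a < b" and u: "continuous_on {a..b} u" and v: "continuous_on {a..b} v"
    and u0: "\<And>x. x \<in> {a..b} \<Longrightarrow> 0 \<le> u x" and v0: "\<And>x. x \<in> {a..b} \<Longrightarrow> 0 \<le> v x"
    and pq: "p > 1" "q > 1" "1 / p + 1 / q = 1"
  shows "integral {a..b} (\<lambda>x. u x * v x) \<le>
    integral {a..b} (\<lambda>x. u x powr p) powr (1 / p) * integral {a..b} (\<lambda>x. v x powr q) powr (1 / q)"
proof -
  have cu: "continuous_on {a..b} (\<lambda>x. u x powr p)" using u u0 pq by (intro continuous_on_powr' continuous_intros) auto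
  have cv: "continuous_on {a..b} (\<lambda>x. v x powr q)" using v v0 pq by (intro continuous_on_powr' continuous_intros) auto
  define U where "U = integral {a..b} (\<lambda>x. u x powr p)"
  define V where "V = integral {a..b} (\<lambda>x. v x powr q)"
  have "U \<ge> 0" unfolding U_def by (intro integral_nonneg integrable_continuous_real cu) auto
  have "V \<ge> 0" unfolding V_def by (intro integral_nonneg integrable_continuous_real cv) auto
  show ?thesis
  proof (cases "U = 0 \<or> V = 0")
    case True
    then have "(\<forall>x\<in>{a..b}. u x = 0) \<or> (\<forall>x\<in>{a..b}. v x = 0)"
      using integral_eq_0_iff[OF cu \<open>a < b\<close>] integral_eq_0_iff[OF cv \<open>a < b\<close>] by (auto simp: U_def V_def)
    then have "integral {a..b} (\<lambda>x. u x * v x) = integral {a..b} (\<lambda>x. 0)"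
      by (intro integral_cong) auto
    then show ?thesis by simp
  next
    case False
    then have pos: "U > 0" "V > 0" using \<open>U \<ge> 0\<close> \<open>V \<ge> 0\<close> by auto
    have *: "u x * v x / (U powr (1 / p) * V powr (1 / q)) \<le> u x powr p / (p * U) + v x powr q / (q * V)"
      if "x \<in> {a..b}" for x
    proof -
      have "(u x / U powr (1 / p)) * (v x / V powr (1 / q)) \<le>
          (u x / U powr (1 / p)) powr p / p + (v x / V powr (1 / q)) powr q / q"
        using u0[OF that] v0[OF that] pq by (intro Youngs_inequality) auto
      then show ?thesis
        using u0[OF that] v0[OF that] pq pos by (simp add: powr_divide powr_powr mult.commute)
    qed
    have "integral {a..b} (\<lambda>x. u x * v x / (U powr (1 / p) * V powr (1 / q))) \<le>
        integral {a..b} (\<lambda>x. u x powr p / (p * U) + v x powr q / (q * V))"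
      using pos pq by (intro integral_le * integrable_continuous_real continuous_on_add continuous_on_divide
          continuous_on_mult continuous_on_const u v cu cv) auto
    also have "\<dots> = U / (p * U) + V / (q * V)"
      using pos pq by (subst integral_add)
        (auto intro!: integrable_continuous_real continuous_on_divide cu cv simp: U_def V_def)
    also have "\<dots> = 1" using pos pq by simp
    finally have "integral {a..b} (\<lambda>x. u x * v x) / (U powr (1 / p) * V powr (1 / q)) \<le> 1" by simp
    then show ?thesis
      using pos by (simp add: U_def[symmetric] V_def[symmetric] divide_le_eq)
  qed
qed

text \<open>Jensen's inequality for the \<open>p\<close>-th power and the weight \<open>w\<close>,
  not normalised to mass \<open>1\<close>. It is Hoelder's inequality for the factors
  \<open>w powr (1 / q)\<close> and \<open>w powr (1 / p) * h\<close>. The weight \<open>1\<close>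
  leads to \<open>A\<^sub>3\<close>, the weight \<open>(x - t) ^ m\<close> to
  \<open>A\<^sub>4\<close>.\<close>

lemma weighted_power_mean_continuous:
  fixes w h :: "real \<Rightarrow> real"
  assumes "a < b" and w: "continuous_on {a..b} w" and h: "continuous_on {a..b} h"
    and w0: "\<And>x. x \<in> {a..b} \<Longrightarrow> 0 \<le> w x" and h0: "\<And>x. x \<in> {a..b} \<Longrightarrow> 0 \<le> h x"
    and W: "0 < integral {a..b} w" and "1 \<le> p"
  shows "integral {a..b} (\<lambda>x. w x * h x) powr p \<le>
    integral {a..b} w powr (p - 1) * integral {a..b} (\<lambda>x. w x * h x powr p)"
proof (cases "p = 1")
  case True
  have "0 \<le> integral {a..b} (\<lambda>x. w x * h x)"
    using w h w0 h0 by (intro integral_nonneg integrable_continuous_real continuous_intros) auto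
  moreover have "integral {a..b} (\<lambda>x. w x * h x powr 1) = integral {a..b} (\<lambda>x. w x * h x)"
    using h0 by (intro integral_cong) auto
  ultimately show ?thesis using True W by simp
next
  case False
  then have "p > 1" using \<open>1 \<le> p\<close> by simp
  define q where "q = p / (p - 1)"
  have q: "q > 1" "1 / q + 1 / p = 1" "1 / q = 1 - 1 / p"
    using \<open>p > 1\<close> by (simp_all add: q_def field_simps)
  have "integral {a..b} (\<lambda>x. w x * h x) = integral {a..b} (\<lambda>x. w x powr (1 / q) * (w x powr (1 / p) * h x))"
  proof (rule integral_cong)
    fix x assume "x \<in> {a..b}"
    have "w x powr (1 / q) * w x powr (1 / p) = w x"
      using w0[OF \<open>x \<in> {a..b}\<close>] q(2) by (simp flip: powr_add)
    then show "w x * h x = w x powr (1 / q) * (w x powr (1 / p) * h x)" by (simp flip: mult.assoc)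
  qed
  also have "\<dots> \<le> integral {a..b} (\<lambda>x. (w x powr (1 / q)) powr q) powr (1 / q) *
      integral {a..b} (\<lambda>x. (w x powr (1 / p) * h x) powr p) powr (1 / p)"
    using w h w0 h0 \<open>a < b\<close> \<open>p > 1\<close> q
    by (intro Holder_continuous continuous_on_mult continuous_on_powr') (auto intro!: continuous_intros)
  also have "integral {a..b} (\<lambda>x. (w x powr (1 / q)) powr q) = integral {a..b} w"
    using w0 q(1) by (intro integral_cong) (simp add: powr_powr)
  also have "integral {a..b} (\<lambda>x. (w x powr (1 / p) * h x) powr p) = integral {a..b} (\<lambda>x. w x * h x powr p)"
    using w0 h0 \<open>p > 1\<close> by (intro integral_cong) (simp add: powr_powr powr_mult)
  finally have "integral {a..b} (\<lambda>x. w x * h x) powr p \<le>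
      (integral {a..b} w powr (1 / q) * integral {a..b} (\<lambda>x. w x * h x powr p) powr (1 / p)) powr p"
    using w h w0 h0 \<open>p > 1\<close>
    by (intro powr_mono2 integral_nonneg integrable_continuous_real continuous_intros) auto
  moreover have "0 \<le> integral {a..b} (\<lambda>x. w x * h x powr p)"
    using w h w0 h0 \<open>p > 1\<close>
    by (intro integral_nonneg integrable_continuous_real continuous_on_mult continuous_on_powr') (auto intro!: continuous_intros)
  moreover have "1 / q * p = p - 1" using q(3) \<open>p > 1\<close> by (simp add: field_simps)
  ultimately show ?thesis using W \<open>p > 1\<close> by (simp add: powr_mult powr_powr)
qed

text \<open>One factor \<open>\<bar>u x + v x\<bar>\<close> is split by the triangle inequality, the
  remaining power is estimated by Hoelder with \<open>(p - 1) * q = p\<close>, and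
  \<open>W powr (1 / q)\<close> is cancelled. For \<open>p = 1\<close> the triangle inequality
  suffices.\<close>

lemma Minkowski_continuous:
  fixes u v :: "real \<Rightarrow> real"
  assumes "a < b" and u: "continuous_on {a..b} u" and v: "continuous_on {a..b} v" and "1 \<le> p"
  shows "Lp_norm (ereal p) a b (\<lambda>x. u x + v x) \<le> Lp_norm (ereal p) a b u + Lp_norm (ereal p) a b v"
proof -
  have uv: "continuous_on {a..b} (\<lambda>x. u x + v x)" using u v by (intro continuous_intros)
  define N where "N f = integral {a..b} (\<lambda>x. \<bar>f x\<bar> powr p)" for f :: "real \<Rightarrow> real"
  have N0: "N f \<ge> 0" if "continuous_on {a..b} f" for f
    unfolding N_def using that \<open>1 \<le> p\<close>
    by (intro integral_nonneg integrable_continuous_real continuous_on_abs_powr) auto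
  have "N (\<lambda>x. u x + v x) powr (1 / p) \<le> N u powr (1 / p) + N v powr (1 / p)"
  proof (cases "p = 1")
    case True
    have "integral {a..b} (\<lambda>x. \<bar>u x + v x\<bar>) \<le> integral {a..b} (\<lambda>x. \<bar>u x\<bar> + \<bar>v x\<bar>)"
      using u v by (intro integral_le integrable_continuous_real continuous_intros) auto
    also have "\<dots> = integral {a..b} (\<lambda>x. \<bar>u x\<bar>) + integral {a..b} (\<lambda>x. \<bar>v x\<bar>)"
      using u v by (intro integral_add integrable_continuous_real continuous_intros)
    finally show ?thesis using True N0[OF u] N0[OF v] N0[OF uv] by (simp add: N_def)
  next
    case False
    then have "p > 1" using \<open>1 \<le> p\<close> by simp
    define q where "q = p / (p - 1)"
    have q: "q > 1" "1 / p + 1 / q = 1" "(p - 1) * q = p"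
      using \<open>p > 1\<close> by (simp_all add: q_def field_simps)
    define W where "W = N (\<lambda>x. u x + v x)"
    have cs: "continuous_on {a..b} (\<lambda>x. \<bar>u x + v x\<bar> powr (p - 1))"
      using uv \<open>p > 1\<close> by (intro continuous_on_abs_powr) auto
    have H: "integral {a..b} (\<lambda>x. \<bar>f x\<bar> * \<bar>u x + v x\<bar> powr (p - 1)) \<le> N f powr (1 / p) * W powr (1 / q)"
      if f: "continuous_on {a..b} f" for f
      using Holder_continuous[OF \<open>a < b\<close> continuous_on_rabs[OF f] cs _ _ \<open>p > 1\<close> q(1,2)] q(3)
      by (simp add: N_def W_def powr_powr)
    have "W \<le> integral {a..b} (\<lambda>x. \<bar>u x\<bar> * \<bar>u x + v x\<bar> powr (p - 1) + \<bar>v x\<bar> * \<bar>u x + v x\<bar> powr (p - 1))"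
      unfolding W_def N_def
    proof (rule integral_le)
      fix x
      have "\<bar>u x + v x\<bar> powr p = \<bar>u x + v x\<bar> * \<bar>u x + v x\<bar> powr (p - 1)"
        by (cases "u x + v x = 0") (simp_all add: powr_mult_base)
      also have "\<dots> \<le> (\<bar>u x\<bar> + \<bar>v x\<bar>) * \<bar>u x + v x\<bar> powr (p - 1)"
        by (intro mult_right_mono) auto
      finally show "\<bar>u x + v x\<bar> powr p \<le> \<bar>u x\<bar> * \<bar>u x + v x\<bar> powr (p - 1) + \<bar>v x\<bar> * \<bar>u x + v x\<bar> powr (p - 1)"
        by (simp add: distrib_right)
    qed (use u v uv cs \<open>1 \<le> p\<close> in \<open>auto intro!: integrable_continuous_real continuous_on_abs_powr continuous_intros\<close>)
    also have "\<dots> = integral {a..b} (\<lambda>x. \<bar>u x\<bar> * \<bar>u x + v x\<bar> powr (p - 1)) +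
        integral {a..b} (\<lambda>x. \<bar>v x\<bar> * \<bar>u x + v x\<bar> powr (p - 1))"
      by (intro integral_add integrable_continuous_real continuous_on_mult continuous_on_rabs u v cs)
    also have "\<dots> \<le> (N u powr (1 / p) + N v powr (1 / p)) * W powr (1 / q)"
      using H[OF u] H[OF v] by (simp add: distrib_right)
    finally have le: "W \<le> (N u powr (1 / p) + N v powr (1 / p)) * W powr (1 / q)" .
    show ?thesis
    proof (cases "W = 0")
      case False
      then have "W > 0" using N0[OF uv] by (simp add: W_def)
      have "W = W powr (1 / p) * W powr (1 / q)"
        using \<open>W > 0\<close> q(2) by (simp flip: powr_add)
      then have "W powr (1 / p) * W powr (1 / q) \<le> (N u powr (1 / p) + N v powr (1 / p)) * W powr (1 / q)"
        using le by simp
      then show ?thesis using \<open>W > 0\<close> by (simp add: W_def)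
    qed (simp add: W_def)
  qed
  then show ?thesis
    by (simp add: Lp_norm_continuous[OF u \<open>1 \<le> p\<close>] Lp_norm_continuous[OF v \<open>1 \<le> p\<close>]
        Lp_norm_continuous[OF uv \<open>1 \<le> p\<close>] N_def)
qed

text \<open>Tonelli on the triangle \<open>a \<le> t \<le> x \<le> b\<close>; the inner integral
  over \<open>x\<close> is \<open>J t\<close>. Working in \<open>ennreal\<close> avoids
  integrability on the product, and continuity of \<open>K\<close> and \<open>H\<close> on the whole
  line makes the integrand Borel.\<close>

lemma integral_le_convolution:
  fixes K H \<psi> J :: "real \<Rightarrow> real"
  assumes "a \<le> b" and K: "continuous_on UNIV K" "\<And>s. 0 \<le> K s" and H: "continuous_on UNIV H" "\<And>t. 0 \<le> H t"
    and \<psi>: "continuous_on {a..b} \<psi>" "\<And>x. x \<in> {a..b} \<Longrightarrow> 0 \<le> \<psi> x"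
      "\<And>x. x \<in> {a..b} \<Longrightarrow> \<psi> x \<le> integral {a..x} (\<lambda>t. K (x - t) * H t)"
    and J: "\<And>t. t \<in> {a..b} \<Longrightarrow> ((\<lambda>x. K (x - t)) has_integral J t) {t..b}" "continuous_on {a..b} J"
  shows "integral {a..b} \<psi> \<le> integral {a..b} (\<lambda>t. H t * J t)"
proof -
  have nn: "(\<integral>\<^sup>+x\<in>S. ennreal (h x) \<partial>lborel) = ennreal I"
    if "(h has_integral I) S" "\<And>x. 0 \<le> h x" for h :: "real \<Rightarrow> real" and I S
  proof -
    have "(\<integral>\<^sup>+x\<in>S. ennreal (h x) \<partial>lborel) = (\<integral>\<^sup>+x. ennreal (indicator S x * h x) \<partial>lborel)"
      by (intro nn_integral_cong) (auto simp: indicator_def)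
    then show ?thesis using nn_integral_has_integral_lebesgue[OF that(2,1)] by simp
  qed
  have [measurable]: "K \<in> borel_measurable borel" "H \<in> borel_measurable borel"
    using K(1) H(1) by (auto intro: borel_measurable_continuous_onI)
  have "(\<lambda>(x, t). if a \<le> t \<and> t \<le> x \<and> x \<le> b then ennreal (K (x - t) * H t) else 0)
      \<in> borel_measurable (borel \<Otimes>\<^sub>M borel)"
    by measurable
  then have meas: "(\<lambda>(x, t). if a \<le> t \<and> t \<le> x \<and> x \<le> b then ennreal (K (x - t) * H t) else 0)
      \<in> borel_measurable (lborel \<Otimes>\<^sub>M lborel)"
    by (subst measurable_cong_sets[OF sets_pair_measure_cong[OF sets_lborel sets_lborel] refl])
  have J0: "0 \<le> J t" if "t \<in> {a..b}" for t by (rule has_integral_nonneg[OF J(1)[OF that]]) (rule K)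
  have in1: "integral {a..x} (\<lambda>t. K (x - t) * H t) \<ge> 0" for x
    using K H by (intro integral_nonneg integrable_continuous_real continuous_intros
        continuous_on_compose2[OF K(1)] continuous_on_subset[OF H(1)]) auto
  have cH: "continuous_on {a..b} (\<lambda>t. H t * J t)"
    using continuous_on_subset[OF H(1)] J(2) by (intro continuous_intros) auto
  have "ennreal (integral {a..b} \<psi>) = (\<integral>\<^sup>+x\<in>{a..b}. ennreal (\<bar>\<psi> x\<bar>) \<partial>lborel)"
  proof (rule nn[symmetric])
    have "(\<psi> has_integral integral {a..b} \<psi>) {a..b}" using \<psi>(1) by (intro integrable_integral integrable_continuous_real)
    then show "((\<lambda>x. \<bar>\<psi> x\<bar>) has_integral integral {a..b} \<psi>) {a..b}"
      by (rule has_integral_eq[rotated]) (use \<psi>(2) in auto)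
  qed simp
  also have "\<dots> \<le> (\<integral>\<^sup>+x. \<integral>\<^sup>+t. (if a \<le> t \<and> t \<le> x \<and> x \<le> b then ennreal (K (x - t) * H t) else 0) \<partial>lborel \<partial>lborel)"
  proof (rule nn_integral_mono)
    fix x
    show "ennreal \<bar>\<psi> x\<bar> * indicator {a..b} x \<le>
        (\<integral>\<^sup>+t. (if a \<le> t \<and> t \<le> x \<and> x \<le> b then ennreal (K (x - t) * H t) else 0) \<partial>lborel)"
    proof (cases "x \<in> {a..b}")
      case True
      have "ennreal \<bar>\<psi> x\<bar> \<le> ennreal (integral {a..x} (\<lambda>t. K (x - t) * H t))"
        using \<psi>(2,3)[OF True] by (intro ennreal_leI) simp
      also have "\<dots> = (\<integral>\<^sup>+t\<in>{a..x}. ennreal (K (x - t) * H t) \<partial>lborel)"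
        using K H by (intro nn[symmetric] integrable_integral integrable_continuous_real continuous_intros
            continuous_on_compose2[OF K(1)] continuous_on_subset[OF H(1)]) auto
      also have "\<dots> = (\<integral>\<^sup>+t. (if a \<le> t \<and> t \<le> x \<and> x \<le> b then ennreal (K (x - t) * H t) else 0) \<partial>lborel)"
        using True by (intro nn_integral_cong) (auto simp: indicator_def)
      finally show ?thesis using True by simp
    qed simp
  qed
  also have "\<dots> = (\<integral>\<^sup>+t. \<integral>\<^sup>+x. (if a \<le> t \<and> t \<le> x \<and> x \<le> b then ennreal (K (x - t) * H t) else 0) \<partial>lborel \<partial>lborel)"
    by (intro lborel_pair.Fubini'[symmetric]) (rule meas)
  also have "\<dots> = (\<integral>\<^sup>+t\<in>{a..b}. ennreal \<bar>H t * J t\<bar> \<partial>lborel)"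
  proof (rule nn_integral_cong)
    fix t :: real
    show "(\<integral>\<^sup>+x. (if a \<le> t \<and> t \<le> x \<and> x \<le> b then ennreal (K (x - t) * H t) else 0) \<partial>lborel) =
        ennreal \<bar>H t * J t\<bar> * indicator {a..b} t"
    proof (cases "t \<in> {a..b}")
      case True
      have "(\<integral>\<^sup>+x. (if a \<le> t \<and> t \<le> x \<and> x \<le> b then ennreal (K (x - t) * H t) else 0) \<partial>lborel) =
          (\<integral>\<^sup>+x\<in>{t..b}. ennreal (K (x - t) * H t) \<partial>lborel)"
        using True by (intro nn_integral_cong) (auto simp: indicator_def)
      also have "\<dots> = ennreal (J t * H t)"
        using J(1)[OF True] K H by (intro nn has_integral_mult_left) auto
      finally show ?thesis using True J0[OF True] H(2)[of t] by (simp add: mult.commute)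
    next
      case False
      then have "(\<integral>\<^sup>+x. (if a \<le> t \<and> t \<le> x \<and> x \<le> b then ennreal (K (x - t) * H t) else 0) \<partial>lborel) = (\<integral>\<^sup>+(x :: real). 0 \<partial>lborel)"
        by (intro nn_integral_cong) auto
      then show ?thesis using False by simp
    qed
  qed
  also have "\<dots> = ennreal (integral {a..b} (\<lambda>t. H t * J t))"
  proof (rule nn)
    have "((\<lambda>t. H t * J t) has_integral integral {a..b} (\<lambda>t. H t * J t)) {a..b}"
      using cH by (intro integrable_integral integrable_continuous_real)
    then show "((\<lambda>t. \<bar>H t * J t\<bar>) has_integral integral {a..b} (\<lambda>t. H t * J t)) {a..b}"
      by (rule has_integral_eq[rotated]) (use J0 H in \<open>auto simp: abs_mult\<close>)
  qed simp
  finally show ?thesis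
    using J0 H by (subst (asm) ennreal_le_iff) (auto intro!: integral_nonneg integrable_continuous_real cH)
qed

section \<open>Estimates for the Taylor remainder\<close>

text \<open>The supremum is taken in the reals, so boundedness is needed; it follows from continuity
  of the indefinite integral on a compact interval.\<close>

lemma alexiewicz_norm_upper:
  assumes "h integrable_on {a..c}" "x \<in> {a..c}"
  shows "\<bar>integral {a..x} h\<bar> \<le> alexiewicz_norm a c h"
proof -
  have "continuous_on {a..c} (\<lambda>x. \<bar>integral {a..x} h\<bar>)"
    using indefinite_integral_continuous_1[OF assms(1)] by (intro continuous_intros)
  then have "bdd_above ((\<lambda>x. \<bar>integral {a..x} h\<bar>) ` {a..c})"
    by (intro bounded_imp_bdd_above compact_imp_bounded compact_continuous_image compact_Icc)
  then show ?thesis unfolding alexiewicz_norm_def by (rule cSUP_upper[OF assms(2)])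
qed

lemma alexiewicz_norm_leI:
  assumes "a \<le> c" "\<And>x. x \<in> {a..c} \<Longrightarrow> \<bar>integral {a..x} h\<bar> \<le> M"
  shows "alexiewicz_norm a c h \<le> M"
  unfolding alexiewicz_norm_def using assms by (intro cSUP_least) auto

lemma alexiewicz_norm_mono:
  assumes "h integrable_on {a..c}" "x \<in> {a..c}"
  shows "alexiewicz_norm a x h \<le> alexiewicz_norm a c h"
  using assms by (intro alexiewicz_norm_leI alexiewicz_norm_upper) auto

lemma alexiewicz_norm_nonneg:
  assumes "h integrable_on {a..c}" "a \<le> c"
  shows "0 \<le> alexiewicz_norm a c h"
  using alexiewicz_norm_upper[OF assms(1), of a] assms(2) by simp

section \<open>Integral form of the Taylor remainder\<close>

lemma has_integral_power_right:
  fixes a x :: real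
  assumes "a \<le> x"
  shows "((\<lambda>t. (x - t) ^ m) has_integral (x - a) ^ Suc m / Suc m) {a..x}"
proof -
  have "((\<lambda>t. (x - t) ^ m) has_integral (- ((x - x) ^ Suc m / Suc m)) - (- ((x - a) ^ Suc m / Suc m))) {a..x}"
  proof (rule fundamental_theorem_of_calculus[OF assms])
    fix t assume "t \<in> {a..x}"
    have "((\<lambda>t. - ((x - t) ^ Suc m / Suc m)) has_real_derivative (x - t) ^ m) (at t within {a..x})"
      by (rule derivative_eq_intros | simp add: divide_simps)+
    then show "((\<lambda>t. - ((x - t) ^ Suc m / Suc m)) has_vector_derivative (x - t) ^ m) (at t within {a..x})"
      by (simp add: has_real_derivative_iff_has_vector_derivative)
  qed
  then show ?thesis by simp
qed

lemma has_integral_power_left: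
  fixes a x :: real
  assumes "a \<le> x"
  shows "((\<lambda>t. (t - a) ^ m) has_integral (x - a) ^ Suc m / Suc m) {a..x}"
proof -
  have "((\<lambda>t. (t - a) ^ m) has_integral (x - a) ^ Suc m / Suc m - (a - a) ^ Suc m / Suc m) {a..x}"
  proof (rule fundamental_theorem_of_calculus[OF assms])
    fix t assume "t \<in> {a..x}"
    have "((\<lambda>t. (t - a) ^ Suc m / Suc m) has_real_derivative (t - a) ^ m) (at t within {a..x})"
      by (rule derivative_eq_intros | simp add: divide_simps)+
    then show "((\<lambda>t. (t - a) ^ Suc m / Suc m) has_vector_derivative (t - a) ^ m) (at t within {a..x})"
      by (simp add: has_real_derivative_iff_has_vector_derivative)
  qed
  then show ?thesis by simp
qed

lemma has_vector_derivative_nth_deriv_on: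
  assumes "times_differentiable_on n f S" "k < n" "x \<in> S"
  shows "(nth_deriv_on S k f has_vector_derivative nth_deriv_on S (Suc k) f x) (at x within S)"
  using assms by (simp add: times_differentiable_on_def differentiable_on_def vector_derivative_works)

lemma taylor_rem_Suc:
  "taylor_rem a b (Suc m) f x =
    taylor_rem a b m f x - nth_deriv_on {a..b} (Suc m) f a * (x - a) ^ Suc m / fact (Suc m)"
  by (simp add: taylor_rem_def taylor_poly_def)

text \<open>Used with \<open>Suc m = n\<close>: the remainder of order \<open>n - 1\<close> involves
  only derivatives that exist everywhere on \<open>{a..b}\<close>.\<close>

lemma has_integral_taylor_rem:
  assumes "times_differentiable_on (Suc m) f {a..b}" and x: "x \<in> {a..b}"
  shows "((\<lambda>t. (x - t) ^ m / fact m * nth_deriv_on {a..b} (Suc m) f t) has_integral taylor_rem a b m f x) {a..x}"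
proof -
  have "((\<lambda>t. ((x - t) ^ (Suc m - 1) / fact (Suc m - 1)) *\<^sub>R nth_deriv_on {a..b} (Suc m) f t) has_integral
      f x - (\<Sum>i<Suc m. ((x - a) ^ i / fact i) *\<^sub>R nth_deriv_on {a..b} i f a)) {a..x}"
  proof (rule Taylor_has_integral)
    fix k t assume "k < Suc m" "a \<le> t" "t \<le> x"
    then have "(nth_deriv_on {a..b} k f has_vector_derivative nth_deriv_on {a..b} (Suc k) f t) (at t within {a..b})"
      using x by (intro has_vector_derivative_nth_deriv_on[OF assms(1)]) auto
    then show "(nth_deriv_on {a..b} k f has_vector_derivative nth_deriv_on {a..b} (Suc k) f t) (at t within {a..x})"
      by (rule has_vector_derivative_within_subset) (use x in auto)
  qed (use x in auto)
  moreover have "f x - (\<Sum>i<Suc m. ((x - a) ^ i / fact i) *\<^sub>R nth_deriv_on {a..b} i f a) = taylor_rem a b m f x"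
    by (simp add: taylor_rem_def taylor_poly_def lessThan_Suc_atMost mult.commute)
  ultimately show ?thesis by simp
qed

lemma continuous_on_taylor_rem:
  assumes "continuous_on {a..b} f"
  shows "continuous_on {a..b} (taylor_rem a b m f)"
  unfolding taylor_rem_def[abs_def] taylor_poly_def using assms by (intro continuous_intros) auto

text \<open>The kernel estimates serve two choices: \<open>g\<close> the \<open>n\<close>-th
  derivative with \<open>r\<close> the remainder of order \<open>n - 1\<close>, and \<open>g\<close>
  the top derivative minus its value at \<open>a\<close>, with \<open>r\<close> the remainder of
  that same order.\<close>

locale iterated_primitive =
  fixes a b :: real and m :: nat and g r :: "real \<Rightarrow> real"
  assumes ab: "a < b"
    and g: "continuous_on {a..b} g"
    and r: "continuous_on {a..b} r"
    and r_integral: "x \<in> {a..b} \<Longrightarrow> ((\<lambda>t. (x - t) ^ m / fact m * g t) has_integral r x) {a..x}"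
begin

lemma g_sub: "x \<in> {a..b} \<Longrightarrow> continuous_on {a..x} g"
  by (rule continuous_on_subset[OF g]) auto

lemma abs_le:
  assumes x: "x \<in> {a..b}"
  shows "\<bar>r x\<bar> \<le> integral {a..x} (\<lambda>t. (x - t) ^ m * \<bar>g t\<bar>) / fact m"
proof -
  have "norm (integral {a..x} (\<lambda>t. (x - t) ^ m / fact m * g t)) \<le>
      integral {a..x} (\<lambda>t. (x - t) ^ m * \<bar>g t\<bar> / fact m)"
  proof (rule integral_norm_bound_integral)
    show "(\<lambda>t. (x - t) ^ m / fact m * g t) integrable_on {a..x}" using r_integral[OF x] by blast
    show "(\<lambda>t. (x - t) ^ m * \<bar>g t\<bar> / fact m) integrable_on {a..x}"
      using g_sub[OF x] by (intro integrable_continuous_real continuous_intros) auto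
  qed (auto simp: abs_mult)
  then have "norm (r x) \<le> integral {a..x} (\<lambda>t. (x - t) ^ m * \<bar>g t\<bar> / fact m)"
    by (simp only: integral_unique[OF r_integral[OF x]])
  then show ?thesis by simp
qed

lemma abs_le_sup:
  assumes x: "x \<in> {a..b}" and M: "\<And>t. t \<in> {a..x} \<Longrightarrow> \<bar>g t\<bar> \<le> M"
  shows "\<bar>r x\<bar> \<le> (x - a) ^ Suc m / fact (Suc m) * M"
proof -
  have "integral {a..x} (\<lambda>t. (x - t) ^ m * \<bar>g t\<bar>) \<le> integral {a..x} (\<lambda>t. (x - t) ^ m * M)"
    using g_sub[OF x] M
    by (intro integral_le integrable_continuous_real continuous_intros mult_left_mono) auto
  also have "\<dots> = (x - a) ^ Suc m / Suc m * M"
    using has_integral_power_right[of a x m] x by (simp add: integral_unique)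
  finally have "integral {a..x} (\<lambda>t. (x - t) ^ m * \<bar>g t\<bar>) / fact m \<le> (x - a) ^ Suc m / Suc m * M / fact m"
    by (intro divide_right_mono) auto
  with abs_le[OF x] show ?thesis by (simp add: mult.commute)
qed

text \<open>The case \<open>\<alpha> = \<infinity>\<close>, \<open>\<beta> = 1\<close> of
  \<open>A\<^sub>2\<close>: integrating the kernel turns \<open>fact m\<close> into
  \<open>fact (Suc m)\<close>.\<close>

lemma Lp_norm_le_Linf_norm:
  assumes "1 \<le> p"
  shows "Lp_norm (ereal p) a b r \<le>
    ereal ((b - a) powr (real m + 1 + 1 / p) / (fact (Suc m) * ((real m + 1) * p + 1) powr (1 / p)))
      * Lp_norm \<infinity> a b g"
proof -
  obtain M where M: "Lp_norm \<infinity> a b g = ereal M" "\<And>t. t \<in> {a..b} \<Longrightarrow> \<bar>g t\<bar> \<le> M"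
    using Linf_norm_continuous[OF ab g] by blast
  have "0 \<le> M" using M(2)[of a] ab by (meson abs_ge_zero atLeastAtMost_iff less_imp_le order_refl order_trans)
  have "\<bar>r x\<bar> \<le> M / fact (Suc m) * (x - a) powr (real m + 1)" if "a < x" "x \<le> b" for x
  proof -
    have "\<bar>r x\<bar> \<le> (x - a) ^ Suc m / fact (Suc m) * M" using M(2) that by (intro abs_le_sup) auto
    also have "(x - a) ^ Suc m = (x - a) powr (real m + 1)"
      using that powr_realpow[of "x - a" "Suc m"] by (simp add: add.commute)
    finally show ?thesis by (simp add: mult.commute)
  qed
  then have "Lp_norm (ereal p) a b r \<le> ereal ((b - a) powr (real m + 1 + 1 / p) /
      ((real m + 1) * p + 1) powr (1 / p) * (M / fact (Suc m)))"
    using assms \<open>0 \<le> M\<close> by (intro Lp_norm_le_powr ab r) auto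
  then show ?thesis by (simp add: M(1) mult_ac)
qed

text \<open>The case \<open>\<alpha> = 1\<close> of \<open>A\<^sub>2\<close>: the kernel is bounded
  by \<open>(x - a) ^ m\<close>, its value at \<open>t = a\<close>.\<close>

lemma Lp_norm_le_L1_norm:
  assumes "1 \<le> p"
  shows "Lp_norm (ereal p) a b r \<le>
    ereal ((b - a) powr (real m + 1 / p) / (fact m * (real m * p + 1) powr (1 / p))) * Lp_norm 1 a b g"
proof -
  define L where "L = integral {a..b} (\<lambda>t. \<bar>g t\<bar>)"
  have "L \<ge> 0" unfolding L_def using g by (intro integral_nonneg integrable_continuous_real continuous_intros) auto
  have L: "Lp_norm 1 a b g = ereal L"
    using Lp_norm_continuous[OF g, of 1] \<open>L \<ge> 0\<close> by (simp add: one_ereal_def L_def)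
  have "\<bar>r x\<bar> \<le> L / fact m * (x - a) powr real m" if "a < x" "x \<le> b" for x
  proof -
    have x: "x \<in> {a..b}" using that by simp
    have "integral {a..x} (\<lambda>t. (x - t) ^ m * \<bar>g t\<bar>) \<le> integral {a..x} (\<lambda>t. (x - a) ^ m * \<bar>g t\<bar>)"
      using g_sub[OF x]
      by (intro integral_le integrable_continuous_real continuous_intros mult_right_mono power_mono) auto
    also have "\<dots> = (x - a) ^ m * integral {a..x} (\<lambda>t. \<bar>g t\<bar>)" by simp
    also have "integral {a..x} (\<lambda>t. \<bar>g t\<bar>) \<le> L"
      unfolding L_def using g g_sub[OF x] x
      by (intro integral_subset_le integrable_continuous_real continuous_intros) auto
    finally have "integral {a..x} (\<lambda>t. (x - t) ^ m * \<bar>g t\<bar>) \<le> (x - a) ^ m * L"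
      using that by (simp add: mult_left_mono)
    then have "integral {a..x} (\<lambda>t. (x - t) ^ m * \<bar>g t\<bar>) / fact m \<le> (x - a) ^ m * L / fact m"
      by (intro divide_right_mono) auto
    with abs_le[OF x] show ?thesis using that by (simp add: powr_realpow mult.commute)
  qed
  then have "Lp_norm (ereal p) a b r \<le> ereal ((b - a) powr (real m + 1 / p) /
      (real m * p + 1) powr (1 / p) * (L / fact m))"
    using assms \<open>0 \<le> L\<close> by (intro Lp_norm_le_powr ab r) auto
  then show ?thesis by (simp add: L mult_ac)
qed

text \<open>Hoelder on \<open>{a..x}\<close>: the \<open>\<beta>\<close>-norm of the kernel is a
  multiple of the power \<open>m + 1 / \<beta>\<close> of \<open>x - a\<close>, whose
  \<open>p\<close>-norm gives the last factor.\<close>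

lemma Lp_norm_le_Lq_norm:
  assumes "1 \<le> p" and \<alpha>\<beta>: "1 < \<alpha>" "1 < \<beta>" "1 / \<alpha> + 1 / \<beta> = 1"
  shows "Lp_norm (ereal p) a b r \<le>
    ereal ((b - a) powr (real m + 1 / p + 1 / \<beta>) / (fact m * (real m * \<beta> + 1) powr (1 / \<beta>)
      * ((real m + 1 / \<beta>) * p + 1) powr (1 / p))) * Lp_norm (ereal \<alpha>) a b g"
proof -
  define L where "L = integral {a..b} (\<lambda>t. \<bar>g t\<bar> powr \<alpha>) powr (1 / \<alpha>)"
  have "L \<ge> 0" by (simp add: L_def)
  have L: "Lp_norm (ereal \<alpha>) a b g = ereal L"
    using Lp_norm_continuous[OF g, of \<alpha>] \<alpha>\<beta> by (simp add: L_def)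
  define c where "c = (real m * \<beta> + 1) powr (1 / \<beta>)"
  have "c \<ge> 0" by (simp add: c_def)
  have "\<bar>r x\<bar> \<le> L / (fact m * c) * (x - a) powr (real m + 1 / \<beta>)" if "a < x" "x \<le> b" for x
  proof -
    have x: "x \<in> {a..b}" using that by simp
    have cg: "continuous_on {a..b} (\<lambda>t. \<bar>g t\<bar> powr \<alpha>)" "continuous_on {a..x} (\<lambda>t. \<bar>g t\<bar> powr \<alpha>)"
      using g g_sub[OF x] \<alpha>\<beta> by (auto intro!: continuous_on_abs_powr)
    have "integral {a..x} (\<lambda>t. (x - t) ^ m * \<bar>g t\<bar>) \<le>
        integral {a..x} (\<lambda>t. ((x - t) ^ m) powr \<beta>) powr (1 / \<beta>) * integral {a..x} (\<lambda>t. \<bar>g t\<bar> powr \<alpha>) powr (1 / \<alpha>)"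
      using \<open>a < x\<close> g_sub[OF x] \<alpha>\<beta> by (intro Holder_continuous continuous_intros) auto
    also have "integral {a..x} (\<lambda>t. ((x - t) ^ m) powr \<beta>) = (x - a) powr (real m * \<beta> + 1) / (real m * \<beta> + 1)"
      using that \<alpha>\<beta> by (intro integral_unique has_integral_power_powr_right) auto
    also have "\<dots> powr (1 / \<beta>) = (x - a) powr (real m + 1 / \<beta>) / c"
    proof -
      have "(real m * \<beta> + 1) * (1 / \<beta>) = real m + 1 / \<beta>" using \<alpha>\<beta> by (simp add: field_simps)
      then show ?thesis using that \<alpha>\<beta> by (simp only: c_def powr_divide powr_powr)
    qed
    also have "\<dots> * integral {a..x} (\<lambda>t. \<bar>g t\<bar> powr \<alpha>) powr (1 / \<alpha>) \<le> (x - a) powr (real m + 1 / \<beta>) / c * L"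
      unfolding L_def using \<open>c \<ge> 0\<close> cg x \<alpha>\<beta>
      by (intro mult_left_mono powr_mono2 integral_subset_le integral_nonneg integrable_continuous_real) auto
    finally have "integral {a..x} (\<lambda>t. (x - t) ^ m * \<bar>g t\<bar>) / fact m \<le> (x - a) powr (real m + 1 / \<beta>) / c * L / fact m"
      by (intro divide_right_mono) auto
    with abs_le[OF x] show ?thesis by (simp add: mult_ac)
  qed
  then have "Lp_norm (ereal p) a b r \<le> ereal ((b - a) powr (real m + 1 / \<beta> + 1 / p) /
      ((real m + 1 / \<beta>) * p + 1) powr (1 / p) * (L / (fact m * c)))"
    using assms \<open>0 \<le> L\<close> \<open>c \<ge> 0\<close> by (intro Lp_norm_le_powr ab r) auto
  then show ?thesis by (simp add: L c_def mult_ac add_ac)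
qed

lemma Lp_norm_le_convolution:
  assumes "1 \<le> p" "0 \<le> C" and K: "continuous_on UNIV K" "\<And>s. 0 \<le> K s"
    and le: "\<And>x. a < x \<Longrightarrow> x \<le> b \<Longrightarrow> \<bar>r x\<bar> powr p \<le> C * integral {a..x} (\<lambda>t. K (x - t) * \<bar>g t\<bar> powr p)"
    and J: "\<And>t. t \<in> {a..b} \<Longrightarrow> ((\<lambda>x. K (x - t)) has_integral J t) {t..b}" "continuous_on {a..b} J"
  shows "Lp_norm (ereal p) a b r \<le> ereal ((C * integral {a..b} (\<lambda>t. \<bar>g t\<bar> powr p * J t)) powr (1 / p))"
proof -
  \<comment> \<open>The Tonelli bound wants a continuous factor on the whole line, so
    \<open>g\<close> is continued by constants; \<open>C\<close> is absorbed as well.\<close>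
  define h where "h t = C * \<bar>g (max a (min b t))\<bar> powr p" for t
  have hg: "h t = C * \<bar>g t\<bar> powr p" if "t \<in> {a..b}" for t using that by (simp add: h_def)
  have "continuous_on UNIV (\<lambda>t. g (max a (min b t)))"
    using ab by (intro continuous_on_compose2[OF g]) (auto intro!: continuous_intros)
  then have ch: "continuous_on UNIV h"
    unfolding h_def using assms by (intro continuous_on_mult continuous_on_const continuous_on_abs_powr) auto
  have "integral {a..b} (\<lambda>x. \<bar>r x\<bar> powr p) \<le> integral {a..b} (\<lambda>t. h t * J t)"
  proof (rule integral_le_convolution[OF _ K ch])
    show "continuous_on {a..b} (\<lambda>x. \<bar>r x\<bar> powr p)" using r assms by (intro continuous_on_abs_powr) auto
    fix x assume x: "x \<in> {a..b}"
    have "integral {a..x} (\<lambda>t. K (x - t) * h t) = integral {a..x} (\<lambda>t. C * (K (x - t) * \<bar>g t\<bar> powr p))"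
      using x by (intro integral_cong) (simp add: hg)
    then have eq: "integral {a..x} (\<lambda>t. K (x - t) * h t) = C * integral {a..x} (\<lambda>t. K (x - t) * \<bar>g t\<bar> powr p)"
      by simp
    show "\<bar>r x\<bar> powr p \<le> integral {a..x} (\<lambda>t. K (x - t) * h t)"
    proof (cases "x = a")
      \<comment> \<open>The hypothesis says nothing at \<open>a\<close>, because Jensen needs a
        weight of positive mass on \<open>{a..x}\<close>. There \<open>r\<close> vanishes, being an
        integral over one point.\<close>
      case True
      have "r x = 0" using abs_le[OF x] True by simp
      then show ?thesis using True by simp
    next
      case False
      then show ?thesis using le[of x] x eq by simp
    qed
  qed (use ab J \<open>0 \<le> C\<close> in \<open>auto simp: h_def\<close>)
  also have "integral {a..b} (\<lambda>t. h t * J t) = integral {a..b} (\<lambda>t. C * (\<bar>g t\<bar> powr p * J t))"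
    by (intro integral_cong) (simp add: hg)
  finally have "integral {a..b} (\<lambda>x. \<bar>r x\<bar> powr p) \<le> C * integral {a..b} (\<lambda>t. \<bar>g t\<bar> powr p * J t)" by simp
  moreover have "0 \<le> integral {a..b} (\<lambda>x. \<bar>r x\<bar> powr p)"
    using r assms by (intro integral_nonneg integrable_continuous_real continuous_on_abs_powr) auto
  ultimately show ?thesis
    using \<open>1 \<le> p\<close> by (simp add: Lp_norm_continuous[OF r] powr_mono2)
qed

text \<open>Jensen with weight \<open>1\<close> on \<open>{a..x}\<close> costs
  \<open>(x - a) powr (p - 1)\<close>, at most \<open>(b - a) powr (p - 1)\<close>. The kernel keeps
  its \<open>p\<close>-th power, whose integral over \<open>{t..b}\<close> produces the weight in
  \<open>A\<^sub>3\<close>.\<close>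

lemma Lp_norm_le_weighted1:
  assumes "1 \<le> p"
  shows "Lp_norm (ereal p) a b r \<le> ereal ((b - a) powr (1 - 1 / p) / (fact m * (real m * p + 1) powr (1 / p))
    * integral {a..b} (\<lambda>t. \<bar>g t\<bar> powr p * (b - t) powr (real m * p + 1)) powr (1 / p))"
proof -
  define C where "C = (b - a) powr (p - 1) / fact m powr p"
  define I where "I = integral {a..b} (\<lambda>t. \<bar>g t\<bar> powr p * (b - t) powr (real m * p + 1))"
  have mp: "0 \<le> real m * p" using assms by simp
  then have pos: "0 < real m * p + 1" by linarith
  have "I \<ge> 0" unfolding I_def using mp assms
    by (intro integral_nonneg integrable_continuous_real continuous_on_mult continuous_on_abs_powr
        continuous_on_powr' continuous_intros g) (auto simp: pos)
  have "Lp_norm (ereal p) a b r \<le>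
    ereal ((C * integral {a..b} (\<lambda>t. \<bar>g t\<bar> powr p * ((b - t) powr (real m * p + 1) / (real m * p + 1)))) powr (1 / p))"
  proof (rule Lp_norm_le_convolution[OF assms, where K = "\<lambda>s. \<bar>s ^ m\<bar> powr p"])
    fix x assume "a < x" "x \<le> b"
    then have x: "x \<in> {a..b}" by simp
    have eq: "((x - t) ^ m * \<bar>g t\<bar>) powr p = \<bar>(x - t) ^ m\<bar> powr p * \<bar>g t\<bar> powr p" if "t \<in> {a..x}" for t
      using that by (simp add: powr_mult)
    have "integral {a..x} (\<lambda>t. 1 * ((x - t) ^ m * \<bar>g t\<bar>)) powr p \<le>
        integral {a..x} (\<lambda>t. 1) powr (p - 1) * integral {a..x} (\<lambda>t. 1 * ((x - t) ^ m * \<bar>g t\<bar>) powr p)"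
      using \<open>a < x\<close> g_sub[OF x] assms by (intro weighted_power_mean_continuous continuous_intros) auto
    also have "integral {a..x} (\<lambda>t. 1 * ((x - t) ^ m * \<bar>g t\<bar>) powr p) = integral {a..x} (\<lambda>t. \<bar>(x - t) ^ m\<bar> powr p * \<bar>g t\<bar> powr p)"
      by (intro integral_cong) (simp add: eq)
    also have "integral {a..x} (\<lambda>t. 1 :: real) powr (p - 1) * \<dots> \<le> (b - a) powr (p - 1) * \<dots>"
      using x assms g_sub[OF x]
      by (intro mult_right_mono powr_mono2 integral_nonneg integrable_continuous_real continuous_on_mult
          continuous_on_abs_powr continuous_intros) auto
    finally have le: "integral {a..x} (\<lambda>t. (x - t) ^ m * \<bar>g t\<bar>) powr p \<le>
        (b - a) powr (p - 1) * integral {a..x} (\<lambda>t. \<bar>(x - t) ^ m\<bar> powr p * \<bar>g t\<bar> powr p)" by simp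
    have "\<bar>r x\<bar> powr p \<le> (integral {a..x} (\<lambda>t. (x - t) ^ m * \<bar>g t\<bar>) / fact m) powr p"
      using abs_le[OF x] assms by (intro powr_mono2) auto
    also have "\<dots> = integral {a..x} (\<lambda>t. (x - t) ^ m * \<bar>g t\<bar>) powr p / fact m powr p"
      using g_sub[OF x] by (intro powr_divide)
    also have "\<dots> \<le> (b - a) powr (p - 1) * integral {a..x} (\<lambda>t. \<bar>(x - t) ^ m\<bar> powr p * \<bar>g t\<bar> powr p) / fact m powr p"
      using le by (intro divide_right_mono) auto
    finally show "\<bar>r x\<bar> powr p \<le> C * integral {a..x} (\<lambda>t. \<bar>(x - t) ^ m\<bar> powr p * \<bar>g t\<bar> powr p)"
      by (simp add: C_def)
  next
    fix t assume t: "t \<in> {a..b}"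
    show "((\<lambda>x. \<bar>(x - t) ^ m\<bar> powr p) has_integral (b - t) powr (real m * p + 1) / (real m * p + 1)) {t..b}"
      by (rule has_integral_eq[OF _ has_integral_power_powr_left]) (use t assms in auto)
  next
    show "continuous_on UNIV (\<lambda>s :: real. \<bar>s ^ m\<bar> powr p)"
      using assms by (intro continuous_on_abs_powr continuous_intros) auto
    show "continuous_on {a..b} (\<lambda>t. (b - t) powr (real m * p + 1) / (real m * p + 1))"
      using mp by (intro continuous_on_divide continuous_on_powr' continuous_intros) auto
  qed (auto simp: C_def)
  also have "integral {a..b} (\<lambda>t. \<bar>g t\<bar> powr p * ((b - t) powr (real m * p + 1) / (real m * p + 1))) = I / (real m * p + 1)"
    by (simp add: I_def)
  also have "(C * (I / (real m * p + 1))) powr (1 / p) =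
      (b - a) powr (1 - 1 / p) / (fact m * (real m * p + 1) powr (1 / p)) * I powr (1 / p)"
  proof -
    have "(p - 1) * (1 / p) = 1 - 1 / p" "p * (1 / p) = 1" using assms by (simp_all add: field_simps)
    then have "C powr (1 / p) = (b - a) powr (1 - 1 / p) / fact m"
      unfolding C_def by (simp only: powr_divide powr_powr) simp
    moreover have "C \<ge> 0" by (simp add: C_def)
    ultimately show ?thesis using \<open>I \<ge> 0\<close> mp by (simp add: powr_mult powr_divide)
  qed
  finally show ?thesis by (simp add: I_def)
qed

text \<open>Here the kernel itself is the weight in Jensen's inequality, so it enters Tonelli to the
  first power; its mass is at most \<open>(b - a) ^ Suc m / Suc m\<close>.\<close>

lemma Lp_norm_le_weighted2:
  assumes "1 \<le> p"
  shows "Lp_norm (ereal p) a b r \<le> ereal ((b - a) powr (real (Suc m) * (1 - 1 / p)) / fact (Suc m)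
    * integral {a..b} (\<lambda>t. \<bar>g t\<bar> powr p * (b - t) ^ Suc m) powr (1 / p))"
proof -
  define C where "C = ((b - a) ^ Suc m / Suc m) powr (p - 1) / fact m powr p"
  define I where "I = integral {a..b} (\<lambda>t. \<bar>g t\<bar> powr p * (b - t) ^ Suc m)"
  have "I \<ge> 0" unfolding I_def using assms
    by (intro integral_nonneg integrable_continuous_real continuous_on_mult continuous_on_abs_powr
        continuous_intros g) auto
  have "Lp_norm (ereal p) a b r \<le>
    ereal ((C * integral {a..b} (\<lambda>t. \<bar>g t\<bar> powr p * ((b - t) ^ Suc m / Suc m))) powr (1 / p))"
  proof (rule Lp_norm_le_convolution[OF assms, where K = "\<lambda>s. \<bar>s ^ m\<bar>"])
    fix x assume "a < x" "x \<le> b"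
    then have x: "x \<in> {a..b}" by simp
    have int: "integral {a..x} (\<lambda>t. (x - t) ^ m) = (x - a) ^ Suc m / Suc m"
      using \<open>a < x\<close> by (intro integral_unique has_integral_power_right) auto
    have "integral {a..x} (\<lambda>t. (x - t) ^ m * \<bar>g t\<bar>) powr p \<le>
        integral {a..x} (\<lambda>t. (x - t) ^ m) powr (p - 1) * integral {a..x} (\<lambda>t. (x - t) ^ m * \<bar>g t\<bar> powr p)"
      using \<open>a < x\<close> g_sub[OF x] assms int by (intro weighted_power_mean_continuous continuous_intros) auto
    also have "integral {a..x} (\<lambda>t. (x - t) ^ m * \<bar>g t\<bar> powr p) = integral {a..x} (\<lambda>t. \<bar>(x - t) ^ m\<bar> * \<bar>g t\<bar> powr p)"
      by (intro integral_cong) simp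
    also have "integral {a..x} (\<lambda>t. (x - t) ^ m) powr (p - 1) * \<dots> \<le> ((b - a) ^ Suc m / Suc m) powr (p - 1) * \<dots>"
      unfolding int using x assms g_sub[OF x]
      by (intro mult_right_mono powr_mono2 divide_right_mono power_mono integral_nonneg integrable_continuous_real
          continuous_on_mult continuous_on_abs_powr continuous_intros) auto
    finally have le: "integral {a..x} (\<lambda>t. (x - t) ^ m * \<bar>g t\<bar>) powr p \<le>
        ((b - a) ^ Suc m / Suc m) powr (p - 1) * integral {a..x} (\<lambda>t. \<bar>(x - t) ^ m\<bar> * \<bar>g t\<bar> powr p)" .
    have "\<bar>r x\<bar> powr p \<le> (integral {a..x} (\<lambda>t. (x - t) ^ m * \<bar>g t\<bar>) / fact m) powr p"
      using abs_le[OF x] assms by (intro powr_mono2) auto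
    also have "\<dots> = integral {a..x} (\<lambda>t. (x - t) ^ m * \<bar>g t\<bar>) powr p / fact m powr p"
      by (intro powr_divide)
    also have "\<dots> \<le> ((b - a) ^ Suc m / Suc m) powr (p - 1) * integral {a..x} (\<lambda>t. \<bar>(x - t) ^ m\<bar> * \<bar>g t\<bar> powr p) / fact m powr p"
      using le by (intro divide_right_mono) auto
    finally show "\<bar>r x\<bar> powr p \<le> C * integral {a..x} (\<lambda>t. \<bar>(x - t) ^ m\<bar> * \<bar>g t\<bar> powr p)"
      by (simp add: C_def)
  next
    fix t assume t: "t \<in> {a..b}"
    have "((\<lambda>x. (x - t) ^ m) has_integral (b - t) ^ Suc m / Suc m) {t..b}"
      using t by (intro has_integral_power_left) auto
    then show "((\<lambda>x. \<bar>(x - t) ^ m\<bar>) has_integral (b - t) ^ Suc m / Suc m) {t..b}"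
      by (rule has_integral_eq[rotated]) simp
  qed (auto simp: C_def intro!: continuous_intros)
  also have "integral {a..b} (\<lambda>t. \<bar>g t\<bar> powr p * ((b - t) ^ Suc m / Suc m)) = I / Suc m"
    by (simp add: I_def)
  also have "(C * (I / Suc m)) powr (1 / p) =
      (b - a) powr (real (Suc m) * (1 - 1 / p)) / fact (Suc m) * I powr (1 / p)"
  proof -
    have e: "(p - 1) * (1 / p) = 1 - 1 / p" "p * (1 / p) = 1" using assms by (simp_all add: field_simps)
    then have "C powr (1 / p) = ((b - a) ^ Suc m / Suc m) powr (1 - 1 / p) / fact m"
      unfolding C_def by (simp only: powr_divide powr_powr) simp
    also have "\<dots> = (b - a) powr (real (Suc m) * (1 - 1 / p)) / Suc m powr (1 - 1 / p) / fact m"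
      using ab power_powr[of "b - a" "Suc m" "1 - 1 / p"] by (simp only: powr_divide)
    finally have "C powr (1 / p) = (b - a) powr (real (Suc m) * (1 - 1 / p)) / Suc m powr (1 - 1 / p) / fact m" .
    moreover have "C \<ge> 0" by (simp add: C_def)
    \<comment> \<open>The mass of the kernel and Tonelli's inner integral each contribute a power of
      \<open>Suc m\<close>; the exponents add up to \<open>1\<close> and complete
      \<open>fact m\<close> to \<open>fact (Suc m)\<close>.\<close>
    moreover have "X / real (Suc m) powr (1 - 1 / p) / fact m * (Y / real (Suc m) powr (1 / p)) =
        X / fact (Suc m) * Y" for X Y :: real
    proof -
      have "X / real (Suc m) powr (1 - 1 / p) / fact m * (Y / real (Suc m) powr (1 / p)) =
          X * Y / (real (Suc m) powr (1 - 1 / p) * real (Suc m) powr (1 / p) * fact m)"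
        by (simp add: mult_ac del: of_nat_Suc)
      also have "real (Suc m) powr (1 - 1 / p) * real (Suc m) powr (1 / p) = real (Suc m)"
        by (simp flip: powr_add del: of_nat_Suc)
      finally show ?thesis by simp
    qed
    ultimately show ?thesis using \<open>I \<ge> 0\<close> by (simp only: powr_mult powr_divide)
  qed
  finally show ?thesis by (simp add: I_def)
qed

end

text \<open>The Newton--Leibniz formula is a hypothesis so that the bound applies at two orders: at
  \<open>n\<close> by the theorem for \<open>ACG_star_on\<close>, and at \<open>n - 1\<close>, where
  the next derivative exists everywhere. The second use includes order \<open>0\<close>, where the
  remainder is just an increment.\<close>

lemma taylor_rem_le_alexiewicz_norm:
  assumes "a < b" and tdo: "times_differentiable_on m f {a..b}"
    and cont: "continuous_on {a..b} (nth_deriv_on {a..b} m f)"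
    and FTC: "\<And>x. x \<in> {a..b} \<Longrightarrow>
      (nth_deriv_on {a..b} (Suc m) f has_integral nth_deriv_on {a..b} m f x - nth_deriv_on {a..b} m f a) {a..x}"
    and contR: "continuous_on {a..b} (taylor_rem a b m f)"
    and x: "x \<in> {a..b}"
  shows "\<bar>taylor_rem a b m f x\<bar> \<le> (x - a) ^ m / fact m * alexiewicz_norm a x (nth_deriv_on {a..b} (Suc m) f)"
proof -
  let ?D = "nth_deriv_on {a..b} m f"
  define N where "N = alexiewicz_norm a x (nth_deriv_on {a..b} (Suc m) f)"
  have int: "nth_deriv_on {a..b} (Suc m) f integrable_on {a..x}" using FTC[OF x] by blast
  have le: "\<bar>?D t - ?D a\<bar> \<le> N" if "t \<in> {a..x}" for t
    using alexiewicz_norm_upper[OF int that] integral_unique[OF FTC[of t]] that x by (simp add: N_def)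
  show ?thesis
  proof (cases m)
    case 0
    then show ?thesis using le[of x] x by (simp add: taylor_rem_def taylor_poly_def N_def)
  next
    case (Suc k)
    interpret iterated_primitive a b k "\<lambda>t. ?D t - ?D a" "taylor_rem a b m f"
    proof
      fix y assume y: "y \<in> {a..b}"
      have "((\<lambda>t. (y - t) ^ k / fact k * ?D t) has_integral taylor_rem a b k f y) {a..y}"
        using has_integral_taylor_rem[of k f a b y] tdo y unfolding Suc by blast
      moreover have "((\<lambda>t. (y - t) ^ k * (?D a / fact k)) has_integral (y - a) ^ Suc k / Suc k * (?D a / fact k)) {a..y}"
        using y by (intro has_integral_mult_left has_integral_power_right) auto
      ultimately have "((\<lambda>t. (y - t) ^ k / fact k * ?D t - (y - t) ^ k * (?D a / fact k)) has_integral
          taylor_rem a b k f y - (y - a) ^ Suc k / Suc k * (?D a / fact k)) {a..y}"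
        by (rule has_integral_diff)
      \<comment> \<open>Subtracting the constant \<open>?D a\<close> under the integral removes
        exactly the top Taylor term, raising the order of the remainder by one.\<close>
      moreover have "taylor_rem a b k f y - (y - a) ^ Suc k / Suc k * (?D a / fact k) = taylor_rem a b m f y"
        unfolding Suc taylor_rem_Suc by (simp add: mult_ac)
      ultimately show "((\<lambda>t. (y - t) ^ k / fact k * (?D t - ?D a)) has_integral taylor_rem a b m f y) {a..y}"
        by (simp add: right_diff_distrib)
    qed (use \<open>a < b\<close> cont contR in \<open>auto intro!: continuous_intros\<close>)
    show ?thesis using abs_le_sup[OF x le] unfolding N_def Suc by blast
  qed
qed

text \<open>In \<open>ereal\<close> the quotient \<open>1 / \<infinity>\<close> is \<open>0\<close>
  and \<open>1 / 0\<close> is infinite; the former forces \<open>\<beta> = 1\<close> when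
  \<open>\<alpha> = \<infinity>\<close>, the latter excludes \<open>\<beta> = 0\<close>.\<close>

lemma conjugate_exponents_cases:
  fixes \<alpha> :: ereal and \<beta> :: real
  assumes "1 < \<alpha>" "1 / \<alpha> + 1 / ereal \<beta> = 1"
  obtains "\<alpha> = \<infinity>" "\<beta> = 1"
  | \<gamma> where "\<alpha> = ereal \<gamma>" "1 < \<gamma>" "1 < \<beta>" "1 / \<gamma> + 1 / \<beta> = 1"
proof (cases \<alpha>)
  case (real \<gamma>)
  then have "1 < \<gamma>" using assms(1) by (simp add: one_ereal_def)
  have "\<beta> \<noteq> 0" using assms(2) by (auto simp: divide_ereal_def one_ereal_def real)
  then have eq: "1 / \<gamma> + 1 / \<beta> = 1"
    using assms(2) \<open>1 < \<gamma>\<close> by (simp add: divide_ereal_def one_ereal_def real inverse_eq_divide)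
  moreover have "0 < 1 / \<gamma>" "1 / \<gamma> < 1" using \<open>1 < \<gamma>\<close> by auto
  ultimately have "0 < 1 / \<beta>" "1 / \<beta> < 1" by linarith+
  then have "1 < \<beta>" by (simp add: divide_less_eq split: if_splits)
  then show thesis using that(2) real \<open>1 < \<gamma>\<close> eq by blast
next
  case PInf
  have "\<beta> \<noteq> 0" using assms(2) by (auto simp: divide_ereal_def one_ereal_def PInf)
  then have "\<beta> = 1"
    using assms(2) by (simp add: divide_ereal_def one_ereal_def PInf inverse_eq_divide)
  then show thesis using that(1) PInf by blast
qed (use assms(1) in auto)

theorem theorem4:
  fixes a b :: real and n :: nat and f :: "real \<Rightarrow> real"
  assumes "a < b"
    and "0 < n"
    and "times_differentiable_on n f {a..b}"
    and "ACG_star_on (nth_deriv_on {a..b} n f) a b"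
  shows
    "negligible {x \<in> {a..b}. \<not> nth_deriv_on {a..b} n f differentiable (at x within {a..b})} \<and>
     nth_deriv_on {a..b} (Suc n) f integrable_on {a..b} \<and>

     alexiewicz_norm a b (taylor_rem a b n f)
       \<le> (b - a) ^ (n + 1) / fact (n + 1) * alexiewicz_norm a b (nth_deriv_on {a..b} (Suc n) f) \<and>

     (\<forall>x\<in>{a..b}. \<bar>taylor_rem a b n f x\<bar>
       \<le> (x - a) ^ n / fact n * alexiewicz_norm a x (nth_deriv_on {a..b} (Suc n) f)) \<and>

     (\<forall>p::real. 1 \<le> p \<longrightarrow>
       Lp_norm (ereal p) a b (taylor_rem a b n f)
         \<le> ereal ((b - a) powr (real n + 1 / p) / (fact n * (real n * p + 1) powr (1 / p))
                  * alexiewicz_norm a b (nth_deriv_on {a..b} (Suc n) f))) \<and>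

     Lp_norm \<infinity> a b (taylor_rem a b n f)
       \<le> ereal ((b - a) ^ n / fact n * alexiewicz_norm a b (nth_deriv_on {a..b} (Suc n) f)) \<and>

     Lp_norm \<infinity> a b (taylor_rem a b n f)
       \<le> ereal ((b - a) ^ n / fact n * \<bar>nth_deriv_on {a..b} n f a\<bar>)
         + ereal ((b - a) ^ n / fact n) * Lp_norm \<infinity> a b (nth_deriv_on {a..b} n f) \<and>

     (\<forall>p::real. 1 \<le> p \<longrightarrow>
       (\<forall>A::ereal.
          A = ereal ((b - a) powr (real n - 1 + 1 / p)
                     * alexiewicz_norm a b (nth_deriv_on {a..b} n f)
                     / (fact (n - 1) * ((real n - 1) * p + 1) powr (1 / p)))
        \<or> n = 1 \<and> A = Lp_norm (ereal p) a b (\<lambda>x. f x - f a)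
        \<or> (\<exists>(\<alpha>::ereal) (\<beta>::real). 1 < \<alpha> \<and> 1 / \<alpha> + 1 / ereal \<beta> = 1 \<and>
             A = ereal ((b - a) powr (real n - 1 + 1 / p + 1 / \<beta>)
                        / (fact (n - 1) * ((real n - 1) * \<beta> + 1) powr (1 / \<beta>)
                           * ((real n - 1 + 1 / \<beta>) * p + 1) powr (1 / p)))
                 * Lp_norm \<alpha> a b (nth_deriv_on {a..b} n f))
        \<or> A = ereal ((b - a) powr (real n - 1 + 1 / p)
                     / (fact (n - 1) * ((real n - 1) * p + 1) powr (1 / p)))
              * Lp_norm 1 a b (nth_deriv_on {a..b} n f)
        \<or> A = ereal ((b - a) powr (1 - 1 / p)
                     / (fact (n - 1) * ((real n - 1) * p + 1) powr (1 / p))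
                     * integral {a..b} (\<lambda>t. \<bar>nth_deriv_on {a..b} n f t\<bar> powr p
                                            * (b - t) powr ((real n - 1) * p + 1)) powr (1 / p))
        \<or> A = ereal ((b - a) powr (real n * (1 - 1 / p)) / fact n
                     * integral {a..b} (\<lambda>t. \<bar>nth_deriv_on {a..b} n f t\<bar> powr p
                                            * (b - t) ^ n) powr (1 / p))
        \<longrightarrow>
          Lp_norm (ereal p) a b (taylor_rem a b n f)
            \<le> ereal ((b - a) powr (real n + 1 / p) / (fact n * (real n * p + 1) powr (1 / p))
                     * \<bar>nth_deriv_on {a..b} n f a\<bar>) + A))"
proof -
  obtain m where n: "n = Suc m" using assms(2) by (cases n) auto
  have mn: "n - 1 = m" "real n - 1 = real m" by (simp_all add: n)
  define g where "g = nth_deriv_on {a..b} n f"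
  define h where "h = nth_deriv_on {a..b} (Suc n) f"
  define R where "R = taylor_rem a b n f"
  define r where "r = taylor_rem a b m f"
  define M where "M = alexiewicz_norm a b h"
  note ab = assms(1)
  have h: "h = (\<lambda>x. vector_derivative g (at x within {a..b}))" by (simp add: h_def g_def)
  have neg: "negligible {x \<in> {a..b}. \<not> g differentiable (at x within {a..b})}"
    unfolding g_def by (rule ACG_star_on_differentiable_ae[OF ab assms(4)])
  have FTC: "(h has_integral g x - g a) {a..x}" if "x \<in> {a..b}" for x
    unfolding h g_def by (rule ACG_star_on_has_integral[OF ab assms(4) that])
  have hint: "h integrable_on {a..b}" using FTC[of b] ab by auto
  have gcont: "continuous_on {a..b} g" using assms(4) by (simp add: ACG_star_on_def g_def)
  have dercont: "continuous_on {a..b} (nth_deriv_on {a..b} k f)" if "k < n" for k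
    using assms(3) that by (auto simp: times_differentiable_on_def intro: differentiable_imp_continuous_on)
  have fcont: "continuous_on {a..b} f" using dercont[of 0] assms(2) by simp
  have Rcont: "continuous_on {a..b} R" and rcont: "continuous_on {a..b} r"
    unfolding R_def r_def by (rule continuous_on_taylor_rem[OF fcont])+
  have "0 \<le> M" unfolding M_def using hint ab by (intro alexiewicz_norm_nonneg) auto
  interpret iterated_primitive a b m g r
  proof
    fix x assume "x \<in> {a..b}"
    with assms(3)[unfolded n]
    show "((\<lambda>t. (x - t) ^ m / fact m * g t) has_integral r x) {a..x}"
      unfolding g_def r_def n by (rule has_integral_taylor_rem)
  qed (rule ab gcont rcont)+
  \<comment> \<open>The top Taylor term split off here is the source of every summand with
    \<open>\<bar>g a\<bar>\<close> in the conclusion.\<close>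
  have R_eq: "R x = r x + - (g a * (x - a) ^ n / fact n)" for x
    unfolding R_def r_def g_def n taylor_rem_Suc by simp
  have R_le: "\<bar>R x\<bar> \<le> (x - a) ^ n / fact n * alexiewicz_norm a x h" if "x \<in> {a..b}" for x
    unfolding R_def h_def using gcont FTC Rcont
    by (intro taylor_rem_le_alexiewicz_norm ab assms(3) that) (auto simp: g_def h_def R_def)
  have R_leM: "\<bar>R x\<bar> \<le> (x - a) ^ n / fact n * M" if "x \<in> {a..b}" for x
  proof -
    have "(x - a) ^ n / fact n * alexiewicz_norm a x h \<le> (x - a) ^ n / fact n * M"
      unfolding M_def using that by (intro mult_left_mono alexiewicz_norm_mono hint) auto
    with R_le[OF that] show ?thesis by linarith
  qed
  have pw: "(x - a) ^ n = (x - a) powr real n" if "a < x" for x using that by (simp add: powr_realpow)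
  have powle: "(x - a) ^ n / fact n \<le> (b - a) ^ n / fact n" if "x \<in> {a..b}" for x
    using that by (intro divide_right_mono power_mono) auto

  \<comment> \<open>Integrating the pointwise bound once more supplies the additional power of
    \<open>b - a\<close> and the factor \<open>n + 1\<close> in the factorial.\<close>
  have c1: "alexiewicz_norm a b R \<le> (b - a) ^ (n + 1) / fact (n + 1) * M"
  proof (rule alexiewicz_norm_leI)
    fix x assume x: "x \<in> {a..b}"
    have 1: "((\<lambda>t. (t - a) ^ n * (M / fact n)) has_integral (x - a) ^ Suc n / Suc n * (M / fact n)) {a..x}"
      using x by (intro has_integral_mult_left has_integral_power_left) auto
    have "norm (integral {a..x} R) \<le> integral {a..x} (\<lambda>t. (t - a) ^ n * (M / fact n))"
    proof (rule integral_norm_bound_integral)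
      show "R integrable_on {a..x}"
        by (intro integrable_continuous_real continuous_on_subset[OF Rcont]) (use x in auto)
      show "norm (R t) \<le> (t - a) ^ n * (M / fact n)" if "t \<in> {a..x}" for t
        using R_leM[of t] that x by simp
    qed (use 1 in blast)
    also have "\<dots> = (x - a) ^ Suc n / fact (Suc n) * M" using integral_unique[OF 1] by simp
    also have "\<dots> \<le> (b - a) ^ Suc n / fact (Suc n) * M"
      using x \<open>0 \<le> M\<close> by (intro mult_right_mono divide_right_mono power_mono) auto
    finally show "\<bar>integral {a..x} R\<bar> \<le> (b - a) ^ (n + 1) / fact (n + 1) * M" by simp
  qed (use ab in simp)

  have c3: "Lp_norm (ereal p) a b R \<le>
      ereal ((b - a) powr (real n + 1 / p) / (fact n * (real n * p + 1) powr (1 / p)) * M)"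
    if "1 \<le> p" for p
  proof -
    have "\<bar>R x\<bar> \<le> M / fact n * (x - a) powr real n" if "a < x" "x \<le> b" for x
      using R_leM[of x] that by (simp add: powr_realpow mult.commute)
    then have "Lp_norm (ereal p) a b R \<le>
        ereal ((b - a) powr (real n + 1 / p) / (real n * p + 1) powr (1 / p) * (M / fact n))"
      using that \<open>0 \<le> M\<close> by (intro Lp_norm_le_powr ab Rcont) auto
    then show ?thesis by (simp add: mult_ac)
  qed

  have c4: "Lp_norm \<infinity> a b R \<le> ereal ((b - a) ^ n / fact n * M)"
  proof (rule Linf_norm_leI[OF Rcont])
    fix x assume x: "x \<in> {a..b}"
    have "(x - a) ^ n / fact n * M \<le> (b - a) ^ n / fact n * M"
      using powle[OF x] \<open>0 \<le> M\<close> by (rule mult_right_mono)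
    with R_leM[OF x] show "\<bar>R x\<bar> \<le> (b - a) ^ n / fact n * M" by linarith
  qed

  have c5: "Lp_norm \<infinity> a b R \<le> ereal ((b - a) ^ n / fact n * \<bar>g a\<bar>) + ereal ((b - a) ^ n / fact n) * Lp_norm \<infinity> a b g"
  proof -
    obtain S where S: "Lp_norm \<infinity> a b g = ereal S" "\<And>x. x \<in> {a..b} \<Longrightarrow> \<bar>g x\<bar> \<le> S"
      using Linf_norm_continuous[OF ab gcont] by blast
    have "\<bar>R x\<bar> \<le> (b - a) ^ n / fact n * \<bar>g a\<bar> + (b - a) ^ n / fact n * S" if x: "x \<in> {a..b}" for x
    proof -
      have "0 \<le> S" using S(2)[OF x] by linarith
      have "\<bar>r x\<bar> \<le> (x - a) ^ n / fact n * S" unfolding n using S(2) x by (intro abs_le_sup) auto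
      also have "\<dots> \<le> (b - a) ^ n / fact n * S" using powle[OF x] \<open>0 \<le> S\<close> by (rule mult_right_mono)
      finally have 1: "\<bar>r x\<bar> \<le> (b - a) ^ n / fact n * S" .
      have "\<bar>g a * (x - a) ^ n / fact n\<bar> = (x - a) ^ n / fact n * \<bar>g a\<bar>" using x by (simp add: abs_mult)
      also have "\<dots> \<le> (b - a) ^ n / fact n * \<bar>g a\<bar>" using powle[OF x] by (rule mult_right_mono) simp
      finally show ?thesis using 1 R_eq[of x] by linarith
    qed
    then have "Lp_norm \<infinity> a b R \<le> ereal ((b - a) ^ n / fact n * \<bar>g a\<bar> + (b - a) ^ n / fact n * S)"
      by (intro Linf_norm_leI Rcont) blast
    then show ?thesis by (simp add: S(1))
  qed

  \<comment> \<open>Reduces all choices of \<open>A\<close> to a single kind of claim: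
    \<open>A\<close> bounds the \<open>p\<close>-norm of the remainder \<open>r\<close> of order
    \<open>n - 1\<close>.\<close>
  have c6: "Lp_norm (ereal p) a b R \<le>
      ereal ((b - a) powr (real n + 1 / p) / (fact n * (real n * p + 1) powr (1 / p)) * \<bar>g a\<bar>) + A"
    if p: "1 \<le> p" and A: "Lp_norm (ereal p) a b r \<le> A" for p A
  proof -
    let ?q = "\<lambda>x. - (g a * (x - a) ^ n / fact n)"
    have qcont: "continuous_on {a..b} ?q" by (intro continuous_intros) auto
    have "Lp_norm (ereal p) a b ?q \<le>
        ereal ((b - a) powr (real n + 1 / p) / (real n * p + 1) powr (1 / p) * (\<bar>g a\<bar> / fact n))"
      using p by (intro Lp_norm_le_powr ab qcont) (auto simp: pw abs_mult)
    then have q: "Lp_norm (ereal p) a b ?q \<le>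
        ereal ((b - a) powr (real n + 1 / p) / (fact n * (real n * p + 1) powr (1 / p)) * \<bar>g a\<bar>)"
      by (simp add: mult_ac)
    have "R = (\<lambda>x. r x + ?q x)" using R_eq by blast
    then have "Lp_norm (ereal p) a b R \<le> Lp_norm (ereal p) a b r + Lp_norm (ereal p) a b ?q"
      using Minkowski_continuous[OF ab rcont qcont p] by simp
    also have "\<dots> \<le> A + ereal ((b - a) powr (real n + 1 / p) / (fact n * (real n * p + 1) powr (1 / p)) * \<bar>g a\<bar>)"
      by (rule add_mono[OF A q])
    finally show ?thesis by (simp add: add.commute)
  qed

  have gFTC: "(g has_integral nth_deriv_on {a..b} m f x - nth_deriv_on {a..b} m f a) {a..x}"
    if "x \<in> {a..b}" for x
  proof (rule fundamental_theorem_of_calculus)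
    fix t assume "t \<in> {a..x}"
    then have "(nth_deriv_on {a..b} m f has_vector_derivative g t) (at t within {a..b})"
      unfolding g_def n using that by (intro has_vector_derivative_nth_deriv_on[OF assms(3)]) (auto simp: n)
    then show "(nth_deriv_on {a..b} m f has_vector_derivative g t) (at t within {a..x})"
      by (rule has_vector_derivative_within_subset) (use that in auto)
  qed (use that in auto)

  \<comment> \<open>The pointwise Alexiewicz estimate one order lower, with \<open>g\<close> in the
    role of the derivative of order \<open>n + 1\<close>.\<close>
  have a1: "Lp_norm (ereal p) a b r \<le> ereal ((b - a) powr (real n - 1 + 1 / p) * alexiewicz_norm a b g
      / (fact (n - 1) * ((real n - 1) * p + 1) powr (1 / p)))" if p: "1 \<le> p" for p
  proof -
    have gint: "g integrable_on {a..b}" using gFTC[of b] ab by auto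
    have "\<bar>r x\<bar> \<le> alexiewicz_norm a b g / fact m * (x - a) powr real m" if "a < x" "x \<le> b" for x
    proof -
      have x: "x \<in> {a..b}" using that by simp
      have "times_differentiable_on m f {a..b}" using assms(3) by (simp add: times_differentiable_on_def n)
      then have "\<bar>r x\<bar> \<le> (x - a) ^ m / fact m * alexiewicz_norm a x (nth_deriv_on {a..b} (Suc m) f)"
        unfolding r_def using gFTC dercont[of m] rcont
        by (intro taylor_rem_le_alexiewicz_norm ab x) (auto simp: g_def n r_def)
      also have "\<dots> \<le> (x - a) ^ m / fact m * alexiewicz_norm a b g"
        unfolding n[symmetric] g_def[symmetric] using x gint
        by (intro mult_left_mono alexiewicz_norm_mono) auto
      finally show ?thesis using that by (simp add: powr_realpow mult.commute)
    qed
    then have "Lp_norm (ereal p) a b r \<le>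
        ereal ((b - a) powr (real m + 1 / p) / (real m * p + 1) powr (1 / p) * (alexiewicz_norm a b g / fact m))"
      using p gint ab by (intro Lp_norm_le_powr rcont divide_nonneg_nonneg alexiewicz_norm_nonneg) auto
    then show ?thesis by (simp add: n mult_ac)
  qed

  have a2: "Lp_norm (ereal p) a b r \<le> ereal ((b - a) powr (real n - 1 + 1 / p + 1 / \<beta>)
      / (fact (n - 1) * ((real n - 1) * \<beta> + 1) powr (1 / \<beta>) * ((real n - 1 + 1 / \<beta>) * p + 1) powr (1 / p)))
      * Lp_norm \<alpha> a b g"
    if p: "1 \<le> p" and \<alpha>\<beta>: "1 < \<alpha>" "1 / \<alpha> + 1 / ereal \<beta> = 1" for p \<alpha> \<beta>
    using \<alpha>\<beta>
  proof (cases rule: conjugate_exponents_cases)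
    \<comment> \<open>With \<open>\<beta> = 1\<close> the factor \<open>real m * \<beta> + 1\<close>
      is \<open>m + 1\<close> and merges with \<open>fact m\<close>.\<close>
    case 1
    then show ?thesis using Lp_norm_le_Linf_norm[OF p] by (simp add: n algebra_simps)
  next
    case (2 \<gamma>)
    then show ?thesis using Lp_norm_le_Lq_norm[OF p 2(2-4)] by (simp add: n)
  qed

  have c7: "Lp_norm (ereal p) a b r \<le> A"
    if p: "1 \<le> p" and
      A: "A = ereal ((b - a) powr (real n - 1 + 1 / p) * alexiewicz_norm a b g
             / (fact (n - 1) * ((real n - 1) * p + 1) powr (1 / p)))
        \<or> n = 1 \<and> A = Lp_norm (ereal p) a b (\<lambda>x. f x - f a)
        \<or> (\<exists>(\<alpha>::ereal) (\<beta>::real). 1 < \<alpha> \<and> 1 / \<alpha> + 1 / ereal \<beta> = 1 \<and>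
             A = ereal ((b - a) powr (real n - 1 + 1 / p + 1 / \<beta>)
                        / (fact (n - 1) * ((real n - 1) * \<beta> + 1) powr (1 / \<beta>)
                           * ((real n - 1 + 1 / \<beta>) * p + 1) powr (1 / p)))
                 * Lp_norm \<alpha> a b g)
        \<or> A = ereal ((b - a) powr (real n - 1 + 1 / p)
                     / (fact (n - 1) * ((real n - 1) * p + 1) powr (1 / p))) * Lp_norm 1 a b g
        \<or> A = ereal ((b - a) powr (1 - 1 / p)
                     / (fact (n - 1) * ((real n - 1) * p + 1) powr (1 / p))
                     * integral {a..b} (\<lambda>t. \<bar>g t\<bar> powr p * (b - t) powr ((real n - 1) * p + 1)) powr (1 / p))
        \<or> A = ereal ((b - a) powr (real n * (1 - 1 / p)) / fact n
                     * integral {a..b} (\<lambda>t. \<bar>g t\<bar> powr p * (b - t) ^ n) powr (1 / p))" for p A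
    using A
  proof (elim disjE exE conjE)
    assume "n = 1" "A = Lp_norm (ereal p) a b (\<lambda>x. f x - f a)"
    moreover from this have "r = (\<lambda>x. f x - f a)"
      by (auto simp: r_def n taylor_rem_def taylor_poly_def)
    ultimately show ?thesis by simp
  next
    assume "A = ereal ((b - a) powr (real n - 1 + 1 / p)
        / (fact (n - 1) * ((real n - 1) * p + 1) powr (1 / p))) * Lp_norm 1 a b g"
    then show ?thesis using Lp_norm_le_L1_norm[OF p] by (simp only: mn)
  next
    assume "A = ereal ((b - a) powr (1 - 1 / p) / (fact (n - 1) * ((real n - 1) * p + 1) powr (1 / p))
        * integral {a..b} (\<lambda>t. \<bar>g t\<bar> powr p * (b - t) powr ((real n - 1) * p + 1)) powr (1 / p))"
    then show ?thesis using Lp_norm_le_weighted1[OF p] by (simp only: mn)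
  next
    assume "A = ereal ((b - a) powr (real n * (1 - 1 / p)) / fact n
        * integral {a..b} (\<lambda>t. \<bar>g t\<bar> powr p * (b - t) ^ n) powr (1 / p))"
    then show ?thesis using Lp_norm_le_weighted2[OF p] by (simp only: n)
  qed (use a1[OF p] a2[OF p] in auto)
  show ?thesis
    unfolding g_def[symmetric] h_def[symmetric] R_def[symmetric] M_def[symmetric]
    using neg hint c1 R_le c3 c4 c5 c6 c7 by (intro conjI ballI allI impI) blast+
qed

end
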